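(* Let $\tau\in\mathbb Q$, $\bullet\in\{*,ш\}$, and let $\mathbf k=(k_1,\dots,k_r)$ be an index ($r\ge1$) with weight $k>r$. Then \begin{align*} &\sum_{i=1}^{r}\sum_{j=0}^{k_i-1}\zeta^{s,t,\tau,\bullet}_{\widehat{\mathcal S}}(j+1,\mathbf k^{[i]},\mathbf k_{[i-1]},k_i-j;T_1,T_2)-k\tau^r\zeta^{s,t,\star,\bullet}_{\widehat{\mathcal S}}(k+1;T_1,T_2)\\ &=\sum_{i=1}^{r}\sum_{j=0}^{\infty}\Bigl(\zeta^{s,t,\tau,\bullet}_{\widehat{\mathcal S}}(j+1,\mathbf k^{[i]},\mathbf k_{[i]};T_1,T_2)+(1-\tau)\zeta^{s,t,\tau,\bullet}_{\widehat{\mathcal S}}((j+1)\uplus\mathbf k^{[i]},\mathbf k_{[i]};T_1,T_2)\Bigr)t^j\\ &\quad+\sum_{i=1}^{r}\sum_{j=0}^{\infty}\Bigl(\zeta^{s,t,\tau,\bullet}_{\widehat{\mathcal S}}(\mathbf k^{[i]},\mathbf k_{[i]},j+1;T_1,T_2)+(1-\tau)\zeta^{s,t,\tau,\bullet}_{\widehat{\mathcal S}}(\mathbf k^{[i]},\mathbf k_{[i]}\uplus(j+1);T_1,T_2)\Bigr)s^j. \end{align*} Here $((j+1)\uplus\mathbf k^{[i]},\mathbf k_{[i]})$ means the concatenation of the index $(j+1)\uplus(\mathbf k^{[i]},\mathbf k_{[i]})$ (i.e. $j+1$ is added to the first entry of $(\mathbf k^{[i]},\mathbf k_{[i]})$),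 and $(\mathbf k^{[i]},\mathbf k_{[i]}\uplus(j+1))$ means $j+1$ is added to the last entry of $(\mathbf k^{[i]},\mathbf k_{[i]})$.
   Context: $s,t,T,T_1,T_2$ are commuting indeterminates. An index is a finite tuple $\mathbf{k}=(k_1,\dots,k_r)$ of positive integers ($r\ge0$), $\mathrm{dep}(\mathbf k)=r$, $\mathrm{wt}(\mathbf k)=\sum k_i$; $\mathbf{k}_{[i]}=(k_1,\dots,k_i)$, $\mathbf{k}^{[i]}=(k_{i+1},\dots,k_r)$, $\overleftarrow{\mathbf{k}}=(k_r,\dots,k_1)$; commas denote concatenation; $\oplus$ is componentwise sum and $b\binom{\mathbf{k}}{\mathbf{l}}=\prod_{i}\binom{k_i+l_i-1}{l_i}$. For non-empty $\mathbf k=(k_1,\dots,k_r)$, $\mathbf l=(l_1,\dots,l_{r'})$: $\mathbf k\uplus\mathbf l=(k_1,\dots,k_{r-1},k_r+l_1,l_2,\dots,l_{r'})$. MZVs $\zeta(\mathbf k)$ for admissible $\mathbf k$ (empty or $k_r\ge2$), $\mathcal Z$ the $\mathbb Q$-algebra they generate. $\zeta^{\bullet}(\mathbf k;T)$ is the harmonic ($\bullet=*$) or shuffle ($\bullet=ш$) regularized polynomial: with $\mathfrak H=\mathbb Q\langle e_0,e_1\rangle$, $e_{\mathbf{k}}=e_1e_0^{k_1-1}\cdots e_1e_0^{k_r-1}$, $Z^\bullet_T$ the unique $\mathbb Q$-algebra homomorphism $(\mathbb Q+e_1\mathfrak H,\bullet)\to\mathbb R[T]$ with $Z^\bullet_T(e_{\mathbf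 k})=(-1)^{\mathrm{dep}}\zeta(\mathbf k)$ for admissible $\mathbf k$ and $Z^\bullet_T(e_1)=-T$, $\zeta^\bullet(\mathbf k;T)=(-1)^{\mathrm{dep}(\mathbf k)}Z^\bullet_T(e_{\mathbf k})$. $\zeta^{t,\bullet}_{\mathrm{shift}}(\mathbf{k};T)=\sum_{\mathbf n\in\mathbb Z_{\ge0}^{\mathrm{dep}(\mathbf k)}}b\binom{\mathbf k}{\mathbf n}\zeta^{\bullet}(\mathbf k\oplus\mathbf n;T)(-t)^{\mathrm{wt}(\mathbf n)}$. $\zeta^{s,t,\bullet}_{\widehat{\mathcal S}}(\mathbf k;T_1,T_2)=\sum_{i=0}^{r}(-1)^{\mathrm{wt}(\mathbf k^{[i]})}\zeta^{s,\bullet}_{\mathrm{shift}}(\mathbf k_{[i]};T_1)\zeta^{-t,\bullet}_{\mathrm{shift}}(\overleftarrow{\mathbf k^{[i]}};T_2)$. $\mathbf l\preceq\mathbf k$ means $\mathbf l$ is obtained from $(k_1\circ\cdots\circ k_r)$ by replacing each $\circ$ by a comma or a plus sign. $\zeta^{s,t,\tau,\bullet}_{\widehat{\mathcal S}}(\mathbf k;T_1,T_2)=\sum_{\mathbf l\preceq\mathbf k}\zeta^{s,t,\bullet}_{\widehat{\mathcal S}}(\mathbf l;T_1,T_2)\tau^{\mathrm{dep}(\mathbf k)-\mathrm{dep}(\mathbf l)}$, and $\zeta^{s,t,\star,\bullet}_{\widehat{\mathcal S}}=\zeta^{s,t,1,\bullet}_{\widehat{\mathcal S}}$. *)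

theory Defs
  imports "HOL-Analysis.Analysis"
          "HOL-Computational_Algebra.Polynomial"
          "HOL-Computational_Algebra.Formal_Power_Series"
          "HOL-Library.Multiset"
begin

definition is_index :: "nat list \<Rightarrow> bool" where
  "is_index k \<longleftrightarrow> (\<forall>x\<in>set k. 0 < x)"

definition admissible :: "nat list \<Rightarrow> bool" where
  "admissible k \<longleftrightarrow> is_index k \<and> (k = [] \<or> 2 \<le> last k)"

definition mzv :: "nat list \<Rightarrow> real" where
  "mzv k = infsum (\<lambda>ns. \<Prod>i<length k. 1 / real (ns ! i) ^ (k ! i))
             {ns. length ns = length k \<and> sorted_wrt (<) ns \<and> (\<forall>n\<in>set ns. 0 < n)}"

text \<open>Words in e_0, e_1: True = e_1, False = e_0.  e_k = e_1 e_0^{k_1-1} ... e_1 e_0^{k_r-1}.\<close>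
definition i2w :: "nat list \<Rightarrow> bool list" where
  "i2w k = concat (map (\<lambda>n. True # replicate (n - 1) False) k)"

function w2i :: "bool list \<Rightarrow> nat list" where
  "w2i [] = []"
| "w2i (False # w) = w2i w"
| "w2i (True # w) = Suc (length (takeWhile Not w)) # w2i (dropWhile Not w)"
  by pat_completeness auto
termination
  by (relation "Wellfounded.measure length") (auto simp: le_imp_less_Suc length_dropWhile_le)

fun shw :: "bool list \<Rightarrow> bool list \<Rightarrow> bool list multiset" where
  "shw [] v = {#v#}"
| "shw u [] = {#u#}"
| "shw (a # u) (b # v) = image_mset ((#) a) (shw u (b # v)) + image_mset ((#) b) (shw (a # u) v)"

fun stuffle :: "nat list \<Rightarrow> nat list \<Rightarrow> nat list multiset" where
  "stuffle [] l = {#l#}"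
| "stuffle k [] = {#k#}"
| "stuffle (a # k) (b # l) = image_mset ((#) a) (stuffle k (b # l))
      + image_mset ((#) b) (stuffle (a # k) l) + image_mset ((#) (a + b)) (stuffle k l)"

datatype regtype = Harmonic | Shuffle

definition prod_expand :: "regtype \<Rightarrow> nat list \<Rightarrow> nat list \<Rightarrow> nat list multiset" where
  "prod_expand b k l = (case b of Harmonic \<Rightarrow> stuffle k l
                          | Shuffle \<Rightarrow> image_mset w2i (shw (i2w k) (i2w l)))"

text \<open>Regularized MZV polynomial zeta^bullet(k;T) in R[T]: the unique algebra homomorphism
  (for the harmonic resp. shuffle product) extending the MZVs with zeta^bullet(1;T) = T.
  Non-indices are sent to 0 (junk convention, only to make the description unique).\<close>
definition zeta_reg :: "regtype \<Rightarrow> nat list \<Rightarrow> real poly" where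
  "zeta_reg b = (THE Z.
      (\<forall>k. \<not> is_index k \<longrightarrow> Z k = 0) \<and>
      (\<forall>k. admissible k \<longrightarrow> Z k = [:mzv k:]) \<and>
      Z [1] = [:0, 1:] \<and>
      (\<forall>k l. is_index k \<longrightarrow> is_index l \<longrightarrow> Z k * Z l = (\<Sum>m\<in>#prod_expand b k l. Z m)))"

definition bcoef :: "nat list \<Rightarrow> nat list \<Rightarrow> nat" where
  "bcoef k n = (\<Prod>i<length k. (k ! i + n ! i - 1) choose (n ! i))"

definition zeta_shift :: "regtype \<Rightarrow> nat list \<Rightarrow> real poly fps" where
  "zeta_shift b k = Abs_fps (\<lambda>m. (-1) ^ m *
      (\<Sum>n\<in>{n. length n = length k \<and> sum_list n = m}.
          of_nat (bcoef k n) * zeta_reg b (map2 (+) k n)))"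

definition fps_negvar :: "'a::comm_ring_1 fps \<Rightarrow> 'a fps" where
  "fps_negvar F = Abs_fps (\<lambda>m. (-1) ^ m * fps_nth F m)"

text \<open>Coefficient ring R[T_1,T_2] = (R[T_2])[T_1]; series ring R[T_1,T_2][[t]][[s]]
  (outer fps variable s, inner fps variable t).\<close>
type_synonym biv = "real poly poly fps fps"

definition emb1 :: "real poly \<Rightarrow> real poly poly" where
  "emb1 p = map_poly (\<lambda>c. [:c:]) p"

definition emb2 :: "real poly \<Rightarrow> real poly poly" where
  "emb2 q = [:q:]"

definition svar :: biv where "svar = fps_X"
definition tvar :: biv where "tvar = fps_const fps_X"

definition sc :: "real \<Rightarrow> biv" where
  "sc x = fps_const (fps_const [:[:x:]:])"

definition lift_s :: "real poly fps \<Rightarrow> biv" where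
  "lift_s A = Abs_fps (\<lambda>a. fps_const (emb1 (fps_nth A a)))"

definition lift_t :: "real poly fps \<Rightarrow> biv" where
  "lift_t B = fps_const (Abs_fps (\<lambda>c. emb2 (fps_nth B c)))"

text \<open>Formal infinite sums sum_j X_j t^j and sum_j X_j s^j (coefficientwise finite).\<close>
definition fsum_t :: "(nat \<Rightarrow> biv) \<Rightarrow> biv" where
  "fsum_t X = Abs_fps (\<lambda>a. Abs_fps (\<lambda>c. \<Sum>j\<le>c. fps_nth (fps_nth (X j * tvar ^ j) a) c))"

definition fsum_s :: "(nat \<Rightarrow> biv) \<Rightarrow> biv" where
  "fsum_s X = Abs_fps (\<lambda>a. \<Sum>j\<le>a. fps_nth (X j * svar ^ j) a)"

definition zeta_S :: "regtype \<Rightarrow> nat list \<Rightarrow> biv" where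
  "zeta_S b k = (\<Sum>i=0..length k. (-1) ^ sum_list (drop i k) *
      (lift_s (zeta_shift b (take i k)) * lift_t (fps_negvar (zeta_shift b (rev (drop i k))))))"

fun coarsenings :: "nat list \<Rightarrow> nat list list" where
  "coarsenings [] = [[]]"
| "coarsenings [a] = [[a]]"
| "coarsenings (a # b # k) =
     map (\<lambda>l. a # l) (coarsenings (b # k)) @ map (\<lambda>l. (a + hd l) # tl l) (coarsenings (b # k))"

definition zeta_S_tau :: "rat \<Rightarrow> regtype \<Rightarrow> nat list \<Rightarrow> biv" where
  "zeta_S_tau \<tau> b k = (\<Sum>l\<leftarrow>coarsenings k. zeta_S b l * sc (of_rat \<tau>) ^ (length k - length l))"

definition zeta_S_star :: "regtype \<Rightarrow> nat list \<Rightarrow> biv" where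
  "zeta_S_star b k = zeta_S_tau 1 b k"

text \<open>k \<uplus> l for non-empty k, l.\<close>
definition uplus :: "nat list \<Rightarrow> nat list \<Rightarrow> nat list" where
  "uplus k l = butlast k @ [last k + hd l] @ tl l"

end

(* Replace each regularized MZV by the truncated sum over 0 < n_1 < ... < n_r <= M. Then
   zeta_S(k) becomes the monomial quasisymmetric polynomial M_k evaluated at the inverses of the
   ordered elements 1+s < 2+s < ... < M+s < -N+t < ... < -2+t < -1+t, and the tau-version becomes
   a sum over weak chains with a factor tau for each equality. Partial fractions telescope
   cyclically, and the two sides differ by an explicit error that is O(log^r(N)/M) for M <= N.

   The harmonic zeta(k;T) is the polynomial with zeta_M(k) = zeta(k; H_M) + (negligible). Taking
   N = M^c makes H_N close to c log M + gamma, and since c >= 1 is arbitrary the limit yields a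
   polynomial identity in T_1 and T_2 independently. The shuffle case follows: Abel summation
   (1-z) sum_N zeta_N(k) z^N is the multiple polylogarithm Li_k(z), whose behaviour at z -> 1 is
   the shuffle regularization, so every linear relation between the harmonic zeta(k;T) is also one
   between the shuffle zeta(k;T), and the identity is bilinear in these values. *)

theory Submission
  imports Defs "HOL-Real_Asymp.Real_Asymp"
begin

text \<open>Write x_p for the ordered elements. Partial fractions of an entry that is split over
  both ends of a chain produce 1 / (x_e - x_a), where the end e is free to move. The sum over e
  collapses because the x_p form arithmetic progressions: differences are integers inside a block
  and integers plus or minus s - t across the blocks. All sums over e are therefore differences of
  partial sums, and whatever depends on the distance of the two ends a, b of the chain cancels. What
  survives is the sum of 1 / (x_e - t) over e <= a and of 1 / (x_e - s) over e >= b; their geometric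
  expansions are the t^j and s^j series of the theorem. The cut-offs M and N leave an error of size
  about n / (M + 1 - n) + n / (N + 1) for a chain in the first block that starts at its n-th
  element, and symmetrically in the second. Weighted by 1 / n alone this does not tend to 0,
  weighted by 1 / n^2 it does. The second factor 1 / n is available because a weight larger than the
  depth forces an entry of at least 2.\<close>

section \<open>Monomial quasisymmetric polynomials and weighted chains\<close>

fun mqs :: "nat list \<Rightarrow> 'a::comm_ring_1 list \<Rightarrow> 'a" where
  "mqs [] ys = 1"
| "mqs (a # k) [] = 0"
| "mqs (a # k) (y # ys) = y ^ a * mqs k ys + mqs (a # k) ys"

lemma mqs_Nil_right: "mqs k [] = (if k = [] then 1 else 0)"
  by (cases k) auto

lemma sum_mset_mult_left: "(\<Sum>x\<in>#A. c * f x) = c * (\<Sum>x\<in>#A. f x :: 'a::comm_ring_1)"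
  by (induction A) (auto simp: algebra_simps)

text \<open>The first variable is used by the first factor, by the second, by both or by neither.
  The first three cases are the three summands of the stuffle recursion, the last one is the
  induction hypothesis.\<close>

lemma mqs_stuffle: "mqs k ys * mqs l ys = (\<Sum>m\<in>#stuffle k l. mqs m ys)"
proof (induction ys arbitrary: k l)
  case Nil
  show ?case
    by (cases k; cases l) (auto simp: mqs_Nil_right image_mset.compositionality o_def)
next
  case (Cons y ys)
  show ?case
  proof (cases k)
    case Nil
    then show ?thesis by simp
  next
    case k: (Cons a k')
    show ?thesis
    proof (cases l)
      case Nil
      then show ?thesis using k by simp
    next
      case l: (Cons b l')
      have *: "(\<Sum>m\<in>#image_mset ((#) c) A. mqs m (y # ys))
          = y ^ c * (\<Sum>m\<in>#A. mqs m ys) + (\<Sum>m\<in>#image_mset ((#) c) A. mqs m ys)" for c A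
        by (simp add: image_mset.compositionality o_def sum_mset.distrib sum_mset_mult_left)
      have "(\<Sum>m\<in>#stuffle k l. mqs m (y # ys)) =
          y ^ a * (\<Sum>m\<in>#stuffle k' l. mqs m ys) + y ^ b * (\<Sum>m\<in>#stuffle k l'. mqs m ys)
          + y ^ (a + b) * (\<Sum>m\<in>#stuffle k' l'. mqs m ys) + (\<Sum>m\<in>#stuffle k l. mqs m ys)"
        unfolding k l stuffle.simps image_mset_union sum_mset.union *
        by (simp add: algebra_simps)
      also have "\<dots> = y ^ a * (mqs k' ys * mqs l ys) + y ^ b * (mqs k ys * mqs l' ys)
          + y ^ (a + b) * (mqs k' ys * mqs l' ys) + mqs k ys * mqs l ys"
        by (simp only: Cons.IH)
      also have "\<dots> = mqs k (y # ys) * mqs l (y # ys)"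
        by (simp add: k l algebra_simps power_add)
      finally show ?thesis by simp
    qed
  qed
qed

text \<open>An increasing chain in a concatenated alphabet is cut where it leaves \<open>xs\<close>.
  With two blocks of variables this cut becomes the sum over \<open>i\<close> in
  \<open>zeta_S\<close>.\<close>

lemma mqs_append: "mqs k (xs @ ys) = (\<Sum>i\<le>length k. mqs (take i k) xs * mqs (drop i k) ys)"
proof (induction xs arbitrary: k)
  case Nil
  have "(\<Sum>i\<le>length k. mqs (take i k) [] * mqs (drop i k) ys)
     = (\<Sum>i\<le>length k. if i = 0 then mqs k ys else 0)"
    by (rule sum.cong) (auto simp: mqs_Nil_right)
  then show ?case by simp
next
  case (Cons x xs)
  show ?case
  proof (cases k)
    case Nil
    then show ?thesis by simp
  next
    case k: (Cons a k')
    have "mqs k ((x # xs) @ ys) = x ^ a * mqs k' (xs @ ys) + mqs k (xs @ ys)"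
      by (simp add: k)
    also have "\<dots> = (\<Sum>i\<le>length k'. x ^ a * (mqs (take i k') xs * mqs (drop i k') ys))
         + (\<Sum>i\<le>length k. mqs (take i k) xs * mqs (drop i k) ys)"
      by (simp only: Cons.IH sum_distrib_left)
    also have "\<dots> = (\<Sum>i\<le>length k. mqs (take i k) (x # xs) * mqs (drop i k) ys)"
      unfolding k length_Cons sum.atMost_Suc_shift
      by (simp add: sum.distrib algebra_simps)
    finally show ?thesis .
  qed
qed

lemma mqs_snoc: "mqs (k @ [a]) (ys @ [y]) = mqs (k @ [a]) ys + mqs k ys * y ^ a"
proof -
  have "mqs (k @ [a]) (ys @ [y])
      = (\<Sum>i\<le>Suc (length k). mqs (take i (k @ [a])) ys * mqs (drop i (k @ [a])) [y])"
    by (simp add: mqs_append)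
  also have "\<dots> = (\<Sum>i\<le>Suc (length k). (if i = Suc (length k) then mqs (k @ [a]) ys else 0)
       + (if i = length k then mqs k ys * y ^ a else 0))"
  proof (rule sum.cong)
    fix i assume "i \<in> {..Suc (length k)}"
    then consider "i = Suc (length k)" | "i = length k" | "i < length k" by force
    then show "mqs (take i (k @ [a])) ys * mqs (drop i (k @ [a])) [y]
      = (if i = Suc (length k) then mqs (k @ [a]) ys else 0)
       + (if i = length k then mqs k ys * y ^ a else 0)"
    proof cases
      case 3
      then have "drop i (k @ [a]) = k ! i # (drop (Suc i) k @ [a])"
        by (simp add: Cons_nth_drop_Suc)
      moreover obtain c d where "drop (Suc i) k @ [a] = c # d"
        by (cases "drop (Suc i) k @ [a]") auto
      ultimately have "mqs (drop i (k @ [a])) [y] = 0" by simp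
      with 3 show ?thesis by simp
    qed auto
  qed auto
  finally show ?thesis by (simp add: sum.distrib)
qed

lemma mqs_snoc': "k \<noteq> [] \<Longrightarrow>
    mqs k (ys @ [y]) = mqs k ys + mqs (butlast k) ys * y ^ last k"
  using mqs_snoc[of "butlast k" "last k" ys y] by simp

lemma mqs_rev: "mqs (rev k) (rev ys) = mqs k ys"
proof (induction ys arbitrary: k)
  case Nil
  then show ?case by (simp add: mqs_Nil_right)
next
  case (Cons y ys)
  then show ?case
    using Cons.IH[of "tl k"] Cons.IH[of k] by (cases k) (auto simp: mqs_snoc)
qed

lemma mqs_hom:
  assumes "\<And>x y. f (x + y) = f x + f y" "\<And>x y. f (x * y) = f x * f y" "f 0 = 0" "f 1 = 1"
  shows "f (mqs k ys) = mqs k (map f ys)"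
proof -
  have "f (x ^ n) = f x ^ n" for x n
    by (induction n) (auto simp: assms)
  then show ?thesis by (induction k ys rule: mqs.induct) (auto simp: assms)
qed

lemma mqs_uminus: "mqs k (map uminus ys) = (-1) ^ sum_list k * mqs k ys"
proof (induction k ys rule: mqs.induct)
  case (3 a k y ys)
  show ?case by (simp add: 3 power_add power_minus[of y] algebra_simps)
qed auto

definition mqs_tau :: "'a::comm_ring_1 \<Rightarrow> nat list \<Rightarrow> 'a list \<Rightarrow> 'a" where
  "mqs_tau \<tau> k ys = (\<Sum>l\<leftarrow>coarsenings k. mqs l ys * \<tau> ^ (length k - length l))"

lemma coarsenings_props:
  "l \<in> set (coarsenings k) \<Longrightarrow> length l \<le> length k \<and> (l = [] \<longleftrightarrow> k = [])"
proof (induction k arbitrary: l rule: coarsenings.induct)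
  case (3 a b k)
  then obtain m where m: "m \<in> set (coarsenings (b # k))" "l = a # m \<or> l = (a + hd m) # tl m"
    by auto
  from 3(1)[OF m(1)] have "length m \<le> length (b # k)" by blast
  with m(2) show ?case by auto
qed auto

lemma is_index_coarsenings:
  "is_index k \<Longrightarrow> l \<in> set (coarsenings k) \<Longrightarrow> is_index l"
proof (induction k arbitrary: l rule: coarsenings.induct)
  case (3 a b k)
  have k: "is_index (b # k)" "0 < a" using 3(3) by (simp_all add: is_index_def)
  obtain m where m: "m \<in> set (coarsenings (b # k))" "l = a # m \<or> l = (a + hd m) # tl m"
    using 3(4) by auto
  have "is_index m" by (rule 3(1)[OF k(1) m(1)])
  then have tl: "\<forall>x\<in>set (tl m). 0 < x"
    by (cases m) (simp_all add: is_index_def)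
  from m(2) show ?case
  proof
    assume "l = a # m"
    then show ?thesis using \<open>is_index m\<close> k(2) by (simp add: is_index_def)
  next
    assume "l = (a + hd m) # tl m"
    then show ?thesis using tl k(2) by (simp add: is_index_def)
  qed
qed simp_all

text \<open>Interpolates between strict chains (\<open>\<tau> = 0\<close>) and weak chains
  (\<open>\<tau> = 1\<close>).\<close>

definition weak_kernel :: "'a::comm_ring_1 \<Rightarrow> nat \<Rightarrow> nat \<Rightarrow> 'a" where
  "weak_kernel \<tau> a b = (if a < b then 1 else if a = b then \<tau> else 0)"

text \<open>The first position \<open>a\<close> and the last position \<open>b\<close> are kept
  fixed, because partial fractions and rotation act on the two ends. The empty index has no ends,
  hence the value 0.\<close>

fun chain :: "'a::comm_ring_1 \<Rightarrow> (nat \<Rightarrow> 'a) \<Rightarrow> nat \<Rightarrow> nat list \<Rightarrow> nat \<Rightarrow> nat \<Rightarrow> 'a" where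
  "chain \<tau> y P [] a b = 0"
| "chain \<tau> y P [k] a b = (if a = b then y a ^ k else 0)"
| "chain \<tau> y P (k # l # ks) a b
     = y a ^ k * (\<Sum>c<P. weak_kernel \<tau> a c * chain \<tau> y P (l # ks) c b)"

definition mqs_beg :: "(nat \<Rightarrow> 'a::comm_ring_1) \<Rightarrow> nat \<Rightarrow> nat list \<Rightarrow> nat \<Rightarrow> 'a" where
  "mqs_beg y P l p = y p ^ hd l * mqs (tl l) (map y [Suc p..<P])"

lemma sum_mqs_beg:
  assumes "l \<noteq> []" "c \<le> P"
  shows "mqs l (map y [c..<P]) = (\<Sum>p=c..<P. mqs_beg y P l p)"
  using assms(2)
proof (induction c rule: inc_induct)
  case base
  then show ?case using assms(1) by (simp add: mqs_Nil_right)
next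
  case (step c)
  obtain a k where "l = a # k" using assms(1) by (cases l) auto
  with step show ?case
    by (simp add: upt_conv_Cons sum.atLeast_Suc_lessThan mqs_beg_def)
qed

lemma weak_kernel_sum:
  assumes "a < P"
  shows "(\<Sum>c<P. weak_kernel \<tau> a c * f c) = \<tau> * f a + (\<Sum>c=Suc a..<P. f c)"
proof -
  have "(\<Sum>c<P. weak_kernel \<tau> a c * f c)
      = (\<Sum>c<P. (if c = a then \<tau> * f a else 0) + (if c \<in> {Suc a..<P} then f c else 0))"
    by (rule sum.cong) (auto simp: weak_kernel_def)
  also have "\<dots> = \<tau> * f a + (\<Sum>c\<in>{..<P} \<inter> {Suc a..<P}. f c)"
    using assms by (simp only: sum.distrib sum.inter_restrict[symmetric] finite_lessThan) (simp add: sum.delta)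
  also have "{..<P} \<inter> {Suc a..<P} = {Suc a..<P}" by auto
  finally show ?thesis .
qed

lemma sum_list_sum: "(\<Sum>x\<leftarrow>xs. \<Sum>p\<in>A. f x p) = (\<Sum>p\<in>A. \<Sum>x\<leftarrow>xs. f x p)"
  by (induction xs) (auto simp: sum.distrib)

text \<open>A coarsening of \<open>a # b # k\<close> either keeps the first comma, and then the next
  position is strictly later, or replaces it by a plus, and then the next entry sits at the same
  position at the price of one \<open>\<tau>\<close>. These are the two nonzero cases of
  \<open>weak_kernel\<close>.\<close>

lemma mqs_beg_tau:
  assumes "k \<noteq> []" "p < P"
  shows "(\<Sum>l\<leftarrow>coarsenings k. mqs_beg y P l p * \<tau> ^ (length k - length l))
       = (\<Sum>b<P. chain \<tau> y P k p b)"
  using assms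
proof (induction k arbitrary: p rule: coarsenings.induct)
  case (2 a)
  then show ?case by (simp add: mqs_beg_def)
next
  case (3 a b k)
  let ?C = "coarsenings (b # k)"
  have C: "length l \<le> Suc (length k)" "l \<noteq> []" if "l \<in> set ?C" for l
    using coarsenings_props[OF that] by auto
  have 1: "(\<Sum>l\<leftarrow>?C. mqs_beg y P (a # l) p * \<tau> ^ (length (a # b # k) - length (a # l)))
     = y p ^ a * (\<Sum>q=Suc p..<P. \<Sum>l\<leftarrow>?C. mqs_beg y P l q * \<tau> ^ (length (b # k) - length l))"
  proof -
    have "(\<Sum>l\<leftarrow>?C. mqs_beg y P (a # l) p * \<tau> ^ (length (a # b # k) - length (a # l)))
       = (\<Sum>l\<leftarrow>?C. \<Sum>q=Suc p..<P. y p ^ a * (mqs_beg y P l q * \<tau> ^ (length (b # k) - length l)))"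
    proof (rule arg_cong[where f = sum_list], rule map_cong)
      fix l assume "l \<in> set ?C"
      have "mqs_beg y P (a # l) p = y p ^ a * (\<Sum>q=Suc p..<P. mqs_beg y P l q)"
        unfolding mqs_beg_def[of y P "a # l"] list.sel
        by (subst sum_mqs_beg) (use C[OF \<open>l \<in> set ?C\<close>] 3 in auto)
      then show "mqs_beg y P (a # l) p * \<tau> ^ (length (a # b # k) - length (a # l))
        = (\<Sum>q=Suc p..<P. y p ^ a * (mqs_beg y P l q * \<tau> ^ (length (b # k) - length l)))"
        by (simp add: sum_distrib_left sum_distrib_right mult_ac)
    qed auto
    also have "\<dots> = y p ^ a * (\<Sum>q=Suc p..<P. \<Sum>l\<leftarrow>?C. mqs_beg y P l q * \<tau> ^ (length (b # k) - length l))"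
      by (simp only: sum_list_sum sum_list_const_mult sum_distrib_left)
    finally show ?thesis .
  qed
  have 2: "(\<Sum>l\<leftarrow>?C. mqs_beg y P ((a + hd l) # tl l) p
        * \<tau> ^ (length (a # b # k) - length ((a + hd l) # tl l)))
     = y p ^ a * (\<tau> * (\<Sum>l\<leftarrow>?C. mqs_beg y P l p * \<tau> ^ (length (b # k) - length l)))"
  proof -
    have "(\<Sum>l\<leftarrow>?C. mqs_beg y P ((a + hd l) # tl l) p
        * \<tau> ^ (length (a # b # k) - length ((a + hd l) # tl l)))
      = (\<Sum>l\<leftarrow>?C. y p ^ a * (\<tau> * (mqs_beg y P l p * \<tau> ^ (length (b # k) - length l))))"
    proof (rule arg_cong[where f = sum_list], rule map_cong)
      fix l assume "l \<in> set ?C"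
      from C[OF this] obtain h u where l: "l = h # u" "length u \<le> length k" by (cases l) auto
      then have "length (a # b # k) - length ((a + hd l) # tl l) = Suc (length (b # k) - length l)"
        by (simp add: Suc_diff_le)
      then show "mqs_beg y P ((a + hd l) # tl l) p
        * \<tau> ^ (length (a # b # k) - length ((a + hd l) # tl l))
        = y p ^ a * (\<tau> * (mqs_beg y P l p * \<tau> ^ (length (b # k) - length l)))"
        by (simp add: mqs_beg_def l power_add mult_ac)
    qed auto
    then show ?thesis by (simp only: sum_list_const_mult)
  qed
  have "(\<Sum>l\<leftarrow>coarsenings (a # b # k). mqs_beg y P l p * \<tau> ^ (length (a # b # k) - length l))
     = y p ^ a * (\<Sum>q=Suc p..<P. \<Sum>l\<leftarrow>?C. mqs_beg y P l q * \<tau> ^ (length (b # k) - length l))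
     + y p ^ a * (\<tau> * (\<Sum>l\<leftarrow>?C. mqs_beg y P l p * \<tau> ^ (length (b # k) - length l)))"
    unfolding 1[symmetric] 2[symmetric] by (simp add: o_def)
  also have "\<dots> = y p ^ a * (\<tau> * (\<Sum>e<P. chain \<tau> y P (b # k) p e)
       + (\<Sum>q=Suc p..<P. \<Sum>e<P. chain \<tau> y P (b # k) q e))"
    using 3 by (simp add: algebra_simps)
  also have "\<dots> = y p ^ a * (\<Sum>c<P. weak_kernel \<tau> p c * (\<Sum>e<P. chain \<tau> y P (b # k) c e))"
    using 3 by (simp only: weak_kernel_sum)
  also have "\<dots> = (\<Sum>e<P. chain \<tau> y P (a # b # k) p e)"
    unfolding chain.simps sum_distrib_left by (rule sum.swap)
  finally show ?case .
qed auto

lemma mqs_tau_chain: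
  assumes "k \<noteq> []"
  shows "mqs_tau \<tau> k (map y [0..<P]) = (\<Sum>a<P. \<Sum>b<P. chain \<tau> y P k a b)"
proof -
  have "mqs_tau \<tau> k (map y [0..<P])
    = (\<Sum>l\<leftarrow>coarsenings k. \<Sum>p<P. mqs_beg y P l p * \<tau> ^ (length k - length l))"
    unfolding mqs_tau_def
  proof (rule arg_cong[where f = sum_list], rule map_cong)
    fix l assume "l \<in> set (coarsenings k)"
    then have "l \<noteq> []" using coarsenings_props assms by blast
    then show "mqs l (map y [0..<P]) * \<tau> ^ (length k - length l)
      = (\<Sum>p<P. mqs_beg y P l p * \<tau> ^ (length k - length l))"
      using sum_mqs_beg[of l 0 P y] by (simp add: sum_distrib_right atLeast0LessThan)
  qed auto
  also have "\<dots> = (\<Sum>p<P. \<Sum>b<P. chain \<tau> y P k p b)"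
    using assms by (simp add: sum_list_sum mqs_beg_tau)
  finally show ?thesis .
qed

section \<open>Cyclic telescoping\<close>

text \<open>A chain whose ends \<open>a\<close> and \<open>b\<close> carry no power, so that there
  is one kernel more than there are entries. This is the shape of a rotation from which one entry
  has been removed; the entry can be attached again at either end.\<close>

fun chain_gap :: "'a::comm_ring_1 \<Rightarrow> (nat \<Rightarrow> 'a) \<Rightarrow> nat \<Rightarrow> nat list \<Rightarrow> nat \<Rightarrow> nat \<Rightarrow> 'a" where
  "chain_gap \<tau> y P [] a b = weak_kernel \<tau> a b"
| "chain_gap \<tau> y P (k # ks) a b = (\<Sum>c<P. weak_kernel \<tau> a c * y c ^ k * chain_gap \<tau> y P ks c b)"

lemma chain_Cons: "ks \<noteq> [] \<Longrightarrow> chain \<tau> y P (k # ks) a b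
    = y a ^ k * (\<Sum>c<P. weak_kernel \<tau> a c * chain \<tau> y P ks c b)"
  by (cases ks) auto

text \<open>Attached at \<open>a\<close>, the removed entry gives the rotation that begins with it,
  weakly followed by the free end \<open>b\<close>. By \<open>chain_gap_right\<close> the same gap
  also gives the rotation that ends with this entry, weakly preceded by a free end. The telescoping
  compares these two neighbouring rotations.\<close>

lemma chain_gap_left:
  assumes "a < P"
  shows "y a ^ k * chain_gap \<tau> y P ks a b = (\<Sum>c<P. chain \<tau> y P (k # ks) a c * weak_kernel \<tau> c b)"
  using assms
proof (induction ks arbitrary: k a)
  case Nil
  have "(\<Sum>c<P. chain \<tau> y P [k] a c * weak_kernel \<tau> c b)
      = (\<Sum>c<P. if c = a then y a ^ k * weak_kernel \<tau> a b else 0)"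
    by (rule sum.cong) auto
  then show ?case using Nil by simp
next
  case (Cons l ks)
  have "y a ^ k * chain_gap \<tau> y P (l # ks) a b
      = y a ^ k * (\<Sum>c<P. weak_kernel \<tau> a c * (\<Sum>e<P. chain \<tau> y P (l # ks) c e * weak_kernel \<tau> e b))"
    using Cons.IH by (simp add: mult.assoc)
  also have "\<dots> = (\<Sum>c<P. \<Sum>e<P. y a ^ k * weak_kernel \<tau> a c * chain \<tau> y P (l # ks) c e * weak_kernel \<tau> e b)"
    by (simp add: sum_distrib_left mult.assoc)
  also have "\<dots> = (\<Sum>e<P. \<Sum>c<P. y a ^ k * weak_kernel \<tau> a c * chain \<tau> y P (l # ks) c e * weak_kernel \<tau> e b)"
    by (rule sum.swap)
  also have "\<dots> = (\<Sum>e<P. chain \<tau> y P (k # l # ks) a e * weak_kernel \<tau> e b)"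
    by (simp add: sum_distrib_left sum_distrib_right mult.assoc)
  finally show ?case .
qed

lemma chain_gap_right:
  assumes "b < P"
  shows "chain_gap \<tau> y P ks a b * y b ^ k = (\<Sum>c<P. weak_kernel \<tau> a c * chain \<tau> y P (ks @ [k]) c b)"
  using assms
proof (induction ks arbitrary: a)
  case Nil
  have "(\<Sum>c<P. weak_kernel \<tau> a c * chain \<tau> y P [k] c b)
      = (\<Sum>c<P. if c = b then weak_kernel \<tau> a b * y b ^ k else 0)"
    by (rule sum.cong) auto
  then show ?case using Nil by simp
next
  case (Cons l ks)
  have "chain_gap \<tau> y P (l # ks) a b * y b ^ k
      = (\<Sum>c<P. weak_kernel \<tau> a c * (y c ^ l * (chain_gap \<tau> y P ks c b * y b ^ k)))"
    by (simp add: sum_distrib_left sum_distrib_right mult_ac)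
  also have "\<dots> = (\<Sum>c<P. weak_kernel \<tau> a c * chain \<tau> y P ((l # ks) @ [k]) c b)"
    using Cons by (simp add: chain_Cons)
  finally show ?case .
qed

lemma chain_both_ends:
  assumes "b < P"
  shows "chain \<tau> y P (k # ks @ [l]) a b = y a ^ k * chain_gap \<tau> y P ks a b * y b ^ l"
  using assms by (simp add: chain_Cons chain_gap_right[symmetric] mult.assoc)

lemma chain_gap_zero: "b < a \<Longrightarrow> chain_gap \<tau> y P ks a b = 0"
proof (induction ks arbitrary: a)
  case (Cons k ks)
  have "weak_kernel \<tau> a c * y c ^ k * chain_gap \<tau> y P ks c b = 0" for c
    using Cons by (cases "a \<le> c") (auto simp: weak_kernel_def)
  then show ?case by simp
qed (simp add: weak_kernel_def)

lemma chain_zero: "b < a \<Longrightarrow> chain \<tau> y P ks a b = 0"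
proof (induction ks arbitrary: a rule: induct_list012)
  case (3 k l ks)
  have "weak_kernel \<tau> a c * chain \<tau> y P (l # ks) c b = 0" for c
    using 3 by (cases "a \<le> c") (auto simp: weak_kernel_def)
  then show ?case by simp
qed auto

text \<open>A weak chain from \<open>a\<close> to \<open>a\<close> is constant, and each of its
  \<open>length ks + 1\<close> relations is an equality. This is the origin of the term with
  \<open>\<tau> ^ length k\<close> in the theorem.\<close>

lemma chain_gap_diag:
  assumes "a < P"
  shows "chain_gap \<tau> y P ks a a = \<tau> ^ Suc (length ks) * y a ^ sum_list ks"
proof (induction ks)
  case (Cons k ks)
  have "chain_gap \<tau> y P (k # ks) a a = (\<Sum>c<P. if c = a then \<tau> * y a ^ k * chain_gap \<tau> y P ks a a else 0)"
    unfolding chain_gap.simps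
    by (rule sum.cong) (auto simp: weak_kernel_def chain_gap_zero)
  then show ?case using assms Cons by (simp add: power_add mult_ac)
qed (simp add: weak_kernel_def)

lemma chain_Cons_add: "chain \<tau> y P ((c + h) # ks) a b = y a ^ c * chain \<tau> y P (h # ks) a b"
  by (cases ks) (auto simp: power_add mult_ac)

lemma chain_snoc_add:
  "chain \<tau> y P (ks @ [h + c]) a b = chain \<tau> y P (ks @ [h]) a b * y b ^ c"
proof (induction ks arbitrary: a)
  case (Cons k ks)
  then show ?case by (simp add: chain_Cons sum_distrib_right mult.assoc)
qed (simp add: power_add)

lemma chain_snoc:
  assumes "ks \<noteq> []" "a < P" "b < P"
  shows "chain \<tau> y P (ks @ [c]) a b = (\<Sum>e<P. chain \<tau> y P ks a e * weak_kernel \<tau> e b) * y b ^ c"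
proof -
  obtain k u where ks: "ks = k # u" using assms by (cases ks) auto
  show ?thesis
    unfolding ks append_Cons chain_both_ends[OF assms(3)] chain_gap_left[OF assms(2)] ..
qed

text \<open>For \<open>x = 1 / X\<close> and \<open>y = 1 / Y\<close> the hypothesis says that
  \<open>d\<close> is \<open>1 / (Y - X)\<close>. It is stated without division so that it applies
  in a ring of power series.\<close>

lemma partial_fraction_sum:
  fixes x y d :: "'a::comm_ring_1"
  assumes "d * (x - y) = x * y"
  shows "(\<Sum>j=0..<k. x ^ (j + 1) * y ^ (k - j)) = d * (x ^ k - y ^ k)"
proof -
  have "(\<Sum>j=0..<k. x ^ (j + 1) * y ^ (k - j)) = (\<Sum>j<k. (x * y) * (y ^ (k - Suc j) * x ^ j))"
    unfolding atLeast0LessThan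
  proof (rule sum.cong)
    fix j assume "j \<in> {..<k}"
    then have "y ^ (k - j) = y * y ^ (k - Suc j)"
      by (metis Suc_diff_Suc lessThan_iff power_Suc)
    then show "x ^ (j + 1) * y ^ (k - j) = (x * y) * (y ^ (k - Suc j) * x ^ j)"
      by (simp add: mult_ac)
  qed simp
  also have "\<dots> = d * ((x - y) * (\<Sum>j<k. y ^ (k - Suc j) * x ^ j))"
    by (simp only: assms[symmetric] sum_distrib_left mult.assoc)
  finally show ?thesis by (simp only: power_diff_sumr2)
qed

text \<open>The total factor that a rotation with ends \<open>a\<close>, \<open>b\<close> receives:
  the free end \<open>e\<close> either follows \<open>b\<close> weakly and is paired with
  \<open>a\<close>, or precedes \<open>a\<close> weakly and is paired with \<open>b\<close>.\<close>

definition cyc_kernel :: "'a::comm_ring_1 \<Rightarrow> (nat \<Rightarrow> nat \<Rightarrow> 'a) \<Rightarrow> nat \<Rightarrow> nat \<Rightarrow> nat \<Rightarrow> 'a" where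
  "cyc_kernel \<tau> d P a b = (\<Sum>e\<in>{..<P}-{a}. weak_kernel \<tau> b e * d a e)
       - (\<Sum>e\<in>{..<P}-{b}. weak_kernel \<tau> e a * d e b)"

lemma rotation_split:
  fixes k :: "nat list"
  assumes "1 \<le> i" "i \<le> length k"
  shows "drop (i - 1) k @ take (i - 1) k = k ! (i - 1) # (drop i k @ take (i - 1) k)"
    and "drop i k @ take i k = (drop i k @ take (i - 1) k) @ [k ! (i - 1)]"
    and "sum_list (drop i k @ take (i - 1) k) + k ! (i - 1) = sum_list k"
    and "length (drop i k @ take (i - 1) k) = length k - 1"
proof -
  have *: "i - 1 < length k" using assms by auto
  show 1: "drop (i - 1) k @ take (i - 1) k = k ! (i - 1) # (drop i k @ take (i - 1) k)"
    using Cons_nth_drop_Suc[OF *] assms by simp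
  show 2: "drop i k @ take i k = (drop i k @ take (i - 1) k) @ [k ! (i - 1)]"
    using take_Suc_conv_app_nth[OF *] assms by simp
  have "sum_list (take i k) + sum_list (drop i k) = sum_list k"
    by (metis append_take_drop_id sum_list.append)
  then show "sum_list (drop i k @ take (i - 1) k) + k ! (i - 1) = sum_list k"
    using arg_cong[OF 2, of sum_list] unfolding sum_list.append sum_list.Cons sum_list.Nil by linarith
  show "length (drop i k @ take (i - 1) k) = length k - 1"
    using assms by auto
qed

text \<open>Off the diagonal, partial fractions turn the summand of \<open>i\<close> into a term for
  rotation \<open>i - 1\<close> minus a term for rotation \<open>i\<close>. Shifting the first sum
  cyclically collects both on the same rotation, with the difference of the free-end sums as kernel.
  The diagonal \<open>a = b\<close> contributes \<open>k ! (i - 1)\<close> equal terms, which add up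
  to the subtracted term of weight \<open>sum_list k + 1\<close>.\<close>

lemma cyclic_telescoping:
  fixes y :: "nat \<Rightarrow> 'a::comm_ring_1"
  assumes d: "\<And>a b. a < P \<Longrightarrow> b < P \<Longrightarrow> a \<noteq> b \<Longrightarrow> d a b * (y a - y b) = y a * y b"
    and k: "length k \<ge> 1"
  shows "(\<Sum>i=1..length k. \<Sum>j=0..<k ! (i - 1). \<Sum>a<P. \<Sum>b<P.
            chain \<tau> y P ((j + 1) # drop i k @ take (i - 1) k @ [k ! (i - 1) - j]) a b)
         - of_nat (sum_list k) * \<tau> ^ length k * (\<Sum>a<P. y a ^ (sum_list k + 1))
       = (\<Sum>i=1..length k. \<Sum>a<P. \<Sum>b<P. chain \<tau> y P (drop i k @ take i k) a b * cyc_kernel \<tau> d P a b)"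
proof -
  let ?R = "\<lambda>i. drop i k @ take i k"
  let ?K = "\<lambda>i. drop i k @ take (i - 1) k"
  \<comment> \<open>\<open>d\<close> is constrained off the diagonal only; the value 0 on it lets
    all sums run over full squares.\<close>
  let ?D = "\<lambda>a b. if a = b then 0 else d a b"
  have one: "(\<Sum>j=0..<k ! (i - 1). \<Sum>a<P. \<Sum>b<P.
            chain \<tau> y P ((j + 1) # drop i k @ take (i - 1) k @ [k ! (i - 1) - j]) a b)
      = (\<Sum>a<P. \<Sum>c<P. chain \<tau> y P (?R (i - 1)) a c * (\<Sum>e\<in>{..<P}-{a}. weak_kernel \<tau> c e * d a e))
      - (\<Sum>a<P. \<Sum>c<P. chain \<tau> y P (?R i) a c * (\<Sum>e\<in>{..<P}-{c}. weak_kernel \<tau> e a * d e c))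
      + of_nat (k ! (i - 1)) * \<tau> ^ length k * (\<Sum>a<P. y a ^ (sum_list k + 1))"
    if i: "i \<in> {1..length k}" for i
  proof -
    let ?n = "k ! (i - 1)"
    note rs = rotation_split[of i k]
    have i': "1 \<le> i" "i \<le> length k" using i by auto
    have diag: "chain_gap \<tau> y P (?K i) a a * y a ^ (?n + 1) = \<tau> ^ length k * y a ^ (sum_list k + 1)"
      if "a < P" for a
    proof -
      have "Suc (length (?K i)) = length k" using rs(4)[OF i'] k by simp
      moreover have "sum_list (?K i) + (?n + 1) = sum_list k + 1" using rs(3)[OF i'] by simp
      ultimately show ?thesis
        unfolding chain_gap_diag[OF that] mult.assoc power_add[symmetric] by (simp only:)
    qed
    have "(\<Sum>j=0..<?n. \<Sum>a<P. \<Sum>b<P. chain \<tau> y P ((j + 1) # drop i k @ take (i - 1) k @ [?n - j]) a b)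
      = (\<Sum>j=0..<?n. \<Sum>a<P. \<Sum>b<P. chain_gap \<tau> y P (?K i) a b * (y a ^ (j + 1) * y b ^ (?n - j)))"
    proof (intro sum.cong refl)
      fix j a b assume "b \<in> {..<P}"
      then show "chain \<tau> y P ((j + 1) # drop i k @ take (i - 1) k @ [?n - j]) a b
        = chain_gap \<tau> y P (?K i) a b * (y a ^ (j + 1) * y b ^ (?n - j))"
        using chain_both_ends[of b P \<tau> y "j + 1" "?K i" "?n - j" a] by (simp add: mult_ac)
    qed
    also have "\<dots> = (\<Sum>a<P. \<Sum>b<P. chain_gap \<tau> y P (?K i) a b * (\<Sum>j=0..<?n. y a ^ (j + 1) * y b ^ (?n - j)))"
      unfolding sum_distrib_left by (subst sum.swap) (intro sum.cong refl sum.swap)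
    also have "\<dots> = (\<Sum>a<P. \<Sum>b<P. (y a ^ ?n * chain_gap \<tau> y P (?K i) a b) * ?D a b
           - (chain_gap \<tau> y P (?K i) a b * y b ^ ?n) * ?D a b
           + (if b = a then of_nat ?n * (\<tau> ^ length k * y a ^ (sum_list k + 1)) else 0))"
    proof (intro sum.cong refl)
      fix a b assume ab: "a \<in> {..<P}" "b \<in> {..<P}"
      show "chain_gap \<tau> y P (?K i) a b * (\<Sum>j=0..<?n. y a ^ (j + 1) * y b ^ (?n - j))
         = (y a ^ ?n * chain_gap \<tau> y P (?K i) a b) * ?D a b
           - (chain_gap \<tau> y P (?K i) a b * y b ^ ?n) * ?D a b
           + (if b = a then of_nat ?n * (\<tau> ^ length k * y a ^ (sum_list k + 1)) else 0)"
      proof (cases "a = b")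
        case True
        have "(\<Sum>j=0..<?n. y a ^ (j + 1) * y a ^ (?n - j)) = (\<Sum>j=0..<?n. y a ^ (?n + 1))"
          by (rule sum.cong) (auto simp: power_add[symmetric] simp del: power_Suc)
        then have "chain_gap \<tau> y P (?K i) a a * (\<Sum>j=0..<?n. y a ^ (j + 1) * y a ^ (?n - j))
            = of_nat ?n * (chain_gap \<tau> y P (?K i) a a * y a ^ (?n + 1))"
          by (simp add: mult_ac)
        then show ?thesis using diag[of a] ab True by simp
      next
        case False
        then have *: "(\<Sum>j=0..<?n. y a ^ (j + 1) * y b ^ (?n - j)) = d a b * (y a ^ ?n - y b ^ ?n)"
          using partial_fraction_sum[OF d[of a b], of ?n] ab by simp
        show ?thesis unfolding * using False by (simp add: algebra_simps)
      qed
    qed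
    also have "\<dots> = (\<Sum>a<P. \<Sum>b<P. (y a ^ ?n * chain_gap \<tau> y P (?K i) a b) * ?D a b)
           - (\<Sum>a<P. \<Sum>b<P. (chain_gap \<tau> y P (?K i) a b * y b ^ ?n) * ?D a b)
           + of_nat ?n * \<tau> ^ length k * (\<Sum>a<P. y a ^ (sum_list k + 1))"
      by (simp add: sum.distrib sum_subtractf sum_distrib_left mult.assoc)
    also have "(\<Sum>a<P. \<Sum>b<P. (y a ^ ?n * chain_gap \<tau> y P (?K i) a b) * ?D a b)
        = (\<Sum>a<P. \<Sum>b<P. \<Sum>c<P. chain \<tau> y P (?R (i - 1)) a c * (weak_kernel \<tau> c b * ?D a b))"
      unfolding rs(1)[OF i'] using chain_gap_left[of _ P y ?n \<tau> "?K i"]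
      by (intro sum.cong refl) (simp add: sum_distrib_right mult.assoc)
    also have "\<dots> = (\<Sum>a<P. \<Sum>c<P. \<Sum>b<P. chain \<tau> y P (?R (i - 1)) a c * (weak_kernel \<tau> c b * ?D a b))"
      by (intro sum.cong refl sum.swap)
    also have "\<dots> = (\<Sum>a<P. \<Sum>c<P. chain \<tau> y P (?R (i - 1)) a c * (\<Sum>e\<in>{..<P}-{a}. weak_kernel \<tau> c e * d a e))"
      unfolding sum_distrib_left[symmetric]
      by (intro sum.cong refl arg_cong2[where f = "(*)"] sum.mono_neutral_cong_right) auto
    also have "(\<Sum>a<P. \<Sum>b<P. (chain_gap \<tau> y P (?K i) a b * y b ^ ?n) * ?D a b)
        = (\<Sum>a<P. \<Sum>b<P. \<Sum>c<P. chain \<tau> y P (?R i) c b * (weak_kernel \<tau> a c * ?D a b))"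
      unfolding rs(2)[OF i'] using chain_gap_right[of _ P \<tau> y "?K i" _ ?n]
      by (intro sum.cong refl) (simp add: sum_distrib_right sum_distrib_left mult_ac)
    also have "\<dots> = (\<Sum>b<P. \<Sum>a<P. \<Sum>c<P. chain \<tau> y P (?R i) c b * (weak_kernel \<tau> a c * ?D a b))"
      by (rule sum.swap)
    also have "\<dots> = (\<Sum>b<P. \<Sum>c<P. \<Sum>a<P. chain \<tau> y P (?R i) c b * (weak_kernel \<tau> a c * ?D a b))"
      by (intro sum.cong refl sum.swap)
    also have "\<dots> = (\<Sum>c<P. \<Sum>b<P. \<Sum>a<P. chain \<tau> y P (?R i) c b * (weak_kernel \<tau> a c * ?D a b))"
      by (rule sum.swap)
    also have "\<dots> = (\<Sum>a<P. \<Sum>c<P. chain \<tau> y P (?R i) a c * (\<Sum>e\<in>{..<P}-{c}. weak_kernel \<tau> e a * d e c))"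
      unfolding sum_distrib_left[symmetric]
      by (intro sum.cong refl arg_cong2[where f = "(*)"] sum.mono_neutral_cong_right) auto
    finally show ?thesis .
  qed
  define A where "A i = (\<Sum>a<P. \<Sum>c<P. chain \<tau> y P (?R i) a c * (\<Sum>e\<in>{..<P}-{a}. weak_kernel \<tau> c e * d a e))" for i
  define B where "B i = (\<Sum>a<P. \<Sum>c<P. chain \<tau> y P (?R i) a c * (\<Sum>e\<in>{..<P}-{c}. weak_kernel \<tau> e a * d e c))" for i
  have wt: "(\<Sum>i=1..length k. k ! (i - 1)) = sum_list k"
    unfolding sum_list_sum_nth
    by (rule sum.reindex_bij_witness[of _ Suc "\<lambda>i. i - 1"]) auto
  \<comment> \<open>Rotating by \<open>length k\<close> is the identity; this closes the
    cycle.\<close>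
  have "A 0 = A (length k)" by (simp add: A_def)
  have A: "(\<Sum>i=1..length k. A (i - 1)) = (\<Sum>i=1..length k. A i)"
  proof -
    have "(\<Sum>i=1..length k. A (i - 1)) = (\<Sum>i<length k. A i)"
      by (rule sum.reindex_bij_witness[of _ Suc "\<lambda>i. i - 1"]) auto
    also have "\<dots> = (\<Sum>i<length k. A (Suc i))"
      using sum.lessThan_Suc[of A "length k"] sum.lessThan_Suc_shift[of A "length k"] \<open>A 0 = A (length k)\<close>
      by simp
    also have "\<dots> = (\<Sum>i=1..length k. A i)"
      by (rule sum.reindex_bij_witness[of _ "\<lambda>i. i - 1" Suc]) auto
    finally show ?thesis .
  qed
  have "(\<Sum>i=1..length k. \<Sum>j=0..<k ! (i - 1). \<Sum>a<P. \<Sum>b<P.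
            chain \<tau> y P ((j + 1) # drop i k @ take (i - 1) k @ [k ! (i - 1) - j]) a b)
      = (\<Sum>i=1..length k. A (i - 1) - B i + of_nat (k ! (i - 1)) * \<tau> ^ length k * (\<Sum>a<P. y a ^ (sum_list k + 1)))"
    by (rule sum.cong) (simp_all only: one A_def B_def)
  also have "\<dots> = (\<Sum>i=1..length k. A i) - (\<Sum>i=1..length k. B i)
      + of_nat (sum_list k) * \<tau> ^ length k * (\<Sum>a<P. y a ^ (sum_list k + 1))"
    by (simp add: sum.distrib sum_subtractf A wt[symmetric] sum_distrib_right del: One_nat_def)
  also have "(\<Sum>i=1..length k. A i) - (\<Sum>i=1..length k. B i)
      = (\<Sum>i=1..length k. \<Sum>a<P. \<Sum>b<P. chain \<tau> y P (?R i) a b * cyc_kernel \<tau> d P a b)"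
    by (simp only: A_def B_def cyc_kernel_def right_diff_distrib sum_subtractf)
  finally show ?thesis by simp
qed

section \<open>The telescoping kernel on two blocks of an arithmetic progression\<close>

definition psum :: "(nat \<Rightarrow> 'a::ab_group_add) \<Rightarrow> nat \<Rightarrow> 'a" where
  "psum f n = (\<Sum>i<n. f (Suc i))"

lemma psum_Suc: "psum f (Suc n) = psum f n + f (Suc n)"
  by (simp add: psum_def)

lemma psum_0 [simp]: "psum f 0 = 0"
  by (simp add: psum_def)

lemma sum_shift_psum:
  "p \<le> q \<Longrightarrow> (\<Sum>e=p..<q. f (Suc (e + c))) = psum f (q + c) - psum f (p + c)"
  by (induction q rule: dec_induct) (auto simp: psum_Suc)

lemma sum_diff_psum:
  assumes "a < p" "p \<le> q"
  shows "(\<Sum>e=p..<q. f (e - a)) = psum f (q - Suc a) - psum f (p - Suc a)"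
  using assms(2)
proof (induction q rule: dec_induct)
  case (step q)
  then have "Suc q - Suc a = Suc (q - Suc a)" "q - a = Suc (q - Suc a)" using assms by auto
  with step show ?case by (simp add: psum_Suc)
qed simp

lemma sum_reflect_psum:
  assumes "q \<le> C" "p \<le> q"
  shows "(\<Sum>e=p..<q. f (C - e)) = psum f (C - p) - psum f (C - q)"
  using assms(2,1)
proof (induction q rule: dec_induct)
  case (step q)
  then have "C - q = Suc (C - Suc q)" by auto
  then have "psum f (C - q) = psum f (C - Suc q) + f (C - q)" by (simp add: psum_Suc)
  with step show ?case by simp
qed simp

text \<open>With \<open>v d = 1 / d\<close> and \<open>u d = 1 / (d + s - t)\<close> this is
  \<open>1 / (x_b - x_a)\<close>, where \<open>x_p\<close> is the element at position
  \<open>p\<close>, that is \<open>p + 1 + s\<close> for \<open>p < M\<close> and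
  \<open>t - (M + N - p)\<close> otherwise.\<close>

definition diff_inv :: "(nat \<Rightarrow> 'a) \<Rightarrow> (nat \<Rightarrow> 'a) \<Rightarrow> nat \<Rightarrow> nat \<Rightarrow> nat \<Rightarrow> nat \<Rightarrow> 'a::comm_ring_1" where
  "diff_inv v u M N a b = (if (a < M) = (b < M) then (if a < b then v (b - a) else - v (a - b))
      else if a < M then - u (M + N + Suc a - b) else u (M + N + Suc b - a))"

text \<open>In the same notation, \<open>end_low\<close> is \<open>1 / (x_e - t)\<close> and
  \<open>end_high\<close> is \<open>1 / (x_e - s)\<close>.\<close>

definition end_low :: "(nat \<Rightarrow> 'a) \<Rightarrow> (nat \<Rightarrow> 'a) \<Rightarrow> nat \<Rightarrow> nat \<Rightarrow> nat \<Rightarrow> 'a::comm_ring_1" where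
  "end_low v u M N e = (if e < M then u (Suc e) else - v (M + N - e))"

definition end_high :: "(nat \<Rightarrow> 'a) \<Rightarrow> (nat \<Rightarrow> 'a) \<Rightarrow> nat \<Rightarrow> nat \<Rightarrow> nat \<Rightarrow> 'a::comm_ring_1" where
  "end_high v u M N e = (if e < M then v (Suc e) else - u (M + N - e))"

text \<open>What the cut-offs leave: short stretches of the partial sums of \<open>v\<close> and
  \<open>u\<close> next to \<open>M\<close> and \<open>N\<close>. A chain that crosses from the
  first block to the second has no error at all.\<close>

definition cyc_error :: "(nat \<Rightarrow> 'a) \<Rightarrow> (nat \<Rightarrow> 'a) \<Rightarrow> nat \<Rightarrow> nat \<Rightarrow> nat \<Rightarrow> nat \<Rightarrow> 'a::comm_ring_1" where
  "cyc_error v u M N a b =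
     (if b < M then - (psum v M - psum v (M - Suc a)) - (psum u (N + Suc a) - psum u N)
      else if a < M then 0
      else (psum v N - psum v (b - M)) + (psum u (M + (M + N - b)) - psum u M))"

text \<open>For \<open>a \<noteq> b\<close> the terms \<open>e = b\<close> of the first sum and
  \<open>e = a\<close> of the second both equal \<open>\<tau> * d a b\<close>, so
  \<open>\<tau>\<close> drops out of the difference.\<close>

lemma cyc_kernel_le:
  assumes "a \<le> b" "b < P"
  shows "cyc_kernel \<tau> d P a b = (\<Sum>e=Suc b..<P. d a e) - (\<Sum>e=0..<a. d e b)"
proof -
  have "(\<Sum>e\<in>{..<P}-{a}. weak_kernel \<tau> b e * d a e)
     = (\<Sum>e<P. weak_kernel \<tau> b e * (if e = a then 0 else d a e))"
    by (intro sum.mono_neutral_cong_left) auto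
  also have "\<dots> = \<tau> * (if b = a then 0 else d a b) + (\<Sum>e=Suc b..<P. d a e)"
    unfolding weak_kernel_sum[OF assms(2)]
    using assms by (intro arg_cong2[where f = "(+)"] refl sum.cong) auto
  finally have 1: "(\<Sum>e\<in>{..<P}-{a}. weak_kernel \<tau> b e * d a e)
     = \<tau> * (if b = a then 0 else d a b) + (\<Sum>e=Suc b..<P. d a e)" .
  have "(\<Sum>e\<in>{..<P}-{b}. weak_kernel \<tau> e a * d e b)
     = (\<Sum>e<P. (if e = a then \<tau> * (if b = a then 0 else d a b) else 0) + (if e \<in> {0..<a} then d e b else 0))"
    using assms by (intro sum.mono_neutral_cong_left) (auto simp: weak_kernel_def)
  also have "\<dots> = \<tau> * (if b = a then 0 else d a b) + (\<Sum>e\<in>{..<P} \<inter> {0..<a}. d e b)"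
    using assms by (simp only: sum.distrib sum.inter_restrict[symmetric] finite_lessThan) (simp add: sum.delta)
  also have "{..<P} \<inter> {0..<a} = {0..<a}" using assms by auto
  finally show ?thesis unfolding cyc_kernel_def 1 by simp
qed

text \<open>On each block the summands are values of \<open>v\<close> or \<open>u\<close> at
  consecutive integers, so every sum is a difference of two values of \<open>psum\<close>. If both
  ends lie in the same block, \<open>psum v (b - a)\<close> occurs in both parts of the kernel and
  cancels; if they lie in different blocks, \<open>psum u (a + (M + N - b))\<close> cancels and the
  identity is exact.\<close>

lemma cyc_kernel_eq_error:
  fixes v u :: "nat \<Rightarrow> 'a::comm_ring_1"
  assumes ab: "a \<le> b" "b < M + N"
  shows "cyc_kernel \<tau> (diff_inv v u M N) (M + N) a b
     = (\<Sum>e=0..<Suc a. end_low v u M N e) + (\<Sum>e=b..<M+N. end_high v u M N e) + cyc_error v u M N a b"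
proof -
  let ?d = "diff_inv v u M N"
  have split: "(\<Sum>e=p..<q. f e) = (\<Sum>e=p..<M. f e) + (\<Sum>e=M..<q. f e)"
    if "p \<le> M" "M \<le> q" for p q and f :: "nat \<Rightarrow> 'a"
    using sum.atLeastLessThan_concat[OF that, of f] by simp
  have high_neg: "(\<Sum>e=p..<M+N. end_high v u M N e) = - psum u (M + N - p)" if "M \<le> p" "p \<le> M + N" for p
  proof -
    have "(\<Sum>e=p..<M+N. end_high v u M N e) = - (\<Sum>e=p..<M+N. u (M + N - e))"
      unfolding sum_negf[symmetric] using that by (intro sum.cong) (auto simp: end_high_def)
    then show ?thesis using sum_reflect_psum[of "M + N" "M + N" p u] that by simp
  qed
  have low_pos: "(\<Sum>e=0..<p. end_low v u M N e) = psum u p" if "p \<le> M" for p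
  proof -
    have "(\<Sum>e=0..<p. end_low v u M N e) = (\<Sum>e=0..<p. u (Suc (e + 0)))"
      using that by (intro sum.cong) (auto simp: end_low_def)
    then show ?thesis using sum_shift_psum[of 0 p u 0] by simp
  qed
  have up_neg: "(\<Sum>e=M..<M+N. ?d a e) = - (psum u (N + Suc a) - psum u (Suc a))" if "a < M"
  proof -
    have "(\<Sum>e=M..<M+N. ?d a e) = - (\<Sum>e=M..<M+N. u (M + N + Suc a - e))"
      unfolding sum_negf[symmetric] using that by (intro sum.cong) (auto simp: diff_inv_def)
    then show ?thesis using sum_reflect_psum[of "M + N" "M + N + Suc a" M u] that by simp
  qed
  have down_pos: "(\<Sum>e=0..<p. ?d e b) = - (psum u (p + (M + N - b)) - psum u (M + N - b))"
    if "M \<le> b" "p \<le> M" for p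
  proof -
    have "(\<Sum>e=0..<p. ?d e b) = - (\<Sum>e=0..<p. u (Suc (e + (M + N - b))))"
      unfolding sum_negf[symmetric]
      using that ab by (intro sum.cong) (auto simp: diff_inv_def Suc_diff_le add.commute)
    then show ?thesis using sum_shift_psum[of 0 p u "M + N - b"] by simp
  qed
  consider "b < M" | "a < M" "M \<le> b" | "M \<le> a" using ab by linarith
  then show ?thesis
  proof cases
    case 1
    have "(\<Sum>e=Suc b..<M. ?d a e) = (\<Sum>e=Suc b..<M. v (e - a))"
      using ab 1 by (intro sum.cong) (auto simp: diff_inv_def)
    also have "\<dots> = psum v (M - Suc a) - psum v (b - a)"
      using sum_diff_psum[of a "Suc b" M v] ab 1 by simp
    finally have s1: "(\<Sum>e=Suc b..<M. ?d a e) = psum v (M - Suc a) - psum v (b - a)" .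
    have "(\<Sum>e=0..<a. ?d e b) = (\<Sum>e=0..<a. v (b - e))"
      using ab 1 by (intro sum.cong) (auto simp: diff_inv_def)
    also have "\<dots> = psum v b - psum v (b - a)"
      using sum_reflect_psum[of a b 0 v] ab by simp
    finally have s2: "(\<Sum>e=0..<a. ?d e b) = psum v b - psum v (b - a)" .
    have "(\<Sum>e=b..<M. end_high v u M N e) = (\<Sum>e=b..<M. v (Suc (e + 0)))"
      by (intro sum.cong) (auto simp: end_high_def)
    also have "\<dots> = psum v M - psum v b"
      using sum_shift_psum[of b M v 0] 1 by simp
    finally have s3: "(\<Sum>e=b..<M. end_high v u M N e) = psum v M - psum v b" .
    show ?thesis
      unfolding cyc_kernel_le[OF ab] cyc_error_def
      using ab 1 s1 s2 s3 up_neg low_pos[of "Suc a"] high_neg[of M]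
        split[of "Suc b" "M + N" "?d a"] split[of b "M + N" "end_high v u M N"]
      by simp
  next
    case 2
    have "(\<Sum>e=Suc b..<M + N. ?d a e) = - (\<Sum>e=Suc b..<M+N. u (M + N + Suc a - e))"
      unfolding sum_negf[symmetric] using 2 by (intro sum.cong) (auto simp: diff_inv_def)
    also have "\<dots> = - (psum u (M + N + Suc a - Suc b) - psum u (Suc a))"
      using sum_reflect_psum[of "M + N" "M + N + Suc a" "Suc b" u] 2 ab by simp
    also have "M + N + Suc a - Suc b = a + (M + N - b)" using ab by simp
    finally have s1: "(\<Sum>e=Suc b..<M + N. ?d a e) = - (psum u (a + (M + N - b)) - psum u (Suc a))" .
    show ?thesis
      unfolding cyc_kernel_le[OF ab] cyc_error_def s1
      using 2 ab low_pos[of "Suc a"] high_neg[of b] down_pos[of a] by simp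
  next
    case 3
    have "(\<Sum>e=Suc b..<M + N. ?d a e) = (\<Sum>e=Suc b..<M + N. v (e - a))"
      using ab 3 by (intro sum.cong) (auto simp: diff_inv_def)
    also have "\<dots> = psum v (M + N - Suc a) - psum v (b - a)"
      using sum_diff_psum[of a "Suc b" "M + N" v] ab by simp
    finally have s1: "(\<Sum>e=Suc b..<M + N. ?d a e) = psum v (M + N - Suc a) - psum v (b - a)" .
    have "(\<Sum>e=M..<a. ?d e b) = (\<Sum>e=M..<a. v (b - e))"
      using ab 3 by (intro sum.cong) (auto simp: diff_inv_def)
    also have "\<dots> = psum v (b - M) - psum v (b - a)"
      using sum_reflect_psum[of a b M v] ab 3 by simp
    finally have s2: "(\<Sum>e=M..<a. ?d e b) = psum v (b - M) - psum v (b - a)" .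
    have "(\<Sum>e=M..<Suc a. end_low v u M N e) = - (\<Sum>e=M..<Suc a. v (M + N - e))"
      unfolding sum_negf[symmetric] by (intro sum.cong) (auto simp: end_low_def)
    also have "\<dots> = - (psum v N - psum v (M + N - Suc a))"
      using sum_reflect_psum[of "Suc a" "M + N" M v] ab 3 by simp
    finally have s3: "(\<Sum>e=M..<Suc a. end_low v u M N e) = - (psum v N - psum v (M + N - Suc a))" .
    show ?thesis
      unfolding cyc_kernel_le[OF ab] cyc_error_def
      using ab 3 s1 s2 s3 down_pos[of M] low_pos[of M] high_neg[of b]
        split[of 0 a "\<lambda>e. ?d e b"] split[of 0 "Suc a" "end_low v u M N"]
      by simp
  qed
qed

section \<open>Regularization by asymptotic expansion\<close>

text \<open>The predicate is a parameter because trailing entries 1 of an index and trailing letters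
  \<open>True\<close> of its word are both counted; \<open>trailing_i2w\<close> identifies the two
  numbers.\<close>

definition trailing :: "('a \<Rightarrow> bool) \<Rightarrow> 'a list \<Rightarrow> nat" where
  "trailing P xs = length (takeWhile P (rev xs))"

lemma trailing_snoc: "trailing P (xs @ [x]) = (if P x then Suc (trailing P xs) else 0)"
  by (simp add: trailing_def)

lemma trailing_Nil [simp]: "trailing P [] = 0"
  by (simp add: trailing_def)

lemma trailing_Cons:
  "trailing P (x # xs) = (if P x \<and> (\<forall>y\<in>set xs. P y) then Suc (length xs) else trailing P xs)"
proof (induction xs rule: rev_induct)
  case Nil
  then show ?case using trailing_snoc[of P "[]" x] by simp
next
  case (snoc y xs)
  then show ?case using trailing_snoc[of P "x # xs" y] by (auto simp: trailing_snoc)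
qed

lemma trailing_le: "trailing P xs \<le> length xs"
  by (metis length_rev length_takeWhile_le trailing_def)

lemma trailing_eq_length: "trailing P xs = length xs \<longleftrightarrow> (\<forall>y\<in>set xs. P y)"
proof -
  have "length (takeWhile P ys) = length ys \<longleftrightarrow> takeWhile P ys = ys" for ys
    by (metis order_refl takeWhile_eq_take take_all)
  from this[of "rev xs"] show ?thesis
    by (simp add: trailing_def takeWhile_eq_all_conv)
qed

text \<open>The length condition serves the case in which all of \<open>m\<close> is trailing: then
  \<open>l\<close> has the same length and is trailing as well, so that \<open>x\<close> extends
  both or neither.\<close>

lemma trailing_Cons_mono:
  assumes "trailing P m \<le> trailing P l" "length l \<le> length m"
  shows "trailing P (x # m) \<le> trailing P (x # l)"
proof (cases "\<forall>y\<in>set m. P y")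
  case True
  then have "trailing P m = length m" by (simp add: trailing_eq_length)
  then have l: "trailing P l = length l" "length l = length m"
    using assms trailing_le[of P l] by auto
  then have "\<forall>y\<in>set l. P y" by (simp add: trailing_eq_length[symmetric])
  then show ?thesis using True l assms by (auto simp: trailing_Cons)
next
  case False
  then show ?thesis using assms trailing_le[of P l] by (auto simp: trailing_Cons)
qed

text \<open>A 1 that is inserted before an entry different from 1, or added to an entry, cannot
  lengthen the final run of ones. Inserted anywhere within this run it yields the same list as
  appending it.\<close>

lemma stuffle_one_props:
  "m \<in># stuffle [1] k \<Longrightarrow> length k \<le> length m \<and> (is_index k \<longrightarrow> is_index m)
     \<and> (is_index k \<longrightarrow> m = k @ [1] \<or> trailing ((=) 1) m \<le> trailing ((=) 1) k)"
proof (induction k arbitrary: m)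
  case Nil
  then show ?case by (simp add: is_index_def)
next
  case (Cons x k)
  have ix: "is_index (x # k) \<longleftrightarrow> 0 < x \<and> is_index k" for x k by (simp add: is_index_def)
  from Cons.prems consider "m = 1 # x # k" | m' where "m = x # m'" "m' \<in># stuffle [1] k" | "m = Suc x # k"
    by auto
  then show ?case
  proof cases
    case 1
    have "1 # x # k = (x # k) @ [1]" if "\<forall>y\<in>set (x # k). 1 = y"
    proof -
      have "x # k = replicate (length (x # k)) 1"
        using that by (metis (full_types) replicate_length_same)
      then show ?thesis by (metis append_Cons replicate_Suc replicate_append_same)
    qed
    then show ?thesis unfolding 1 trailing_Cons[of _ 1] using ix by auto
  next
    case 2
    then show ?thesis using Cons.IH[of m'] trailing_Cons_mono[of "(=) 1" m' k x] ix by auto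
  next
    case 3
    have "trailing ((=) 1) (Suc x # k) \<le> trailing ((=) 1) (x # k)" if "0 < x"
      using that trailing_le[of "(=) 1" k] by (auto simp: trailing_Cons)
    then show ?thesis using 3 ix by auto
  qed
qed

lemma snoc_in_stuffle_one: "k @ [1] \<in># stuffle [1] k"
  by (induction k) auto

lemma shw_Nil_right: "shw k [] = {#k#}"
  by (cases k) auto

lemma shw_one_props:
  "m \<in># shw [True] v \<Longrightarrow> length v \<le> length m \<and> (v = [] \<or> hd v \<longrightarrow> m \<noteq> [] \<and> hd m)
     \<and> (m = v @ [True] \<or> trailing (\<lambda>x. x) m \<le> trailing (\<lambda>x. x) v)"
proof (induction v arbitrary: m)
  case (Cons x v)
  from Cons.prems consider "m = True # x # v" | m' where "m = x # m'" "m' \<in># shw [True] v"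
    by auto
  then show ?case
  proof cases
    case 1
    have "True # x # v = (x # v) @ [True]" if "\<forall>y\<in>set (x # v). y"
    proof -
      have "x # v = replicate (length (x # v)) True"
        using that by (metis (full_types) replicate_length_same)
      then show ?thesis by (metis append_Cons replicate_Suc replicate_append_same)
    qed
    then show ?thesis unfolding 1 trailing_Cons[of _ True] by auto
  next
    case 2
    then show ?thesis using Cons.IH[of m'] trailing_Cons_mono[of "\<lambda>x. x" m' v x] by auto
  qed
qed auto

lemma snoc_in_shw_one: "v @ [True] \<in># shw [True] v"
  by (induction v) auto

lemma i2w_Nil [simp]: "i2w [] = []" by (simp add: i2w_def)
lemma i2w_Cons: "i2w (a # k) = (True # replicate (a - 1) False) @ i2w k" by (simp add: i2w_def)
lemma i2w_snoc: "i2w (k @ [a]) = i2w k @ True # replicate (a - 1) False" by (simp add: i2w_def)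

lemma i2w_hd: "k \<noteq> [] \<Longrightarrow> i2w k \<noteq> [] \<and> hd (i2w k)"
  by (cases k) (auto simp: i2w_Cons)

lemma is_index_w2i: "is_index (w2i w)"
  by (induction w rule: w2i.induct) (auto simp: is_index_def)

lemma takeWhile_i2w: "takeWhile Not (i2w k) = [] \<and> dropWhile Not (i2w k) = i2w k"
  by (cases k) (auto simp: i2w_Cons)

lemma w2i_i2w: "is_index k \<Longrightarrow> w2i (i2w k) = k"
proof (induction k)
  case (Cons a k)
  then have "is_index k" "0 < a" by (auto simp: is_index_def)
  have "takeWhile Not (replicate (a - 1) False @ i2w k) = replicate (a - 1) False"
    using takeWhile_i2w[of k] by (subst takeWhile_append2) auto
  moreover have "dropWhile Not (replicate (a - 1) False @ i2w k) = i2w k"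
    using takeWhile_i2w[of k] by (subst dropWhile_append2) auto
  ultimately show ?case using Cons.IH \<open>is_index k\<close> \<open>0 < a\<close> by (simp add: i2w_Cons)
qed simp

lemma i2w_w2i: "w = [] \<or> hd w \<Longrightarrow> i2w (w2i w) = w"
proof (induction w rule: w2i.induct)
  case (3 w)
  let ?d = "dropWhile Not w"
  have "?d = [] \<or> hd ?d" using hd_dropWhile[of Not w] by auto
  then have "i2w (w2i ?d) = ?d" using 3 by simp
  moreover have "replicate (length (takeWhile Not w)) False = takeWhile Not w"
    by (rule replicate_eqI[symmetric]) (auto dest: set_takeWhileD)
  ultimately show ?case by (simp add: i2w_Cons)
qed auto

lemma trailing_i2w: "is_index k \<Longrightarrow> trailing (\<lambda>x. x) (i2w k) = trailing ((=) 1) k"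
proof (induction k rule: rev_induct)
  case (snoc a k)
  then have IH: "trailing (\<lambda>x. x) (i2w k) = trailing ((=) 1) k" and "a \<noteq> 0"
    by (auto simp: is_index_def)
  from \<open>a \<noteq> 0\<close> have "a = 1 \<or> a = Suc (Suc (a - 2))" by arith
  then consider "a = 1" | n where "a = Suc (Suc n)" by blast
  then show ?case
  proof cases
    case 1
    then have w: "i2w (k @ [a]) = i2w k @ [True]" by (simp add: i2w_snoc)
    show ?thesis unfolding w trailing_snoc IH using 1 by simp
  next
    case 2
    then have w: "i2w (k @ [a]) = (i2w k @ True # replicate n False) @ [False]"
      by (simp add: i2w_snoc replicate_append_same)
    show ?thesis unfolding w trailing_snoc using 2 by simp
  qed
qed simp

text \<open>The shuffle case is argued on words and carried back along \<open>w2i\<close>; all words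
  that occur begin with \<open>True\<close>, so that \<open>i2w\<close> recovers them.\<close>

lemma prod_expand_index:
  assumes "is_index k" "m \<in># prod_expand b [1] k"
  shows "is_index m" "m = k @ [1] \<or> trailing ((=) 1) m \<le> trailing ((=) 1) k"
proof -
  have "is_index m \<and> (m = k @ [1] \<or> trailing ((=) 1) m \<le> trailing ((=) 1) k)"
  proof (cases b)
    case Harmonic
    then show ?thesis using assms stuffle_one_props[of m k] by (auto simp: prod_expand_def)
  next
    case Shuffle
    have "i2w [1] = [True]" by (simp add: i2w_Cons)
    with assms Shuffle obtain w where w: "m = w2i w" "w \<in># shw [True] (i2w k)"
      by (auto simp: prod_expand_def)
    have "i2w k = [] \<or> hd (i2w k)" using i2w_hd by (cases "k = []") auto
    with shw_one_props[OF w(2)] have 1: "hd w" "w = i2w k @ [True] \<or> trailing (\<lambda>x. x) w \<le> trailing (\<lambda>x. x) (i2w k)"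
      by auto
    have "i2w m = w" unfolding w using 1 i2w_w2i by blast
    have "is_index (k @ [1])" using assms(1) by (auto simp: is_index_def)
    have "m = k @ [1]" if "w = i2w k @ [True]"
    proof -
      have "w = i2w (k @ [1])" using that by (simp add: i2w_snoc)
      then show ?thesis using w2i_i2w[OF \<open>is_index (k @ [1])\<close>] w by simp
    qed
    moreover have m: "is_index m" unfolding w by (rule is_index_w2i)
    moreover have "trailing ((=) 1) m \<le> trailing ((=) 1) k" if "trailing (\<lambda>x. x) w \<le> trailing (\<lambda>x. x) (i2w k)"
      using that unfolding trailing_i2w[OF assms(1)] trailing_i2w[OF m, symmetric] \<open>i2w m = w\<close> .
    ultimately show ?thesis using 1(2) by blast
  qed
  then show "is_index m" "m = k @ [1] \<or> trailing ((=) 1) m \<le> trailing ((=) 1) k" by auto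
qed

lemma snoc_in_prod_expand: "is_index k \<Longrightarrow> k @ [1] \<in># prod_expand b [1] k"
proof (cases b)
  case Shuffle
  assume "is_index k"
  then have "is_index (k @ [1])" by (auto simp: is_index_def)
  then have "w2i (i2w k @ [True]) = k @ [1]" using w2i_i2w[of "k @ [1]"] by (simp add: i2w_snoc)
  moreover have "i2w [1] = [True]" by (simp add: i2w_Cons)
  ultimately show ?thesis
    using snoc_in_shw_one[of "i2w k"] Shuffle by (force simp: prod_expand_def)
qed (use snoc_in_stuffle_one in \<open>auto simp: prod_expand_def\<close>)

lemma prod_expand_one_split:
  assumes "is_index k"
  obtains c R where "prod_expand b [1] k = replicate_mset c (k @ [1]) + R" "0 < c"
    "\<And>m. m \<in># R \<Longrightarrow> is_index m \<and> trailing ((=) 1) m \<le> trailing ((=) 1) k"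
proof
  let ?A = "prod_expand b [1] k"
  show "?A = replicate_mset (count ?A (k @ [1])) (k @ [1]) + filter_mset (\<lambda>m. m \<noteq> k @ [1]) ?A"
    by (metis filter_eq_replicate_mset multiset_partition)
  show "0 < count ?A (k @ [1])" using snoc_in_prod_expand[OF assms] by simp
  fix m assume "m \<in># filter_mset (\<lambda>m. m \<noteq> k @ [1]) ?A"
  then show "is_index m \<and> trailing ((=) 1) m \<le> trailing ((=) 1) k"
    using prod_expand_index[OF assms, of m b] by auto
qed

lemma admissible_iff: "admissible k \<longleftrightarrow> is_index k \<and> trailing ((=) 1) k = 0"
proof (cases k rule: rev_cases)
  case (snoc l a)
  then show ?thesis by (auto simp: admissible_def trailing_snoc is_index_def)
qed (simp add: admissible_def)

text \<open>The product of \<open>[1]\<close> and \<open>k\<close> is a multiple of \<open>k @ [1]\<close> plus indices with fewer trailing ones;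
  this determines the regularization from its values on admissible indices.\<close>
lemma index_trailing_induct [consumes 1, case_names admissible one snoc]:
  assumes "is_index k"
    and adm: "\<And>k. admissible k \<Longrightarrow> P k"
    and one: "P [1]"
    and snoc: "\<And>k. is_index k \<Longrightarrow> P k
      \<Longrightarrow> (\<And>m. is_index m \<Longrightarrow> trailing ((=) 1) m \<le> trailing ((=) 1) k \<Longrightarrow> P m) \<Longrightarrow> P (k @ [1])"
  shows "P k"
  using assms(1)
proof (induction "trailing ((=) 1) k" arbitrary: k rule: less_induct)
  case less
  show ?case
  proof (cases "admissible k")
    case False
    with less(2) have "trailing ((=) 1) k \<noteq> 0" by (simp add: admissible_iff)
    then obtain l where l: "k = l @ [1]"
      by (cases k rule: rev_cases) (auto simp: trailing_snoc split: if_splits)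
    then have "is_index l" "trailing ((=) 1) k = Suc (trailing ((=) 1) l)"
      using less(2) by (auto simp: is_index_def trailing_snoc)
    then have "P m" if "is_index m" "trailing ((=) 1) m \<le> trailing ((=) 1) l" for m
      using less(1)[of m] that by simp
    then show ?thesis unfolding l using snoc[of l] \<open>is_index l\<close> by blast
  qed (rule adm)
qed

text \<open>The negligible sequences form an ideal in the ring of sequences of polynomial growth in \<open>L\<close>.\<close>
definition negl :: "(nat \<Rightarrow> real) \<Rightarrow> (nat \<Rightarrow> real) \<Rightarrow> bool" where
  "negl L f \<longleftrightarrow> (\<forall>j. (\<lambda>n. f n * L n ^ j) \<longlonglongrightarrow> 0)"

lemma negl_tendsto: "negl L f \<Longrightarrow> f \<longlonglongrightarrow> 0"
  unfolding negl_def by (drule spec[of _ 0]) simp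

lemma negl_0 [simp]: "negl L (\<lambda>n. 0)"
  by (simp add: negl_def)

lemma negl_add: "negl L f \<Longrightarrow> negl L g \<Longrightarrow> negl L (\<lambda>n. f n + g n)"
  unfolding negl_def by (auto simp: distrib_right intro!: tendsto_add_zero)

lemma negl_diff: "negl L f \<Longrightarrow> negl L g \<Longrightarrow> negl L (\<lambda>n. f n - g n)"
  unfolding negl_def left_diff_distrib using tendsto_diff[of _ 0 _ _ 0] by fastforce

lemma negl_cmult: "negl L f \<Longrightarrow> negl L (\<lambda>n. c * f n)"
  unfolding negl_def by (auto simp: mult.assoc intro!: tendsto_mult_right_zero)

lemma negl_mult: "negl L f \<Longrightarrow> negl L g \<Longrightarrow> negl L (\<lambda>n. f n * g n)"
  unfolding negl_def
proof
  fix j assume "\<forall>j. (\<lambda>n. f n * L n ^ j) \<longlonglongrightarrow> 0" "\<forall>j. (\<lambda>n. g n * L n ^ j) \<longlonglongrightarrow> 0"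
  then have "(\<lambda>n. (f n * L n ^ 0) * (g n * L n ^ j)) \<longlonglongrightarrow> 0"
    using tendsto_mult_zero by blast
  then show "(\<lambda>n. f n * g n * L n ^ j) \<longlonglongrightarrow> 0" by (simp add: mult.assoc)
qed

lemma negl_mult_L: "negl L f \<Longrightarrow> negl L (\<lambda>n. f n * L n)"
  unfolding negl_def
proof
  fix j assume "\<forall>j. (\<lambda>n. f n * L n ^ j) \<longlonglongrightarrow> 0"
  then have "(\<lambda>n. f n * L n ^ Suc j) \<longlonglongrightarrow> 0" by blast
  then show "(\<lambda>n. f n * L n * L n ^ j) \<longlonglongrightarrow> 0" by (simp add: mult_ac)
qed

lemma negl_mult_poly:
  assumes "negl L f"
  shows "negl L (\<lambda>n. f n * poly p (\<alpha> * L n + \<beta>))"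
proof (induction p)
  case (pCons c p)
  have "negl L (\<lambda>n. c * f n + \<beta> * (f n * poly p (\<alpha> * L n + \<beta>))
      + \<alpha> * ((f n * poly p (\<alpha> * L n + \<beta>)) * L n))"
    by (intro negl_add negl_cmult negl_mult_L pCons assms)
  then show ?case by (simp add: algebra_simps)
qed simp

lemma negl_prod:
  assumes "negl L (\<lambda>n. f n - poly p (\<alpha> * L n + \<beta>))" "negl L (\<lambda>n. g n - poly q (\<alpha>' * L n + \<beta>'))"
  shows "negl L (\<lambda>n. f n * g n - poly p (\<alpha> * L n + \<beta>) * poly q (\<alpha>' * L n + \<beta>'))"
proof -
  have "negl L (\<lambda>n. (f n - poly p (\<alpha> * L n + \<beta>)) * (g n - poly q (\<alpha>' * L n + \<beta>'))
     + (f n - poly p (\<alpha> * L n + \<beta>)) * poly q (\<alpha>' * L n + \<beta>')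
     + (g n - poly q (\<alpha>' * L n + \<beta>')) * poly p (\<alpha> * L n + \<beta>))"
    using assms by (intro negl_add negl_mult negl_mult_poly)
  then show ?thesis by (simp add: algebra_simps)
qed

lemma poly_tendsto_zero_imp_0:
  assumes "filterlim g at_top F" "F \<noteq> bot" "((\<lambda>n. poly p (g n)) \<longlongrightarrow> 0) F"
  shows "p = (0 :: real poly)"
proof (rule ccontr)
  assume "p \<noteq> 0"
  \<comment> \<open>The sign makes the leading coefficient positive; then \<open>q\<close>
    eventually exceeds it, even when \<open>p\<close> is constant.\<close>
  define q where "q = smult (sgn (lead_coeff p)) p"
  have "lead_coeff q = \<bar>lead_coeff p\<bar>" by (simp add: q_def lead_coeff_smult sgn_mult_self_eq abs_sgn mult.commute)
  then have lc: "lead_coeff q > 0" using \<open>p \<noteq> 0\<close> by simp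
  obtain x0 where x0: "\<And>x. x \<ge> x0 \<Longrightarrow> poly q x \<ge> lead_coeff q"
    using poly_pinfty_gt_lc[OF lc] by blast
  have "((\<lambda>n. poly q (g n)) \<longlongrightarrow> 0) F"
    unfolding q_def poly_smult by (rule tendsto_mult_right_zero) (rule assms)
  then have "eventually (\<lambda>n. poly q (g n) < lead_coeff q) F"
    using lc by (rule order_tendstoD)
  moreover have "eventually (\<lambda>n. g n \<ge> x0) F" using assms(1) by (simp add: filterlim_at_top)
  ultimately have "eventually (\<lambda>n. False) F"
    by eventually_elim (use x0 in force)
  then show False using assms(2) by simp
qed

section \<open>Existence and uniqueness of the regularization polynomials\<close>

definition reg_spec :: "regtype \<Rightarrow> (nat list \<Rightarrow> real poly) \<Rightarrow> bool" where
  "reg_spec b Z \<longleftrightarrow> (\<forall>k. \<not> is_index k \<longrightarrow> Z k = 0) \<and>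
      (\<forall>k. admissible k \<longrightarrow> Z k = [:mzv k:]) \<and>
      Z [1] = [:0, 1:] \<and>
      (\<forall>k l. is_index k \<longrightarrow> is_index l \<longrightarrow> Z k * Z l = (\<Sum>m\<in>#prod_expand b k l. Z m))"

lemma sum_mset_replicate: "(\<Sum>m\<in>#replicate_mset c x. f m) = of_nat c * (f x :: 'a::comm_semiring_1)"
  by (induction c) (auto simp: algebra_simps)

lemma reg_spec_unique:
  assumes "reg_spec b Z" "reg_spec b Z'"
  shows "Z = Z'"
proof
  fix k
  show "Z k = Z' k"
  proof (cases "is_index k")
    case True
    then show ?thesis
    proof (induction rule: index_trailing_induct)
      case (snoc k)
      obtain c R where R: "prod_expand b [1] k = replicate_mset c (k @ [1]) + R" "0 < c"
        "\<And>m. m \<in># R \<Longrightarrow> is_index m \<and> trailing ((=) 1) m \<le> trailing ((=) 1) k"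
        using prod_expand_one_split[OF snoc.hyps, of b] by blast
      have "is_index [1]" by (simp add: is_index_def)
      \<comment> \<open>The product rule for \<open>[1]\<close> and \<open>k\<close>, solved for the
        value at \<open>k @ [1]\<close>; all other terms are covered by the induction
        hypothesis.\<close>
      have *: "of_nat c * Y (k @ [1]) = [:0, 1:] * Y k - (\<Sum>m\<in>#R. Y m)" if "reg_spec b Y" for Y
      proof -
        have "Y [1] * Y k = (\<Sum>m\<in>#prod_expand b [1] k. Y m)" "Y [1] = [:0, 1:]"
          using that snoc.hyps \<open>is_index [1]\<close> unfolding reg_spec_def by blast+
        then show ?thesis unfolding R by (simp add: sum_mset_replicate)
      qed
      have "(\<Sum>m\<in>#R. Z m) = (\<Sum>m\<in>#R. Z' m)"
        using R(3) snoc(3) by (intro arg_cong[where f = sum_mset] image_mset_cong) blast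
      then have "of_nat c * Z (k @ [1]) = of_nat c * Z' (k @ [1])"
        unfolding *[OF assms(1)] *[OF assms(2)] snoc(2) by simp
      then show ?case using R(2) by simp
    qed (use assms in \<open>auto simp: reg_spec_def\<close>)
  qed (use assms in \<open>auto simp: reg_spec_def\<close>)
qed

lemma zeta_reg_eqI: "reg_spec b Z \<Longrightarrow> zeta_reg b = Z"
  unfolding zeta_reg_def reg_spec_def[symmetric] using reg_spec_unique by blast

text \<open>Any family of multiplicative functionals that approximates the zeta values, with
  \<open>[1]\<close> behaving like a quantity tending to infinity, computes the regularization. The
  instances are truncated sums and polylogarithms. The parameters \<open>\<alpha>\<close> and
  \<open>\<beta>\<close> let both use the same scale \<open>L\<close> although \<open>[1]\<close>
  grows differently in them.\<close>

locale asymptotic_reg =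
  fixes b :: regtype and \<phi> :: "nat \<Rightarrow> nat list \<Rightarrow> real" and L :: "nat \<Rightarrow> real" and \<alpha> \<beta> :: real
  assumes L_top: "filterlim L at_top sequentially" and \<alpha>: "\<alpha> > 0"
    and one: "negl L (\<lambda>n. \<phi> n [1] - (\<alpha> * L n + \<beta>))"
    and adm: "\<And>k. admissible k \<Longrightarrow> negl L (\<lambda>n. \<phi> n k - mzv k)"
    and mult: "\<And>n k l. is_index k \<Longrightarrow> is_index l \<Longrightarrow>
       \<phi> n k * \<phi> n l = (\<Sum>m\<in>#prod_expand b k l. \<phi> n m)"
begin

definition asymp :: "(nat \<Rightarrow> real) \<Rightarrow> real poly \<Rightarrow> bool" where
  "asymp f p \<longleftrightarrow> negl L (\<lambda>n. f n - poly p (\<alpha> * L n + \<beta>))"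

lemma asymp_diff: "asymp f p \<Longrightarrow> asymp g q \<Longrightarrow> asymp (\<lambda>n. f n - g n) (p - q)"
  unfolding asymp_def by (drule (1) negl_diff) (simp add: algebra_simps)

lemma asymp_add: "asymp f p \<Longrightarrow> asymp g q \<Longrightarrow> asymp (\<lambda>n. f n + g n) (p + q)"
  unfolding asymp_def by (drule (1) negl_add) (simp add: algebra_simps)

lemma asymp_cmult: "asymp f p \<Longrightarrow> asymp (\<lambda>n. c * f n) (smult c p)"
  unfolding asymp_def by (drule negl_cmult[of _ _ c]) (simp add: algebra_simps)

lemma asymp_mult: "asymp f p \<Longrightarrow> asymp g q \<Longrightarrow> asymp (\<lambda>n. f n * g n) (p * q)"
  unfolding asymp_def poly_mult by (rule negl_prod)

lemma asymp_sum_mset: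
  "(\<And>m. m \<in># R \<Longrightarrow> asymp (\<lambda>n. f n m) (p m)) \<Longrightarrow> asymp (\<lambda>n. \<Sum>m\<in>#R. f n m) (\<Sum>m\<in>#R. p m)"
proof (induction R)
  case empty
  then show ?case by (simp add: asymp_def)
next
  case (add x R)
  then show ?case using asymp_add[of "\<lambda>n. f n x" "p x"] by simp
qed

lemma asymp_sum:
  "finite A \<Longrightarrow> (\<And>x. x \<in> A \<Longrightarrow> asymp (f x) (p x)) \<Longrightarrow> asymp (\<lambda>n. \<Sum>x\<in>A. f x n) (\<Sum>x\<in>A. p x)"
proof (induction A rule: finite_induct)
  case empty
  then show ?case by (simp add: asymp_def)
next
  case (insert x A)
  then show ?case using asymp_add[of "f x" "p x"] by simp
qed

lemma arg_at_top: "filterlim (\<lambda>n. \<alpha> * L n + \<beta>) at_top sequentially"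
proof -
  have "filterlim (\<lambda>n. \<beta> + \<alpha> * L n) at_top sequentially"
    by (intro filterlim_tendsto_add_at_top[OF tendsto_const]
        filterlim_tendsto_pos_mult_at_top[OF tendsto_const \<alpha> L_top])
  then show ?thesis by (simp add: add.commute)
qed

lemma asymp_tendsto_0:
  assumes "asymp f p" "f \<longlonglongrightarrow> 0"
  shows "p = 0"
proof -
  have "(\<lambda>n. f n - (f n - poly p (\<alpha> * L n + \<beta>))) \<longlonglongrightarrow> 0 - 0"
    using assms negl_tendsto unfolding asymp_def by (intro tendsto_diff) blast+
  then show ?thesis by (intro poly_tendsto_zero_imp_0[OF arg_at_top]) simp_all
qed

lemma asymp_unique:
  assumes "asymp f p" "asymp f q"
  shows "p = q"
proof -
  have "negl L (\<lambda>n. poly (q - p) (\<alpha> * L n + \<beta>))"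
    using negl_diff[OF assms[unfolded asymp_def]] by (simp add: algebra_simps)
  then have "q - p = 0"
    by (intro poly_tendsto_zero_imp_0[OF arg_at_top]) (simp_all add: negl_tendsto)
  then show ?thesis by simp
qed

lemma asymp_exists: "is_index k \<Longrightarrow> \<exists>p. asymp (\<lambda>n. \<phi> n k) p"
proof (induction rule: index_trailing_induct)
  case (admissible k)
  then show ?case using adm by (intro exI[of _ "[:mzv k:]"]) (simp add: asymp_def)
next
  case one
  then show ?case using asymptotic_reg_axioms
    by (intro exI[of _ "[:0, 1:]"]) (simp add: asymp_def asymptotic_reg_def)
next
  case (snoc k)
  obtain c R where R: "prod_expand b [1] k = replicate_mset c (k @ [1]) + R" "0 < c"
    "\<And>m. m \<in># R \<Longrightarrow> is_index m \<and> trailing ((=) 1) m \<le> trailing ((=) 1) k"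
    using prod_expand_one_split[OF snoc.hyps, of b] by blast
  obtain p where p: "asymp (\<lambda>n. \<phi> n k) p" using snoc by blast
  define q where "q m = (SOME p. asymp (\<lambda>n. \<phi> n m) p)" for m
  have q: "asymp (\<lambda>n. \<phi> n m) (q m)" if "m \<in># R" for m
    unfolding q_def by (rule someI_ex) (use R(3)[OF that] snoc(3) in blast)
  have "is_index [1]" by (simp add: is_index_def)
  then have "(\<lambda>n. \<phi> n (k @ [1])) = (\<lambda>n. (1 / c) * (\<phi> n [1] * \<phi> n k - (\<Sum>m\<in>#R. \<phi> n m)))"
    using mult[OF _ snoc.hyps, of "[1]"] R(2) unfolding R by (auto simp: sum_mset_replicate)
  moreover have "asymp (\<lambda>n. (1 / c) * (\<phi> n [1] * \<phi> n k - (\<Sum>m\<in>#R. \<phi> n m)))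
     (smult (1 / c) ([:0, 1:] * p - (\<Sum>m\<in>#R. q m)))"
    using one by (intro asymp_cmult asymp_diff asymp_mult asymp_sum_mset p q) (auto simp: asymp_def)
  ultimately show ?case by (intro exI) (simp only:)
qed

lemma prod_expand_is_index:
  assumes "is_index k" "is_index l" "m \<in># prod_expand b k l"
  shows "is_index m"
proof (cases b)
  case Harmonic
  have "is_index m" if "m \<in># stuffle k l" "is_index k" "is_index l"
    using that
    by (induction k l arbitrary: m rule: stuffle.induct) (auto simp: is_index_def)
  then show ?thesis using assms Harmonic by (simp add: prod_expand_def)
next
  case Shuffle
  then show ?thesis using assms by (auto simp: prod_expand_def is_index_w2i)
qed

text \<open>The asymptotic polynomial of a sequence is unique and compatible with sums and products,
  so the polynomials of \<open>\<phi>\<close> satisfy the defining conditions of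
  \<open>zeta_reg\<close>. This also provides the existence that the definite description
  presupposes.\<close>

lemma zeta_reg_asymp:
  shows "reg_spec b (zeta_reg b)"
    and "is_index k \<Longrightarrow> asymp (\<lambda>n. \<phi> n k) (zeta_reg b k)"
proof -
  define Z where "Z k = (if is_index k then SOME p. asymp (\<lambda>n. \<phi> n k) p else 0)" for k
  have Z: "asymp (\<lambda>n. \<phi> n k) (Z k)" if "is_index k" for k
    using someI_ex[OF asymp_exists[OF that]] that by (simp add: Z_def)
  have "reg_spec b Z"
    unfolding reg_spec_def
  proof (intro conjI allI impI)
    fix k assume "\<not> is_index k" then show "Z k = 0" by (simp add: Z_def)
  next
    fix k assume k: "admissible k"
    show "Z k = [:mzv k:]"
      using adm[OF k] k by (intro asymp_unique[OF Z]) (auto simp: asymp_def admissible_def)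
  next
    show "Z [1] = [:0, 1:]"
      using one by (intro asymp_unique[OF Z]) (auto simp: asymp_def is_index_def)
  next
    fix k l assume kl: "is_index k" "is_index l"
    have "asymp (\<lambda>n. \<phi> n k * \<phi> n l) (Z k * Z l)" using Z kl by (intro asymp_mult)
    moreover have "asymp (\<lambda>n. \<phi> n k * \<phi> n l) (\<Sum>m\<in>#prod_expand b k l. Z m)"
      unfolding mult[OF kl] using prod_expand_is_index[OF kl] by (intro asymp_sum_mset Z)
    ultimately show "Z k * Z l = (\<Sum>m\<in>#prod_expand b k l. Z m)" by (rule asymp_unique)
  qed
  then have "zeta_reg b = Z" by (rule zeta_reg_eqI)
  then show "reg_spec b (zeta_reg b)" "is_index k \<Longrightarrow> asymp (\<lambda>n. \<phi> n k) (zeta_reg b k)"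
    using Z \<open>reg_spec b Z\<close> by simp_all
qed

end

section \<open>Truncated multiple zeta values\<close>

definition tz :: "nat \<Rightarrow> nat list \<Rightarrow> real" where
  "tz N k = mqs k (map (\<lambda>n. 1 / real n) [1..<Suc N])"

lemma tz_Nil [simp]: "tz N [] = 1"
  by (simp add: tz_def)

lemma tz_0: "tz 0 k = (if k = [] then 1 else 0)"
  by (simp add: tz_def mqs_Nil_right)

lemma tz_Suc: "k \<noteq> [] \<Longrightarrow> tz (Suc N) k = tz N k + tz N (butlast k) / real (Suc N) ^ last k"
  unfolding tz_def by (simp add: mqs_snoc' power_divide)

lemma mqs_nonneg: "(\<And>y. y \<in> set ys \<Longrightarrow> 0 \<le> y) \<Longrightarrow> 0 \<le> mqs k (ys :: real list)"
  by (induction k ys rule: mqs.induct) auto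

lemma tz_nonneg: "0 \<le> tz N k"
  unfolding tz_def by (rule mqs_nonneg) auto

lemma tz_incseq: "incseq (\<lambda>N. tz N k)"
proof (rule incseq_SucI)
  fix N show "tz N k \<le> tz (Suc N) k"
    by (cases "k = []") (simp_all add: tz_Suc tz_nonneg)
qed

text \<open>Exponents are at least 1 and variables at most 1, so each power is bounded by its
  variable; dropping the order of the chain then gives a power of the sum.\<close>

lemma mqs_le_power:
  fixes ys :: "real list"
  assumes "\<And>y. y \<in> set ys \<Longrightarrow> 0 \<le> y \<and> y \<le> 1" "is_index k"
  shows "mqs k ys \<le> sum_list ys ^ length k"
  using assms
proof (induction k ys rule: mqs.induct)
  case (3 a k y ys)
  have y: "0 \<le> y" "y \<le> 1" and a: "0 < a" "is_index k"
    using 3(3)[of y] 3(4) by (auto simp: is_index_def)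
  have S: "0 \<le> sum_list ys" using 3(3) by (intro sum_list_nonneg) auto
  have "y ^ a \<le> y ^ 1" by (rule power_decreasing) (use a y in auto)
  then have "y ^ a * mqs k ys \<le> y * sum_list ys ^ length k"
    using 3 y a by (intro mult_mono) (auto intro!: mqs_nonneg)
  moreover have "mqs (a # k) ys \<le> sum_list ys * sum_list ys ^ length k"
    using 3 by simp
  ultimately have "mqs (a # k) (y # ys) \<le> (y + sum_list ys) * sum_list ys ^ length k"
    by (simp add: distrib_right)
  also have "\<dots> \<le> (y + sum_list ys) * (y + sum_list ys) ^ length k"
    using y S by (intro mult_left_mono power_mono) auto
  finally show ?case by simp
qed auto

lemma harm_sum_list: "sum_list (map (\<lambda>n. 1 / real n) [1..<Suc N]) = harm N"
  by (induction N) (auto simp: harm_Suc harm_expand inverse_eq_divide)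

lemma tz_le_harm: "is_index k \<Longrightarrow> tz N k \<le> harm N ^ length k"
  unfolding tz_def harm_sum_list[symmetric] by (rule mqs_le_power) auto

lemma tz_one: "tz N [1] = harm N"
proof -
  have "mqs [1] ys = sum_list ys" for ys :: "real list"
    by (induction ys) auto
  then show ?thesis by (simp only: tz_def harm_sum_list)
qed

text \<open>The rate \<open>1 / sqrt\<close> is used for all errors: weak enough to absorb the
  logarithms of truncated sums, strong enough to beat every power of the logarithm.\<close>

lemma ln_power_over_sqrt: "(\<lambda>n. (ln (real (Suc n)) + 1) ^ j / sqrt (real (Suc n))) \<longlonglongrightarrow> 0"
proof -
  have *: "((\<lambda>x. (ln x + 1) ^ j / sqrt x) \<longlongrightarrow> 0) at_top"
    by real_asymp
  have "filterlim (\<lambda>n. real (Suc n)) at_top sequentially"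
    by (rule filterlim_compose[OF filterlim_real_sequentially filterlim_Suc])
  from filterlim_compose[OF * this] show ?thesis .
qed

lemma harm_le_ln: "harm (Suc n) \<le> ln (real (Suc n)) + 1"
proof -
  have "decseq (\<lambda>n. harm (Suc n) - ln (real (Suc n)))" using decseq_harm_diff_ln by simp
  then have "harm (Suc n) - ln (real (Suc n)) \<le> harm (Suc 0) - ln (real (Suc 0))"
    by (rule decseqD) simp
  then show ?thesis by (simp add: harm_expand)
qed

lemma harm_power_bound: "\<exists>C\<ge>0. \<forall>n. harm n ^ j \<le> C * sqrt (real (Suc n))"
proof -
  have "Bseq (\<lambda>n. (ln (real (Suc n)) + 1) ^ j / sqrt (real (Suc n)))"
    using ln_power_over_sqrt[of j] convergentI Bseq_conv_Bfun convergent_imp_Bseq by blast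
  then obtain C where C: "C > 0" "\<And>n. norm ((ln (real (Suc n)) + 1) ^ j / sqrt (real (Suc n))) \<le> C"
    by (rule BseqE) blast
  have "harm n ^ j \<le> C * sqrt (real (Suc n))" for n
  proof -
    have "harm n ^ j \<le> (harm (Suc n) :: real) ^ j"
      by (intro power_mono harm_mono harm_nonneg) simp
    also have "\<dots> \<le> (ln (real (Suc n)) + 1) ^ j"
      by (intro power_mono harm_le_ln harm_nonneg)
    also have "\<dots> \<le> C * sqrt (real (Suc n))"
      using C(2)[of n] by (simp add: divide_le_eq abs_le_iff)
    finally show ?thesis .
  qed
  then show ?thesis using C(1) by (intro exI[of _ C]) auto
qed

lemma admissible_snoc:
  assumes "admissible k" "k \<noteq> []"
  obtains l a where "k = l @ [a]" "is_index l" "2 \<le> a"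
  using assms by (cases k rule: rev_cases) (auto simp: admissible_def is_index_def)

text \<open>A telescoping majorant of the terms \<open>(x + 1) ^ (- 3 / 2)\<close>, in place of an
  integral comparison.\<close>

lemma inverse_sqrt_diff:
  assumes "0 < x"
  shows "1 / (2 * (x + 1) * sqrt (x + 1)) \<le> 1 / sqrt x - 1 / sqrt (x + 1)"
proof -
  let ?a = "sqrt x" and ?b = "sqrt (x + 1)"
  have ab: "0 < ?a" "?a \<le> ?b" "0 < ?b" using assms by auto
  have "(?b - ?a) * (?b + ?a) = 1"
    using assms by (simp add: algebra_simps flip: power2_eq_square)
  then have eq: "?b - ?a = 1 / (?b + ?a)" using ab by (intro eq_divide_imp) auto
  have "1 / ?a - 1 / ?b = (?b - ?a) / (?a * ?b)" using ab by (simp add: field_simps)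
  also have "\<dots> = 1 / ((?b + ?a) * (?a * ?b))" unfolding eq by simp
  also have "\<dots> \<ge> 1 / ((?b + ?b) * (?b * ?b))"
    using ab by (intro divide_left_mono mult_mono add_mono mult_pos_pos add_pos_pos) auto
  also have "(?b + ?b) * (?b * ?b) = 2 * (x + 1) * sqrt (x + 1)"
    using assms by (simp add: power2_eq_square[symmetric])
  finally show ?thesis by simp
qed

text \<open>The last entry is at least 2 and the remaining truncated sum is at most a multiple of a
  square root, so the increments are of order \<open>N ^ (- 3 / 2)\<close> and the tail is of order
  \<open>1 / sqrt N\<close>.\<close>

lemma tz_admissible_limit:
  assumes "admissible k"
  shows "\<exists>l C. 0 \<le> C \<and> (\<lambda>N. tz N k) \<longlonglongrightarrow> l \<and> (\<forall>N\<ge>1. \<bar>tz N k - l\<bar> \<le> C / sqrt (real N))"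
proof (cases "k = []")
  case True
  then show ?thesis by (intro exI[of _ 1] exI[of _ 0]) simp
next
  case False
  obtain l a where k: "k = l @ [a]" "is_index l" "2 \<le> a"
    using admissible_snoc[OF assms False] .
  obtain C where C: "C \<ge> 0" "\<And>n. harm n ^ length l \<le> C * sqrt (real (Suc n))"
    using harm_power_bound by blast
  define f where "f N = tz (Suc N) k" for N
  \<comment> \<open>A bound for the tail: adding it turns the increasing \<open>f\<close> into a
    decreasing sequence with the same limit, so the limit lies between \<open>f N\<close> and
    \<open>f N + g N\<close>.\<close>
  define g where "g N = 2 * C / sqrt (real (Suc N))" for N
  have step: "f (Suc N) + g (Suc N) \<le> f N + g N" for N
  proof -
    let ?x = "real (Suc N)"
    have "f (Suc N) - f N = tz (Suc N) l / (?x + 1) ^ a"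
      unfolding f_def using tz_Suc[OF False, of "Suc N"] k by (simp add: add.commute)
    also have "\<dots> \<le> tz (Suc N) l / (?x + 1) ^ 2"
      using k(3) by (intro divide_left_mono power_increasing tz_nonneg) auto
    also have "\<dots> \<le> C * sqrt (?x + 1) / (?x + 1) ^ 2"
      using order_trans[OF tz_le_harm[OF k(2)] C(2), of "Suc N"]
      by (intro divide_right_mono) (auto simp: add.commute)
    also have "\<dots> = 2 * C * (1 / (2 * (?x + 1) * sqrt (?x + 1)))"
    proof -
      have "C * w / X ^ 2 = 2 * C * (1 / (2 * X * w))" if "X = w * w" "w > 0" for X w :: real
        using that by (simp add: divide_simps power2_eq_square)
      from this[of "?x + 1" "sqrt (?x + 1)"] show ?thesis by simp
    qed
    also have "\<dots> \<le> 2 * C * (1 / sqrt ?x - 1 / sqrt (?x + 1))"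
      using inverse_sqrt_diff[of ?x] C(1) by (intro mult_left_mono) auto
    also have "\<dots> = g N - g (Suc N)"
      by (simp add: g_def right_diff_distrib add.commute)
    finally show ?thesis by simp
  qed
  have dec: "decseq (\<lambda>N. f N + g N)" by (rule decseq_SucI) (rule step)
  have inc: "incseq f"
    unfolding f_def using tz_incseq[of k] by (auto simp: incseq_def)
  have g0: "0 \<le> g N" for N using C by (simp add: g_def)
  have "f N \<le> f 0 + g 0" for N
    using decseqD[OF dec, of 0 N] g0[of N] by simp
  then obtain L where L: "f \<longlonglongrightarrow> L" "\<And>N. f N \<le> L"
    using incseq_convergent[OF inc] by metis
  have g_lim: "g \<longlonglongrightarrow> 0" unfolding g_def by real_asymp
  have "(\<lambda>N. f N + g N) \<longlonglongrightarrow> L" using tendsto_add[OF L(1) g_lim] by simp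
  then have up: "L \<le> f N + g N" for N using decseq_ge[OF dec] by blast
  show ?thesis
  proof (intro exI conjI allI impI)
    show "0 \<le> 2 * C" using C by simp
    show "(\<lambda>N. tz N k) \<longlonglongrightarrow> L" using L(1) unfolding f_def by (rule LIMSEQ_imp_Suc)
    fix N :: nat assume "1 \<le> N"
    then obtain n where "N = Suc n" by (cases N) auto
    then show "\<bar>tz N k - L\<bar> \<le> 2 * C / sqrt (real N)"
      using L(2)[of n] up[of n] by (simp add: f_def g_def abs_le_iff)
  qed
qed

lemma mqs_upt_eq_sum:
  assumes "p \<le> q"
  shows "mqs k (map f [p..<q]) =
     (\<Sum>ns | length ns = length k \<and> sorted_wrt (<) ns \<and> set ns \<subseteq> {p..<q}. \<Prod>i<length k. f (ns ! i) ^ (k ! i))"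
  using assms
proof (induction p arbitrary: k rule: inc_induct)
  case base
  have "{ns. length ns = length k \<and> sorted_wrt (<) ns \<and> set ns \<subseteq> {q..<q}} = (if k = [] then {[]} else {})"
    by auto
  then show ?case by (simp add: mqs_Nil_right)
next
  case (step p)
  let ?B = "\<lambda>p k. {ns. length ns = length k \<and> sorted_wrt (<) ns \<and> set ns \<subseteq> {p..<q}}"
  have fin: "finite (?B p k)" for p and k :: "nat list"
    by (rule finite_subset[OF _ finite_lists_length_eq[of "{p..<q}" "length k"]]) auto
  show ?case
  proof (cases k)
    case Nil
    then have "?B p k = {[]}" by auto
    then show ?thesis using Nil by simp
  next
    case k: (Cons a l)
    have B: "?B p k = (#) p ` ?B (Suc p) l \<union> ?B (Suc p) k"
    proof (intro equalityI subsetI)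
      fix ns assume ns: "ns \<in> ?B p k"
      then obtain n ms where n: "ns = n # ms" by (cases ns) (auto simp: k)
      with ns have ms: "length ms = length l" "sorted_wrt (<) ms" "\<forall>m\<in>set ms. n < m \<and> m < q" "p \<le> n" "n < q"
        by (auto simp: k)
      show "ns \<in> (#) p ` ?B (Suc p) l \<union> ?B (Suc p) k"
      proof (cases "n = p")
        case True
        then have "ms \<in> ?B (Suc p) l" using ms by auto
        then show ?thesis using n True by blast
      next
        case False
        then have "set ns \<subseteq> {Suc p..<q}" using ms n by fastforce
        then show ?thesis using ns by simp
      qed
    next
      fix ns assume "ns \<in> (#) p ` ?B (Suc p) l \<union> ?B (Suc p) k"
      then consider ms where "ns = p # ms" "ms \<in> ?B (Suc p) l" | "ns \<in> ?B (Suc p) k" by blast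
      then show "ns \<in> ?B p k"
      proof cases
        case 1
        then have "\<forall>m\<in>set ms. p < m \<and> m < q" by fastforce
        then show ?thesis using 1 step.hyps by (auto simp: k less_imp_le)
      next
        case 2
        then show ?thesis by fastforce
      qed
    qed
    have "(\<Sum>ns\<in>?B p k. \<Prod>i<length k. f (ns ! i) ^ (k ! i))
       = (\<Sum>ns\<in>(#) p ` ?B (Suc p) l. \<Prod>i<length k. f (ns ! i) ^ (k ! i))
       + (\<Sum>ns\<in>?B (Suc p) k. \<Prod>i<length k. f (ns ! i) ^ (k ! i))"
      unfolding B by (rule sum.union_disjoint) (use fin in auto)
    also have "(\<Sum>ns\<in>(#) p ` ?B (Suc p) l. \<Prod>i<length k. f (ns ! i) ^ (k ! i))
       = (\<Sum>ms\<in>?B (Suc p) l. f p ^ a * (\<Prod>i<length l. f (ms ! i) ^ (l ! i)))"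
      by (subst sum.reindex) (auto simp: k prod.lessThan_Suc_shift simp del: prod.lessThan_Suc)
    finally show ?thesis
      using step.IH[of l] step.IH[of k] step.hyps by (simp add: upt_conv_Cons k sum_distrib_left)
  qed
qed

lemma tz_eq_sum:
  "tz N k = (\<Sum>ns | length ns = length k \<and> sorted_wrt (<) ns \<and> set ns \<subseteq> {1..<Suc N}.
        \<Prod>i<length k. 1 / real (ns ! i) ^ (k ! i))"
  unfolding tz_def by (subst mqs_upt_eq_sum) (simp_all add: power_divide)

text \<open>\<open>mzv\<close> is an unordered sum, while truncation yields a sequence of finite
  sums. For nonnegative terms every finite subset lies in some \<open>A N\<close>, so both have the
  same limit.\<close>

lemma has_sum_exhaustion:
  fixes g :: "'a \<Rightarrow> real"
  assumes nonneg: "\<And>x. x \<in> S \<Longrightarrow> 0 \<le> g x"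
    and fin: "\<And>N. finite (A N)" and mono: "\<And>M N. M \<le> N \<Longrightarrow> A M \<subseteq> A N" and S: "S = (\<Union>N::nat. A N)"
    and lim: "(\<lambda>N. sum g (A N)) \<longlonglongrightarrow> l"
  shows "(g has_sum l) S"
  unfolding has_sum_def
proof (rule order_tendstoI)
  have nn: "0 \<le> g x" if "x \<in> A N" for x N
    using that nonneg S by blast
  have inc: "incseq (\<lambda>N. sum g (A N))"
    unfolding incseq_def using mono fin nn by (intro allI impI sum_mono2) auto
  note le = incseq_le[OF inc lim]
  fix x assume x: "l < x"
  have "sum g F < x" if F: "finite F" "F \<subseteq> S" for F
  proof -
    obtain N where "F \<subseteq> A N"
    proof -
      have "\<exists>N. F \<subseteq> A N" using F
      proof (induction F rule: finite_induct)
        case (insert a F)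
        then obtain M N where "F \<subseteq> A M" "a \<in> A N" using S by auto
        then have "insert a F \<subseteq> A (max M N)" using mono[of M "max M N"] mono[of N "max M N"] by auto
        then show ?case ..
      qed simp
      then show ?thesis using that by blast
    qed
    then have "sum g F \<le> sum g (A N)" using fin nn by (intro sum_mono2) auto
    then show ?thesis using le[of N] x by simp
  qed
  then show "\<forall>\<^sub>F F in finite_subsets_at_top S. sum g F < x"
    by (auto intro: eventually_finite_subsets_at_top_weakI)
next
  fix x assume "x < l"
  then obtain N where N: "x < sum g (A N)"
    using order_tendstoD(1)[OF lim] by (auto simp: eventually_sequentially)
  have "x < sum g F" if "finite F" "A N \<subseteq> F" "F \<subseteq> S" for F
  proof -
    have "sum g (A N) \<le> sum g F" using that nonneg by (intro sum_mono2) auto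
    then show ?thesis using N by simp
  qed
  then show "\<forall>\<^sub>F F in finite_subsets_at_top S. x < sum g F"
    unfolding eventually_finite_subsets_at_top using fin S by (intro exI[of _ "A N"]) auto
qed

lemma mzv_eq_limit:
  assumes "(\<lambda>N. tz N k) \<longlonglongrightarrow> l"
  shows "mzv k = l"
proof -
  let ?g = "\<lambda>ns. \<Prod>i<length k. 1 / real (ns ! i) ^ (k ! i)"
  let ?S = "{ns :: nat list. length ns = length k \<and> sorted_wrt (<) ns \<and> (\<forall>n\<in>set ns. 0 < n)}"
  let ?A = "\<lambda>N. {ns. length ns = length k \<and> sorted_wrt (<) ns \<and> set ns \<subseteq> {1..<Suc N}}"
  have "(?g has_sum l) ?S"
  proof (rule has_sum_exhaustion[where A = ?A])
    fix ns show "0 \<le> ?g ns" by (intro prod_nonneg) auto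
  next
    fix N show "finite (?A N)"
      by (rule finite_subset[OF _ finite_lists_length_eq[of "{1..<Suc N}" "length k"]]) auto
  next
    fix M N :: nat assume "M \<le> N"
    then have "{1..<Suc M} \<subseteq> {1..<Suc N}" by auto
    then show "?A M \<subseteq> ?A N" by blast
  next
    show "?S = (\<Union>N. ?A N)"
    proof (intro equalityI subsetI)
      fix ns assume ns: "ns \<in> ?S"
      have "n \<le> sum_list ns" if "n \<in> set ns" for n by (rule member_le_sum_list[OF that]) simp
      then have "set ns \<subseteq> {1..<Suc (sum_list ns)}" using ns by (auto simp: Suc_le_eq less_Suc_eq_le)
      then show "ns \<in> (\<Union>N. ?A N)" using ns by blast
    next
      fix ns assume "ns \<in> (\<Union>N. ?A N)"
      then show "ns \<in> ?S" by fastforce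
    qed
  next
    show "(\<lambda>N. sum ?g (?A N)) \<longlonglongrightarrow> l" using assms by (simp only: tz_eq_sum)
  qed
  then show ?thesis unfolding mzv_def by (rule infsumI)
qed

lemma tz_mzv_rate:
  assumes "admissible k"
  shows "\<exists>C\<ge>0. \<forall>N\<ge>1. \<bar>tz N k - mzv k\<bar> \<le> C / sqrt (real N)"
  using tz_admissible_limit[OF assms] mzv_eq_limit by metis

lemma negl_sqrtI:
  assumes "\<And>n. \<bar>f n\<bar> \<le> C / sqrt (real (Suc n))"
  shows "negl (\<lambda>n. ln (real (Suc n))) f"
  unfolding negl_def
proof
  fix j
  have "(\<lambda>n. C * ((ln (real (Suc n)) + 1) ^ j / sqrt (real (Suc n)))) \<longlonglongrightarrow> 0"
    by (intro tendsto_mult_right_zero ln_power_over_sqrt)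
  then show "(\<lambda>n. f n * ln (real (Suc n)) ^ j) \<longlonglongrightarrow> 0"
  proof (rule Lim_null_comparison[rotated], intro always_eventually allI)
    fix n
    have l: "0 \<le> ln (real (Suc n))" by simp
    have "norm (f n * ln (real (Suc n)) ^ j) = \<bar>f n\<bar> * ln (real (Suc n)) ^ j"
      using l by (simp add: abs_mult)
    also have "\<dots> \<le> C / sqrt (real (Suc n)) * (ln (real (Suc n)) + 1) ^ j"
      using l order_trans[OF abs_ge_zero assms] by (intro mult_mono assms power_mono) auto
    finally show "norm (f n * ln (real (Suc n)) ^ j) \<le> C * ((ln (real (Suc n)) + 1) ^ j / sqrt (real (Suc n)))"
      by simp
  qed
qed

lemma harm_rate:
  assumes "1 \<le> n"
  shows "\<bar>harm n - (ln (real n) + euler_mascheroni)\<bar> \<le> 1 / real n"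
proof -
  have "ln (real (Suc n)) - ln (real n) \<le> 1 / real n"
  proof -
    have "ln (real (Suc n)) - ln (real n) = ln (1 + 1 / real n)"
    proof -
      have "1 + 1 / real n = real (Suc n) / real n" using assms by (simp add: field_simps)
      then show ?thesis using assms by (simp add: ln_div)
    qed
    also have "\<dots> \<le> 1 / real n" by (rule ln_add_one_self_le_self) simp
    finally show ?thesis .
  qed
  moreover have "ln (real n) \<le> ln (real (Suc n))" using assms by simp
  moreover have "inverse (real (2 * (n + 1))) \<ge> 0" "inverse (real (2 * n)) \<le> 1 / real n"
    using assms by (auto simp: field_simps)
  moreover have "harm n - ln (real (Suc n)) + inverse (real (2 * (n + 1))) \<le> euler_mascheroni"
    "euler_mascheroni \<le> harm n - ln (real (Suc n)) + inverse (real (2 * n))"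
    using euler_mascheroni_bounds[OF assms] by (simp_all only: atLeastAtMost_iff)
  ultimately show ?thesis unfolding abs_le_iff by linarith
qed

lemma sqrt_le_power:
  assumes "1 \<le> c"
  shows "sqrt (real (Suc n)) \<le> sqrt (real (Suc n ^ c))" "sqrt (real (Suc n)) \<le> real (Suc n ^ c)"
proof -
  have "Suc n ^ 1 \<le> Suc n ^ c" using assms by (intro power_increasing) auto
  then have le: "real (Suc n) \<le> real (Suc n ^ c)" by (simp only: of_nat_le_iff) simp
  then show "sqrt (real (Suc n)) \<le> sqrt (real (Suc n ^ c))" by simp
  have "sqrt (real (Suc n)) \<le> real (Suc n)"
    by (rule real_le_lsqrt) (auto simp: power2_eq_square)
  then show "sqrt (real (Suc n)) \<le> real (Suc n ^ c)" using le by simp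
qed

text \<open>Truncating at the power \<open>M\<^sup>c\<close> moves the regularization parameter to \<open>c ln M + \<gamma>\<close>. Varying \<open>c\<close>
  later separates \<open>T\<^sub>1\<close> from \<open>T\<^sub>2\<close>.\<close>
lemma asymptotic_reg_tz:
  assumes "1 \<le> c"
  shows "asymptotic_reg Harmonic (\<lambda>n. tz (Suc n ^ c)) (\<lambda>n. ln (real (Suc n))) (real c) euler_mascheroni"
proof
  show "filterlim (\<lambda>n. ln (real (Suc n))) at_top sequentially" by real_asymp
  show "0 < real c" using assms by simp
  show "negl (\<lambda>n. ln (real (Suc n))) (\<lambda>n. tz (Suc n ^ c) [1] - (real c * ln (real (Suc n)) + euler_mascheroni))"
  proof (rule negl_sqrtI)
    fix n
    have "\<bar>tz (Suc n ^ c) [1] - (real c * ln (real (Suc n)) + euler_mascheroni)\<bar> \<le> 1 / real (Suc n ^ c)"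
      using harm_rate[of "Suc n ^ c"] unfolding tz_one by (simp add: ln_realpow del: of_nat_Suc)
    also have "\<dots> \<le> 1 / sqrt (real (Suc n))"
      using sqrt_le_power(2)[OF assms, of n] by (intro divide_left_mono) auto
    finally show "\<bar>tz (Suc n ^ c) [1] - (real c * ln (real (Suc n)) + euler_mascheroni)\<bar>
       \<le> 1 / sqrt (real (Suc n))" .
  qed
  fix k assume "admissible k"
  then obtain C where C: "C \<ge> 0" "\<And>N. N \<ge> 1 \<Longrightarrow> \<bar>tz N k - mzv k\<bar> \<le> C / sqrt (real N)"
    using tz_mzv_rate by blast
  show "negl (\<lambda>n. ln (real (Suc n))) (\<lambda>n. tz (Suc n ^ c) k - mzv k)"
  proof (rule negl_sqrtI)
    fix n
    have "\<bar>tz (Suc n ^ c) k - mzv k\<bar> \<le> C / sqrt (real (Suc n ^ c))" by (rule C) simp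
    also have "\<dots> \<le> C / sqrt (real (Suc n))"
      using sqrt_le_power(1)[OF assms, of n] C(1) by (intro divide_left_mono) auto
    finally show "\<bar>tz (Suc n ^ c) k - mzv k\<bar> \<le> C / sqrt (real (Suc n))" .
  qed
next
  fix n k l
  show "tz (Suc n ^ c) k * tz (Suc n ^ c) l = (\<Sum>m\<in>#prod_expand Harmonic k l. tz (Suc n ^ c) m)"
    unfolding tz_def prod_expand_def by (simp add: mqs_stuffle)
qed

section \<open>Multiple polylogarithms and the shuffle regularization\<close>

lemma shw_snoc:
  "shw (u @ [a]) (v @ [b]) = image_mset (\<lambda>w. w @ [a]) (shw u (v @ [b]))
     + image_mset (\<lambda>w. w @ [b]) (shw (u @ [a]) v)"
proof (induction u v rule: shw.induct)
  case (1 v)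
  show ?case
    by (induction v) (auto simp: image_mset.compositionality o_def)
next
  case (2 c u)
  have "shw (u @ [a]) [b] = image_mset (\<lambda>w. w @ [a]) (shw u [b]) + {#u @ [a, b]#}" for u
    by (induction u) (auto simp: image_mset.compositionality o_def shw_Nil_right)
  from this[of "c # u"] show ?case by (simp add: shw_Nil_right)
next
  case (3 c u d v)
  then show ?case by (simp add: image_mset.compositionality o_def)
qed

text \<open>Iterated integrals peel off the last letter of a word and \<open>shw\<close> the first,
  so words are reversed before the series are formed.\<close>

lemma image_rev_shw: "image_mset rev (shw u v) = shw (rev u) (rev v)"
proof (induction "length u + length v" arbitrary: u v rule: less_induct)
  case less
  show ?case
  proof (cases "u = [] \<or> v = []")
    case True
    then show ?thesis by (auto simp: shw_Nil_right)
  next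
    case False
    then obtain u' a v' b where uv: "u = u' @ [a]" "v = v' @ [b]"
      by (metis rev_exhaust)
    have "image_mset rev (shw u v) = image_mset ((#) a) (image_mset rev (shw u' v))
       + image_mset ((#) b) (image_mset rev (shw u v'))"
      unfolding uv shw_snoc by (simp add: image_mset.compositionality o_def)
    also have "\<dots> = image_mset ((#) a) (shw (rev u') (rev v)) + image_mset ((#) b) (shw (rev u) (rev v'))"
      using less[of u' v] less[of u v'] uv by simp
    also have "\<dots> = shw (rev u) (rev v)" by (simp add: uv)
    finally show ?thesis .
  qed
qed

text \<open>Series of iterated integrals, the head being the outermost letter: \<open>False\<close>
  integrates against \<open>dz / z\<close> and \<open>True\<close> against
  \<open>dz / (1 - z)\<close>. Division by \<open>real 0\<close> supplies the constant coefficient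
  0; in particular \<open>[False]\<close> gets the zero series instead of a logarithm.\<close>

fun word_fps :: "bool list \<Rightarrow> real fps" where
  "word_fps [] = 1"
| "word_fps (False # w) = Abs_fps (\<lambda>n. fps_nth (word_fps w) n / real n)"
| "word_fps (True # w) = Abs_fps (\<lambda>n. (\<Sum>i<n. fps_nth (word_fps w) i) / real n)"

lemma word_fps_0: "w \<noteq> [] \<Longrightarrow> fps_nth (word_fps w) 0 = 0"
  by (induction w rule: word_fps.induct) auto

text \<open>The differential form of a letter multiplied by \<open>z\<close>:
  \<open>z / (1 - z)\<close> for \<open>True\<close> and 1 for \<open>False\<close>.\<close>

definition form_fps :: "bool \<Rightarrow> real fps" where
  "form_fps a = (if a then Abs_fps (\<lambda>n. if n = 0 then 0 else 1) else 1)"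

lemma form_True_mult: "fps_nth (form_fps True * f) n = (\<Sum>i<n. fps_nth f i)"
proof -
  have "fps_nth (f * form_fps True) n = (\<Sum>i=0..n. if i = n then 0 else fps_nth f i)"
    unfolding fps_mult_nth by (rule sum.cong) (auto simp: form_fps_def)
  also have "\<dots> = (\<Sum>i<n. fps_nth f i)"
    by (rule sum.mono_neutral_cong_right) auto
  finally show ?thesis by (simp add: mult.commute)
qed

lemma X_deriv_word_fps:
  assumes "\<not> a \<longrightarrow> w \<noteq> []"
  shows "fps_X * fps_deriv (word_fps (a # w)) = form_fps a * word_fps w"
proof (rule fps_ext)
  fix n
  have "fps_nth (fps_X * fps_deriv f) n = real n * fps_nth f n" for f :: "real fps"
    by (cases n) auto
  then show "fps_nth (fps_X * fps_deriv (word_fps (a # w))) n = fps_nth (form_fps a * word_fps w) n"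
    using assms word_fps_0[of w]
    by (cases a; cases "n = 0") (auto simp: form_True_mult, simp_all add: form_fps_def)
qed

lemma X_deriv_eqD:
  assumes "fps_X * fps_deriv f = fps_X * fps_deriv (g :: real fps)" "fps_nth f 0 = fps_nth g 0"
  shows "f = g"
proof (rule fps_ext)
  fix n
  have "fps_nth (fps_X * fps_deriv f) n = real n * fps_nth f n" for f :: "real fps"
    by (cases n) auto
  then have "real n * fps_nth f n = real n * fps_nth g n" using assms(1) by metis
  then show "fps_nth f n = fps_nth g n" using assms(2) by (cases "n = 0") auto
qed

lemma length_shw: "m \<in># shw u v \<Longrightarrow> length m = length u + length v"
  by (induction u v arbitrary: m rule: shw.induct) fastforce+

lemma X_deriv_sum_mset:
  "fps_X * fps_deriv (\<Sum>m\<in>#A. f m) = (\<Sum>m\<in>#A. fps_X * fps_deriv (f m :: real fps))"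
  by (induction A) (auto simp: algebra_simps)

lemma fps_nth_sum_mset: "fps_nth (\<Sum>m\<in>#A. f m) n = (\<Sum>m\<in>#A. fps_nth (f m) n)"
  by (induction A) auto

text \<open>Both sides have the same Euler derivative \<open>X d/dX\<close>. The hypotheses exclude the divergent word
  \<open>e\<^sub>0\<close>; words are read backwards here, so \<open>e\<^sub>1\<close> is the last letter.\<close>
lemma word_fps_shuffle:
  assumes "u = [] \<or> last u" "v = [] \<or> last v"
  shows "word_fps u * word_fps v = (\<Sum>m\<in>#shw u v. word_fps m)"
  using assms
proof (induction u v rule: shw.induct)
  case (3 a u b v)
  let ?S = "\<lambda>u v. \<Sum>m\<in>#shw u v. word_fps m"
  have au: "\<not> a \<longrightarrow> u \<noteq> []" "u = [] \<or> last u" using 3(3) by (auto split: if_splits)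
  have bv: "\<not> b \<longrightarrow> v \<noteq> []" "v = [] \<or> last v" using 3(4) by (auto split: if_splits)
  have IH1: "word_fps u * word_fps (b # v) = ?S u (b # v)" using 3 au by blast
  have IH2: "word_fps (a # u) * word_fps v = ?S (a # u) v" using 3 bv by blast
  have D: "(\<Sum>m\<in>#A. fps_X * fps_deriv (word_fps (c # m))) = form_fps c * (\<Sum>m\<in>#A. word_fps m)"
    if "\<And>m. m \<in># A \<Longrightarrow> m \<noteq> []" for A c
  proof -
    have "(\<Sum>m\<in>#A. fps_X * fps_deriv (word_fps (c # m))) = (\<Sum>m\<in>#A. form_fps c * word_fps m)"
      using that X_deriv_word_fps by (intro arg_cong[where f = sum_mset] image_mset_cong) blast
    then show ?thesis by (simp add: sum_mset_mult_left)
  qed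
  have ne: "m \<noteq> []" if "m \<in># shw u (b # v) \<or> m \<in># shw (a # u) v" for m
    using that length_shw by fastforce
  show ?case
  proof (rule X_deriv_eqD)
    have "fps_X * fps_deriv (word_fps (a # u) * word_fps (b # v))
       = (fps_X * fps_deriv (word_fps (a # u))) * word_fps (b # v)
       + word_fps (a # u) * (fps_X * fps_deriv (word_fps (b # v)))"
      by (simp only: fps_deriv_mult distrib_left mult_ac) (simp only: add.commute)
    also have "\<dots> = form_fps a * ?S u (b # v) + form_fps b * ?S (a # u) v"
      unfolding X_deriv_word_fps[OF au(1)] X_deriv_word_fps[OF bv(1)] IH1[symmetric] IH2[symmetric]
      by (simp only: mult_ac)
    also have "\<dots> = fps_X * fps_deriv (?S (a # u) (b # v))"
      using ne by (simp add: X_deriv_sum_mset image_mset.compositionality o_def distrib_left D)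
    finally show "fps_X * fps_deriv (word_fps (a # u) * word_fps (b # v))
       = fps_X * fps_deriv (?S (a # u) (b # v))" .
    show "fps_nth (word_fps (a # u) * word_fps (b # v)) 0 = fps_nth (?S (a # u) (b # v)) 0"
      by (simp add: word_fps_0 fps_nth_sum_mset image_mset.compositionality o_def)
  qed
qed auto

definition index_fps :: "nat list \<Rightarrow> real fps" where
  "index_fps k = word_fps (rev (i2w k))"

lemma index_fps_mult:
  assumes "is_index k" "is_index l"
  shows "index_fps k * index_fps l = (\<Sum>m\<in>#prod_expand Shuffle k l. index_fps m)"
proof -
  have good: "rev (i2w k) = [] \<or> last (rev (i2w k))" for k
    using i2w_hd[of k] by (cases "k = []") (auto simp: last_rev)
  have hd: "m = [] \<or> hd m" if "m \<in># shw (i2w k) (i2w l)" for m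
  proof -
    have "m \<in># shw u v \<Longrightarrow> u = [] \<or> hd u \<Longrightarrow> v = [] \<or> hd v \<Longrightarrow> m = [] \<or> hd m" for u v
      by (induction u v rule: shw.induct) auto
    then show ?thesis using that i2w_hd by (metis i2w_Nil)
  qed
  have "index_fps k * index_fps l = (\<Sum>m\<in>#shw (rev (i2w k)) (rev (i2w l)). word_fps m)"
    unfolding index_fps_def by (rule word_fps_shuffle[OF good good])
  also have "\<dots> = (\<Sum>m\<in>#shw (i2w k) (i2w l). word_fps (rev m))"
    by (simp add: image_rev_shw[symmetric] image_mset.compositionality o_def)
  also have "\<dots> = (\<Sum>m\<in>#shw (i2w k) (i2w l). index_fps (w2i m))"
    unfolding index_fps_def using hd i2w_w2i
    by (intro arg_cong[where f = sum_mset] image_mset_cong) metis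
  finally show ?thesis by (simp add: prod_expand_def image_mset.compositionality o_def)
qed

lemma word_fps_replicate:
  "fps_nth (word_fps (replicate j False @ w)) n = fps_nth (word_fps w) n / real n ^ j"
  by (induction j) auto

text \<open>The coefficient of degree \<open>n\<close> collects the terms whose largest summation
  variable is \<open>n\<close>: the letter \<open>True\<close> sums over the smaller variables and
  divides by \<open>n\<close>, and the \<open>a - 1\<close> letters \<open>False\<close> divide
  again. Adding the coefficients up to \<open>N\<close> gives the truncation.\<close>

lemma sum_index_fps: "is_index k \<Longrightarrow> (\<Sum>i\<le>N. fps_nth (index_fps k) i) = tz N k"
proof (induction k arbitrary: N rule: rev_induct)
  case Nil
  have "(\<Sum>i\<le>N. fps_nth (1 :: real fps) i) = 1" by (induction N) auto
  then show ?case by (simp add: index_fps_def)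
next
  case (snoc a k)
  then have k: "is_index k" and a: "0 < a" by (auto simp: is_index_def)
  have rw: "rev (i2w (k @ [a])) = replicate (a - 1) False @ True # rev (i2w k)"
    by (simp add: i2w_snoc)
  have c: "fps_nth (index_fps (k @ [a])) (Suc n) = tz n k / real (Suc n) ^ a" for n
  proof -
    have "(\<Sum>i<Suc n. fps_nth (word_fps (rev (i2w k))) i) = tz n k"
      using snoc.IH[OF k, of n] by (simp add: index_fps_def lessThan_Suc_atMost)
    then have "fps_nth (index_fps (k @ [a])) (Suc n) = tz n k / real (Suc n) / real (Suc n) ^ (a - 1)"
      unfolding index_fps_def rw word_fps_replicate by (simp del: sum.lessThan_Suc of_nat_Suc)
    also have "\<dots> = tz n k / real (Suc n) ^ a"
      using a by (cases a) (simp_all add: field_simps)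
    finally show ?thesis .
  qed
  show ?case
  proof (induction N)
    case 0
    have "rev (i2w (k @ [a])) \<noteq> []" by (simp add: i2w_snoc)
    then show ?case by (simp add: tz_0 index_fps_def word_fps_0)
  next
    case (Suc N)
    then show ?case by (simp add: c tz_Suc)
  qed
qed

lemma index_fps_nonneg: "0 \<le> fps_nth (index_fps k) n"
proof -
  have "0 \<le> fps_nth (word_fps w) n" for w
    by (induction w arbitrary: n rule: word_fps.induct) (auto intro!: sum_nonneg divide_nonneg_nonneg simp: fps_one_nth)
  then show ?thesis by (simp add: index_fps_def)
qed

section \<open>Convergence of multiple polylogarithms and Abel means\<close>

lemma tz_linear_bound:
  assumes "is_index k"
  shows "\<exists>C\<ge>0. \<forall>n. tz n k \<le> C * real (Suc n)"
proof -
  obtain C where C: "C \<ge> 0" "\<And>n. harm n ^ length k \<le> C * sqrt (real (Suc n))"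
    using harm_power_bound by blast
  have "tz n k \<le> C * real (Suc n)" for n
  proof -
    have "sqrt (real (Suc n)) \<le> real (Suc n)"
      by (rule real_le_lsqrt) (auto simp: power2_eq_square)
    then have "C * sqrt (real (Suc n)) \<le> C * real (Suc n)" using C(1) by (rule mult_left_mono)
    then show ?thesis using tz_le_harm[OF assms, of n] C(2)[of n] by linarith
  qed
  then show ?thesis using C(1) by blast
qed

lemma summable_linear_bound:
  assumes "\<And>n. \<bar>f n\<bar> \<le> C * real (Suc n)" "0 \<le> z" "z < 1"
  shows "summable (\<lambda>n. norm (f n * z ^ n :: real))"
proof (rule summable_comparison_test')
  show "summable (\<lambda>n. C * (of_nat (Suc n) * z ^ n))"
    using geometric_deriv_sums[of z] assms(2,3) by (intro summable_mult) (auto simp: sums_iff)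
  fix n
  have "norm (norm (f n * z ^ n)) = \<bar>f n\<bar> * z ^ n" using assms(2) by (simp add: abs_mult)
  also have "\<dots> \<le> C * real (Suc n) * z ^ n" using assms(1,2) by (intro mult_right_mono) auto
  finally show "norm (norm (f n * z ^ n)) \<le> C * (of_nat (Suc n) * z ^ n)" by (simp add: mult.assoc)
qed

definition polylog :: "real \<Rightarrow> nat list \<Rightarrow> real" where
  "polylog z k = (\<Sum>n. fps_nth (index_fps k) n * z ^ n)"

lemma summable_index_fps:
  assumes "is_index k" "0 \<le> z" "z < 1"
  shows "summable (\<lambda>n. norm (fps_nth (index_fps k) n * z ^ n))" "summable (\<lambda>n. norm (tz n k * z ^ n))"
proof -
  obtain C where C: "\<And>n. tz n k \<le> C * real (Suc n)" using tz_linear_bound[OF assms(1)] by blast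
  show "summable (\<lambda>n. norm (tz n k * z ^ n))"
    using C assms tz_nonneg by (intro summable_linear_bound) auto
  have "fps_nth (index_fps k) n \<le> tz n k" for n
    unfolding sum_index_fps[OF assms(1), symmetric]
    by (rule member_le_sum) (auto simp: index_fps_nonneg)
  then show "summable (\<lambda>n. norm (fps_nth (index_fps k) n * z ^ n))"
    using C assms index_fps_nonneg
    by (intro summable_linear_bound[of _ C]) (auto intro: order_trans)
qed

lemma polylog_mult:
  assumes "is_index k" "is_index l" "0 \<le> z" "z < 1"
  shows "polylog z k * polylog z l = (\<Sum>m\<in>#prod_expand Shuffle k l. polylog z m)"
proof -
  have "polylog z k * polylog z l
     = (\<Sum>n. \<Sum>i\<le>n. (fps_nth (index_fps k) i * z ^ i) * (fps_nth (index_fps l) (n - i) * z ^ (n - i)))"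
    unfolding polylog_def
    by (rule Cauchy_product[OF summable_index_fps(1)[OF assms(1,3,4)] summable_index_fps(1)[OF assms(2,3,4)]])
  also have "\<dots> = (\<Sum>n. fps_nth (index_fps k * index_fps l) n * z ^ n)"
  proof (rule suminf_cong)
    fix n
    show "(\<Sum>i\<le>n. (fps_nth (index_fps k) i * z ^ i) * (fps_nth (index_fps l) (n - i) * z ^ (n - i)))
      = fps_nth (index_fps k * index_fps l) n * z ^ n"
      unfolding fps_mult_nth sum_distrib_right atLeast0AtMost
    proof (rule sum.cong)
      fix i assume "i \<in> {..n}"
      then have "z ^ n = z ^ i * z ^ (n - i)" by (simp flip: power_add)
      then show "(fps_nth (index_fps k) i * z ^ i) * (fps_nth (index_fps l) (n - i) * z ^ (n - i))
        = fps_nth (index_fps k) i * fps_nth (index_fps l) (n - i) * z ^ n"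
        by (simp only: mult_ac)
    qed simp
  qed
  also have "\<dots> = (\<Sum>m\<in>#prod_expand Shuffle k l. polylog z m)"
  proof -
    have *: "summable (\<lambda>n. fps_nth (\<Sum>m\<in>#A. index_fps m) n * z ^ n)
       \<and> (\<Sum>n. fps_nth (\<Sum>m\<in>#A. index_fps m) n * z ^ n) = (\<Sum>m\<in>#A. polylog z m)"
      if "\<And>m. m \<in># A \<Longrightarrow> is_index m" for A
      using that
    proof (induction A)
      case (add m A)
      have m: "is_index m" by (rule add.prems) simp
      have 1: "summable (\<lambda>n. fps_nth (index_fps m) n * z ^ n)"
        by (rule summable_norm_cancel) (rule summable_index_fps(1)[OF m assms(3,4)])
      have IH: "summable (\<lambda>n. fps_nth (\<Sum>m\<in>#A. index_fps m) n * z ^ n)"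
        "(\<Sum>n. fps_nth (\<Sum>m\<in>#A. index_fps m) n * z ^ n) = (\<Sum>m\<in>#A. polylog z m)"
        using add.IH add.prems by auto
      have eq: "(\<lambda>n. fps_nth (\<Sum>m\<in>#add_mset m A. index_fps m) n * z ^ n)
        = (\<lambda>n. fps_nth (index_fps m) n * z ^ n + fps_nth (\<Sum>m\<in>#A. index_fps m) n * z ^ n)"
        by (simp add: distrib_right)
      show ?case
        unfolding eq suminf_add[OF 1 IH(1), symmetric] IH(2)
        using summable_add[OF 1 IH(1)] by (simp add: polylog_def[of z m])
    qed simp
    have "is_index m" if "m \<in># prod_expand Shuffle k l" for m
      using that by (auto simp: prod_expand_def is_index_w2i)
    from conjunct2[OF *[OF this]] show ?thesis unfolding index_fps_mult[OF assms(1,2)] .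
  qed
  finally show ?thesis .
qed

text \<open>Multiplication by the geometric series turns coefficients into partial sums, which are
  the truncated values.\<close>

lemma polylog_eq_tz:
  assumes "is_index k" "0 \<le> z" "z < 1"
  shows "polylog z k = (1 - z) * (\<Sum>n. tz n k * z ^ n)"
proof -
  have "(\<Sum>n. z ^ n) * polylog z k
     = (\<Sum>n. \<Sum>i\<le>n. z ^ (n - i) * (fps_nth (index_fps k) i * z ^ i))"
    unfolding polylog_def mult.commute[of "\<Sum>n. z ^ n"]
    by (subst Cauchy_product)
       (use summable_index_fps[OF assms] assms in \<open>auto simp: mult.commute\<close>)
  also have "\<dots> = (\<Sum>n. tz n k * z ^ n)"
    unfolding sum_index_fps[OF assms(1), symmetric] sum_distrib_right
  proof (intro suminf_cong sum.cong refl)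
    fix n i :: nat assume "i \<in> {..n}"
    then have "z ^ n = z ^ (n - i) * z ^ i" by (simp flip: power_add)
    then show "z ^ (n - i) * (fps_nth (index_fps k) i * z ^ i) = fps_nth (index_fps k) i * z ^ n"
      by (simp only: mult_ac)
  qed
  finally have "(1 / (1 - z)) * polylog z k = (\<Sum>n. tz n k * z ^ n)"
    using suminf_geometric[of z] assms by simp
  then show ?thesis using assms by (simp add: field_simps)
qed

lemma abel_bound:
  fixes f :: "nat \<Rightarrow> real"
  assumes "\<And>N. \<bar>f N\<bar> \<le> B" "\<And>N. N \<ge> K \<Longrightarrow> \<bar>f N\<bar> \<le> S" "K \<ge> 1" "0 \<le> S" and z: "z = 1 - 1 / real K ^ 2"
  shows "\<bar>(1 - z) * (\<Sum>N. f N * z ^ N)\<bar> \<le> B / real K + S"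
proof -
  have B: "0 \<le> B" using assms(1)[of 0] by linarith
  have z01: "0 \<le> z" "z < 1" using assms(3) by (auto simp: z)
  let ?g = "\<lambda>N. (if N < K then B else 0) + S * z ^ N"
  have le: "norm (f N * z ^ N) \<le> ?g N" for N
  proof (cases "N < K")
    case True
    have "\<bar>f N\<bar> * z ^ N \<le> B * 1"
      using assms(1) z01 B by (intro mult_mono) (auto intro: power_le_one)
    then show ?thesis using True z01 assms(4) by (simp add: abs_mult add_increasing2)
  next
    case False
    then show ?thesis using assms(2)[of N] z01 by (simp add: abs_mult mult_right_mono)
  qed
  have s1: "(\<lambda>N. if N < K then B else 0) sums (\<Sum>N<K. B)"
    using sums_If_finite[of "\<lambda>N. N < K" "\<lambda>_. B"] by (simp add: lessThan_def)
  have s2: "(\<lambda>N. S * z ^ N) sums (S * (1 / (1 - z)))"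
    using z01 by (intro sums_mult geometric_sums) simp
  have sg: "?g sums (real K * B + S / (1 - z))" using sums_add[OF s1 s2] by simp
  have sf: "summable (\<lambda>N. norm (f N * z ^ N))"
    by (rule summable_comparison_test'[OF sums_summable[OF sg]]) (use le in auto)
  have "\<bar>\<Sum>N. f N * z ^ N\<bar> \<le> (\<Sum>N. norm (f N * z ^ N))"
    using summable_norm[OF sf] by simp
  also have "\<dots> \<le> real K * B + S / (1 - z)"
    using suminf_le[OF le sf sums_summable[OF sg]] sg by (simp add: sums_iff)
  finally have "(1 - z) * \<bar>\<Sum>N. f N * z ^ N\<bar> \<le> (1 - z) * (real K * B + S / (1 - z))"
    using z01 by (intro mult_left_mono) auto
  also have "\<dots> = B / real K + S"
    using assms(3) by (simp add: z field_simps power2_eq_square)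
  finally show ?thesis using z01 by (simp add: abs_mult)
qed

text \<open>With \<open>1 - z = 1 / K\<^sup>2\<close> the first \<open>K\<close> terms of an Abel mean have total weight at most \<open>1 / K\<close>.\<close>
definition abel_point :: "nat \<Rightarrow> real" where
  "abel_point n = 1 - 1 / real (Suc n) ^ 2"

lemma abel_point: "0 \<le> abel_point n" "abel_point n < 1"
proof -
  have "1 \<le> real (Suc n) ^ 2" by (rule one_le_power) simp
  then show "0 \<le> abel_point n" "abel_point n < 1"
    unfolding abel_point_def by (auto simp: divide_le_eq simp del: of_nat_Suc)
qed

lemma polylog_one:
  assumes "0 \<le> z" "z < 1"
  shows "polylog z [1] = - ln (1 - z)"
proof -
  have c: "fps_nth (index_fps [1]) n = 1 / real n" for n
  proof -
    have "(\<Sum>i<n. fps_nth (1 :: real fps) i) = (if n = 0 then 0 else 1)"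
      by (induction n) auto
    then show ?thesis by (simp add: index_fps_def i2w_Cons)
  qed
  have "(\<lambda>n. - ((- (- z)) ^ n) / real n) sums ln (1 + (- z))"
    using assms by (intro ln_series') auto
  from sums_minus[OF this] have "(\<lambda>n. fps_nth (index_fps [1]) n * z ^ n) sums (- ln (1 - z))"
    unfolding c by simp
  then show ?thesis by (simp add: polylog_def sums_iff)
qed

text \<open>At \<open>z = 1 - 1 / K ^ 2\<close> one has \<open>- ln (1 - z) = 2 * ln K\<close>,
  which explains the parameters 2 and 0. For admissible indices the difference to the zeta value is
  the Abel mean of \<open>tz N k - mzv k\<close>, which inherits the rate
  \<open>1 / sqrt K\<close>.\<close>

lemma asymptotic_reg_polylog:
  "asymptotic_reg Shuffle (\<lambda>n. polylog (abel_point n)) (\<lambda>n. ln (real (Suc n))) 2 0"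
proof
  show "filterlim (\<lambda>n. ln (real (Suc n))) at_top sequentially" by real_asymp
  have "polylog (abel_point n) [1] = 2 * ln (real (Suc n))" for n
    unfolding polylog_one[OF abel_point]
    by (simp add: abel_point_def ln_div ln_realpow del: of_nat_Suc)
  then show "negl (\<lambda>n. ln (real (Suc n))) (\<lambda>n. polylog (abel_point n) [1] - (2 * ln (real (Suc n)) + 0))"
    by simp
next
  fix k assume k: "admissible k"
  then have ix: "is_index k" by (simp add: admissible_def)
  obtain C where C: "C \<ge> 0" "\<And>N. N \<ge> 1 \<Longrightarrow> \<bar>tz N k - mzv k\<bar> \<le> C / sqrt (real N)"
    using tz_mzv_rate[OF k] by blast
  \<comment> \<open>The rate says nothing about \<open>N = 0\<close>, so the global bound takes this
    term in separately.\<close>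
  define B where "B = max C \<bar>tz 0 k - mzv k\<bar>"
  have B: "\<bar>tz N k - mzv k\<bar> \<le> B" for N
  proof (cases "N = 0")
    case False
    then have "C / sqrt (real N) \<le> C / 1" using C(1) by (intro divide_left_mono) auto
    then show ?thesis using C(2)[of N] False by (simp add: B_def)
  qed (simp add: B_def)
  show "negl (\<lambda>n. ln (real (Suc n))) (\<lambda>n. polylog (abel_point n) k - mzv k)"
  proof (rule negl_sqrtI)
    fix n
    let ?z = "abel_point n" and ?K = "Suc n"
    have s: "summable (\<lambda>N. tz N k * ?z ^ N)"
      by (rule summable_norm_cancel) (rule summable_index_fps(2)[OF ix abel_point])
    have "(\<Sum>N. (tz N k - mzv k) * ?z ^ N) = (\<Sum>N. tz N k * ?z ^ N) - mzv k * (1 / (1 - ?z))"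
      using s abel_point[of n] suminf_geometric[of ?z]
      by (simp add: left_diff_distrib suminf_diff[symmetric] suminf_mult summable_mult)
    then have eq: "polylog ?z k - mzv k = (1 - ?z) * (\<Sum>N. (tz N k - mzv k) * ?z ^ N)"
      using abel_point[of n] by (simp add: polylog_eq_tz[OF ix abel_point] right_diff_distrib)
    have "\<bar>polylog ?z k - mzv k\<bar> \<le> B / real ?K + C / sqrt (real ?K)"
      unfolding eq
    proof (rule abel_bound[OF B])
      fix N assume "?K \<le> N"
      then have "C / sqrt (real N) \<le> C / sqrt (real ?K)"
        using C(1) by (intro divide_left_mono) auto
      then show "\<bar>tz N k - mzv k\<bar> \<le> C / sqrt (real ?K)" using C(2)[of N] \<open>?K \<le> N\<close> by simp
    qed (use C in \<open>auto simp: abel_point_def\<close>)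
    also have "B / real ?K \<le> B / sqrt (real ?K)"
    proof -
      have "sqrt (real ?K) \<le> real ?K" using sqrt_le_power(2)[of 1 n] by simp
      moreover have "0 \<le> B" using C(1) by (simp add: B_def)
      ultimately show ?thesis by (intro divide_left_mono) auto
    qed
    finally show "\<bar>polylog ?z k - mzv k\<bar> \<le> (B + C) / sqrt (real ?K)"
      by (simp add: add_divide_distrib)
  qed
next
  fix n k l assume "is_index k" "is_index l"
  then show "polylog (abel_point n) k * polylog (abel_point n) l
     = (\<Sum>m\<in>#prod_expand Shuffle k l. polylog (abel_point n) m)"
    by (intro polylog_mult abel_point)
qed simp

text \<open>A harmonic relation makes the corresponding combination of truncated sums a null
  sequence, hence its Abel means tend to 0. These are the same combination of polylogarithms, so its
  asymptotic polynomial vanishes. No explicit comparison map between the two regularizations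
  enters.\<close>

lemma harmonic_relation_imp_shuffle:
  assumes P: "finite P" "\<And>p. p \<in> P \<Longrightarrow> is_index (\<kappa> p)"
    and rel: "(\<Sum>p\<in>P. smult (c p) (zeta_reg Harmonic (\<kappa> p))) = 0"
  shows "(\<Sum>p\<in>P. smult (c p) (zeta_reg Shuffle (\<kappa> p))) = 0"
proof -
  interpret H: asymptotic_reg Harmonic "\<lambda>n. tz (Suc n ^ 1)" "\<lambda>n. ln (real (Suc n))" "real 1" euler_mascheroni
    by (rule asymptotic_reg_tz) simp
  interpret S: asymptotic_reg Shuffle "\<lambda>n. polylog (abel_point n)" "\<lambda>n. ln (real (Suc n))" 2 0
    by (rule asymptotic_reg_polylog)
  define f where "f N = (\<Sum>p\<in>P. c p * tz N (\<kappa> p))" for N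
  have "H.asymp (\<lambda>n. \<Sum>p\<in>P. c p * tz (Suc n ^ 1) (\<kappa> p)) (\<Sum>p\<in>P. smult (c p) (zeta_reg Harmonic (\<kappa> p)))"
    using P by (intro H.asymp_sum H.asymp_cmult H.zeta_reg_asymp) auto
  then have "(\<lambda>n. f (Suc n)) \<longlonglongrightarrow> 0"
    unfolding rel H.asymp_def f_def using negl_tendsto by fastforce
  then have f: "f \<longlonglongrightarrow> 0" by (rule LIMSEQ_imp_Suc)
  then have "Bseq f" by (intro convergent_imp_Bseq convergentI)
  then obtain B where B: "0 < B" "\<And>N. \<bar>f N\<bar> \<le> B" by (auto simp: Bseq_def)
  define g where "g n = (\<Sum>p\<in>P. c p * polylog (abel_point n) (\<kappa> p))" for n
  have g: "g n = (1 - abel_point n) * (\<Sum>N. f N * abel_point n ^ N)" for n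
  proof -
    have s: "summable (\<lambda>N. c p * (tz N (\<kappa> p) * abel_point n ^ N))" if "p \<in> P" for p
      by (intro summable_mult summable_norm_cancel[OF summable_index_fps(2)] abel_point P that)
    have "(\<Sum>N. f N * abel_point n ^ N) = (\<Sum>p\<in>P. \<Sum>N. c p * (tz N (\<kappa> p) * abel_point n ^ N))"
      unfolding f_def sum_distrib_right mult.assoc using s by (intro suminf_sum)
    also have "\<dots> = (\<Sum>p\<in>P. c p * (\<Sum>N. tz N (\<kappa> p) * abel_point n ^ N))"
      by (intro sum.cong refl suminf_mult summable_norm_cancel[OF summable_index_fps(2)] abel_point P)
    finally show ?thesis
      unfolding g_def by (simp add: sum_distrib_left polylog_eq_tz[OF P(2) abel_point] mult_ac)
  qed
  have "g \<longlonglongrightarrow> 0"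
  proof (rule LIMSEQ_I)
    fix e :: real assume e: "0 < e"
    obtain N0 where N0: "\<And>N. N \<ge> N0 \<Longrightarrow> \<bar>f N\<bar> < e / 2"
      using LIMSEQ_D[OF f, of "e / 2"] e by auto
    have "(\<lambda>n. B / real (Suc n)) \<longlonglongrightarrow> 0" by real_asymp
    then have "\<forall>\<^sub>F n in sequentially. B / real (Suc n) < e / 2"
      using e by (intro order_tendstoD) auto
    then obtain N1 where N1: "\<And>n. n \<ge> N1 \<Longrightarrow> B / real (Suc n) < e / 2"
      unfolding eventually_sequentially by blast
    have "norm (g n - 0) < e" if n: "n \<ge> max N0 N1" for n
    proof -
      have "\<bar>g n\<bar> \<le> B / real (Suc n) + e / 2"
        unfolding g
        by (rule abel_bound[OF B(2)]) (use N0 n e in \<open>auto simp: abel_point_def less_imp_le\<close>)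
      moreover have "B / real (Suc n) < e / 2" using n by (intro N1) simp
      ultimately show ?thesis unfolding diff_zero real_norm_def by linarith
    qed
    then show "\<exists>no. \<forall>n\<ge>no. norm (g n - 0) < e" by blast
  qed
  moreover have "S.asymp g (\<Sum>p\<in>P. smult (c p) (zeta_reg Shuffle (\<kappa> p)))"
    unfolding g_def[abs_def] using P by (intro S.asymp_sum S.asymp_cmult S.zeta_reg_asymp) auto
  ultimately show ?thesis by (intro S.asymp_tendsto_0)
qed

section \<open>The double power series ring\<close>

text \<open>Series in \<open>s\<close> (outer) and \<open>t\<close> (inner) with real coefficients: \<open>rc\<close>, \<open>rs\<close>, \<open>rt\<close>, \<open>rsum_t\<close>, \<open>rsum_s\<close>
  correspond to \<open>sc\<close>, \<open>svar\<close>, \<open>tvar\<close>, \<open>fsum_t\<close>, \<open>fsum_s\<close>.\<close>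
type_synonym rbiv = "real fps fps"

definition rc :: "real \<Rightarrow> rbiv" where "rc x = fps_const (fps_const x)"
definition rs :: rbiv where "rs = fps_X"
definition rt :: rbiv where "rt = fps_const fps_X"

lemma rc_simps: "rc 0 = 0" "rc 1 = 1" "rc (x + y) = rc x + rc y" "rc (x - y) = rc x - rc y"
  "rc (x * y) = rc x * rc y" "rc (- x) = - rc x" "rc x ^ n = rc (x ^ n)" "rc (of_nat n) = of_nat n"
proof -
  show 1: "rc 0 = 0" "rc 1 = 1" "rc (x + y) = rc x + rc y" "rc (x - y) = rc x - rc y"
    "rc (x * y) = rc x * rc y" "rc (- x) = - rc x" for x y
    by (simp_all add: rc_def fps_const_minus)
  show "rc x ^ n = rc (x ^ n)" by (induction n) (simp_all add: 1)
  show "rc (of_nat n) = of_nat n" by (induction n) (simp_all add: 1)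
qed

lemma rc_mult_nth: "fps_nth (fps_nth (rc x * F) a) c = x * fps_nth (fps_nth F a) c"
  by (simp add: rc_def)

lemma mult_rc_nth: "fps_nth (fps_nth (F * rc x) a) c = fps_nth (fps_nth F a) c * x"
  by (simp add: rc_def)

lemma rs_mult_nth: "fps_nth (fps_nth (rs * F) a) c = (if a = 0 then 0 else fps_nth (fps_nth F (a - 1)) c)"
  by (simp add: rs_def)

lemma rt_mult_nth: "fps_nth (fps_nth (rt * F) a) c = (if c = 0 then 0 else fps_nth (fps_nth F a) (c - 1))"
  by (simp add: rt_def)

text \<open>The binomial expansion of \<open>1 / (d + e1 * s + e2 * t)\<close>. Having the
  coefficients explicitly makes the bound \<open>lin_inv_nth_bound\<close> immediate.\<close>

definition lin_inv :: "real \<Rightarrow> real \<Rightarrow> real \<Rightarrow> rbiv" where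
  "lin_inv d e1 e2 = Abs_fps (\<lambda>a. Abs_fps (\<lambda>c.
     (-1) ^ (a + c) * real ((a + c) choose a) * e1 ^ a * e2 ^ c / d ^ (a + c + 1)))"

lemma lin_inv:
  assumes "d \<noteq> 0"
  shows "(rc d + rc e1 * rs + rc e2 * rt) * lin_inv d e1 e2 = 1"
proof (rule fps_ext, rule fps_ext)
  fix a c
  let ?u = "\<lambda>a c. fps_nth (fps_nth (lin_inv d e1 e2) a) c"
  have "fps_nth (fps_nth ((rc d + rc e1 * rs + rc e2 * rt) * lin_inv d e1 e2) a) c
     = d * ?u a c + e1 * (if a = 0 then 0 else ?u (a - 1) c) + e2 * (if c = 0 then 0 else ?u a (c - 1))"
    by (simp only: distrib_right fps_add_nth mult.assoc rc_mult_nth rs_mult_nth rt_mult_nth)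
  also have "\<dots> = (if a = 0 \<and> c = 0 then 1 else 0)"
  proof (cases a)
    case 0
    then show ?thesis using assms by (cases c) (simp_all add: lin_inv_def field_simps)
  next
    case a: (Suc a')
    show ?thesis
    proof (cases c)
      case 0
      then show ?thesis using assms a by (simp add: lin_inv_def field_simps)
    next
      case c: (Suc c')
      define B where "B = (-1) ^ (a' + c') * e1 ^ Suc a' * e2 ^ Suc c' / d ^ (a' + c' + 2)"
      \<comment> \<open>Pascal's rule is exactly the recursion that the coefficients of the inverse
        must satisfy.\<close>
      have p: "Suc a' + Suc c' choose Suc a' = (a' + Suc c' choose a') + (Suc a' + c' choose Suc a')"
        by simp
      have 1: "d * ?u a c = real (Suc a' + Suc c' choose Suc a') * B"
        using assms unfolding a c B_def lin_inv_def by (simp del: binomial_Suc_Suc add: field_simps)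
      have 2: "e1 * ?u a' c = - (real (a' + Suc c' choose a') * B)"
        using assms unfolding c B_def lin_inv_def by (simp del: binomial_Suc_Suc add: field_simps)
      have 3: "e2 * ?u a c' = - (real (Suc a' + c' choose Suc a') * B)"
        using assms unfolding a B_def lin_inv_def by (simp del: binomial_Suc_Suc add: field_simps)
      have "d * ?u a c + e1 * ?u a' c + e2 * ?u a c' = 0"
        unfolding 1 2 3 p by (simp only: of_nat_add) (simp add: algebra_simps)
      then show ?thesis using a c by simp
    qed
  qed
  also have "\<dots> = fps_nth (fps_nth 1 a) c" by simp
  finally show "fps_nth (fps_nth ((rc d + rc e1 * rs + rc e2 * rt) * lin_inv d e1 e2) a) c
    = fps_nth (fps_nth 1 a) c" .
qed

lemma lin_inv_nth_bound:
  assumes "1 \<le> \<bar>d\<bar>" "\<bar>e1\<bar> \<le> 1" "\<bar>e2\<bar> \<le> 1"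
  shows "\<bar>fps_nth (fps_nth (lin_inv d e1 e2) a) c\<bar> \<le> 2 ^ (a + c) / \<bar>d\<bar>"
proof -
  have e: "\<bar>e1\<bar> ^ a * \<bar>e2\<bar> ^ c \<le> 1"
    using assms by (intro mult_le_one power_le_one) auto
  have b: "real ((a + c) choose a) \<le> 2 ^ (a + c)"
    using of_nat_mono[OF binomial_le_pow2[of "a + c" a], where 'a = real] by simp
  have "real ((a + c) choose a) * (\<bar>e1\<bar> ^ a * \<bar>e2\<bar> ^ c) \<le> 2 ^ (a + c) * 1"
    by (rule mult_mono[OF b e]) auto
  moreover have "\<bar>d\<bar> \<le> \<bar>d\<bar> ^ (a + c + 1)"
    using assms power_increasing[of 1 "a + c + 1" "\<bar>d\<bar>"] by simp
  ultimately have "real ((a + c) choose a) * (\<bar>e1\<bar> ^ a * \<bar>e2\<bar> ^ c) / \<bar>d\<bar> ^ (a + c + 1) \<le> 2 ^ (a + c) / \<bar>d\<bar>"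
    using assms by (intro frac_le) auto
  then show ?thesis
    by (simp add: lin_inv_def abs_mult power_abs mult.assoc)
qed

text \<open>Positions \<open>0, \<dots>, M + N - 1\<close> enumerate \<open>1 + s, \<dots>, M + s, t - N, \<dots>, t - 1\<close> in this order.\<close>
definition pos_inv :: "nat \<Rightarrow> nat \<Rightarrow> nat \<Rightarrow> rbiv" where
  "pos_inv M N p = (if p < M then lin_inv (real (Suc p)) 1 0 else lin_inv (- real (M + N - p)) 0 1)"

definition pos_val :: "nat \<Rightarrow> nat \<Rightarrow> nat \<Rightarrow> rbiv" where
  "pos_val M N p = (if p < M then rc (real (Suc p)) + rs else rt - rc (real (M + N - p)))"

definition v_inv :: "nat \<Rightarrow> rbiv" where "v_inv d = lin_inv (real d) 0 0"
definition u_inv :: "nat \<Rightarrow> rbiv" where "u_inv d = lin_inv (real d) 1 (-1)"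

lemma pos_inv:
  assumes "p < M + N"
  shows "pos_val M N p * pos_inv M N p = 1"
proof (cases "p < M")
  case True
  then show ?thesis
    using lin_inv[of "real (Suc p)" 1 0] by (simp add: pos_inv_def pos_val_def rc_simps(1,2))
next
  case False
  define m where "m = M + N - p"
  have "- real m \<noteq> 0" using False assms by (simp add: m_def)
  from lin_inv[OF this, of 0 1] False show ?thesis
    by (simp add: pos_inv_def pos_val_def m_def[symmetric] rc_simps(1,2,6))
qed

lemma v_inv: "0 < d \<Longrightarrow> rc (real d) * v_inv d = 1"
  using lin_inv[of "real d" 0 0] by (simp add: v_inv_def rc_simps)

lemma u_inv: "0 < d \<Longrightarrow> (rc (real d) + rs - rt) * u_inv d = 1"
  using lin_inv[of "real d" 1 "-1"] by (simp add: u_inv_def rc_simps)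

text \<open>\<open>diff_inv\<close> inverts \<open>x_b - x_a\<close>, and inverses satisfy
  \<open>1 / x_a - 1 / x_b = (x_b - x_a) / (x_a * x_b)\<close>. This supplies the hypothesis of
  \<open>cyclic_telescoping\<close>.\<close>

lemma diff_inv_mult:
  assumes "a < M + N" "b < M + N" "a \<noteq> b"
  shows "diff_inv v_inv u_inv M N a b * (pos_inv M N a - pos_inv M N b) = pos_inv M N a * pos_inv M N b"
proof -
  let ?x = "pos_val M N" and ?y = "pos_inv M N" and ?d = "diff_inv v_inv u_inv M N a b"
  have swap: "X * - I = 1" if "(- X) * I = 1" for X I :: rbiv using that by simp
  have "(?x b - ?x a) * ?d = 1"
  proof (cases "(a < M) = (b < M)")
    case True
    then have eq: "?x b - ?x a = rc (real b - real a)"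
      using assms by (auto simp: pos_val_def rc_simps of_nat_diff)
    show ?thesis
    proof (cases "a < b")
      case lt: True
      then have "real b - real a = real (b - a)" by (simp add: of_nat_diff)
      then show ?thesis unfolding eq using True lt v_inv[of "b - a"] by (simp only: diff_inv_def if_True) simp
    next
      case nlt: False
      then have "rc (real b - real a) = - rc (real (a - b))"
        using assms by (simp add: of_nat_diff flip: rc_simps(6))
      then show ?thesis unfolding eq using True nlt assms v_inv[of "a - b"] by (simp add: diff_inv_def)
    qed
  next
    case False
    show ?thesis
    proof (cases "a < M")
      case lt: True
      let ?n = "M + N + Suc a - b"
      have "real ?n = real (Suc a) + real (M + N - b)"
        using assms by (simp add: of_nat_diff)
      then have "?x b - ?x a = - (rc (real ?n) + rs - rt)"
        using lt False unfolding pos_val_def by (simp add: rc_simps)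
      moreover have "?d = - u_inv ?n" using lt False by (simp add: diff_inv_def)
      moreover have "(rc (real ?n) + rs - rt) * u_inv ?n = 1" using assms by (intro u_inv) simp
      ultimately show ?thesis by (simp only: minus_mult_minus)
    next
      case nlt: False
      let ?n = "M + N + Suc b - a"
      have "real ?n = real (Suc b) + real (M + N - a)"
        using assms by (simp add: of_nat_diff)
      then have "?x b - ?x a = rc (real ?n) + rs - rt"
        using nlt False unfolding pos_val_def by (simp add: rc_simps)
      then show ?thesis using nlt False u_inv[of ?n] assms by (simp add: diff_inv_def)
    qed
  qed
  then have d: "?d * (?x b - ?x a) = 1" by (simp add: mult.commute)
  have "?y a - ?y b = ?y a * (?x b * ?y b) - (?x a * ?y a) * ?y b"
    using pos_inv assms by simp
  also have "\<dots> = (?x b - ?x a) * (?y a * ?y b)" by (simp add: algebra_simps)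
  finally have "?d * (?y a - ?y b) = (?d * (?x b - ?x a)) * (?y a * ?y b)" by (simp add: mult.assoc)
  then show ?thesis using d by simp
qed

text \<open>Says, without division, that \<open>1 / (x - t)\<close> is the value of the geometric
  series with terms \<open>(1 / x) ^ Suc j * t ^ j\<close>.\<close>

lemma end_low_inv:
  assumes "e < M + N"
  shows "end_low v_inv u_inv M N e * (1 - pos_inv M N e * rt) = pos_inv M N e"
proof -
  let ?x = "pos_val M N e" and ?z = "pos_inv M N e" and ?D = "end_low v_inv u_inv M N e"
  have D: "(?x - rt) * ?D = 1"
  proof (cases "e < M")
    case True
    then show ?thesis using u_inv[of "Suc e"] by (simp add: pos_val_def end_low_def algebra_simps)
  next
    case False
    have "?x - rt = - rc (real (M + N - e))" using False by (simp add: pos_val_def)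
    then show ?thesis using False assms v_inv[of "M + N - e"] by (simp add: end_low_def)
  qed
  have "?D * (1 - ?z * rt) = ?D * (?x * ?z - ?z * rt)" using pos_inv[OF assms] by simp
  also have "\<dots> = ((?x - rt) * ?D) * ?z" by (simp add: algebra_simps)
  finally show ?thesis using D by simp
qed

lemma end_high_inv:
  assumes "e < M + N"
  shows "end_high v_inv u_inv M N e * (1 - pos_inv M N e * rs) = pos_inv M N e"
proof -
  let ?x = "pos_val M N e" and ?z = "pos_inv M N e" and ?D = "end_high v_inv u_inv M N e"
  have D: "(?x - rs) * ?D = 1"
  proof (cases "e < M")
    case True
    then show ?thesis using v_inv[of "Suc e"] by (simp add: pos_val_def end_high_def)
  next
    case False
    then have "?x - rs = - (rc (real (M + N - e)) + rs - rt)" by (simp add: pos_val_def)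
    moreover have "?D = - u_inv (M + N - e)" using False by (simp add: end_high_def)
    moreover have "(rc (real (M + N - e)) + rs - rt) * u_inv (M + N - e) = 1"
      using assms by (intro u_inv) simp
    ultimately show ?thesis by (simp only: minus_mult_minus)
  qed
  have "?D * (1 - ?z * rs) = ?D * (?x * ?z - ?z * rs)" using pos_inv[OF assms] by simp
  also have "\<dots> = ((?x - rs) * ?D) * ?z" by (simp add: algebra_simps)
  finally show ?thesis using D by simp
qed

definition rsum_t :: "(nat \<Rightarrow> rbiv) \<Rightarrow> rbiv" where
  "rsum_t X = Abs_fps (\<lambda>a. Abs_fps (\<lambda>c. \<Sum>j\<le>c. fps_nth (fps_nth (X j) a) (c - j)))"

definition rsum_s :: "(nat \<Rightarrow> rbiv) \<Rightarrow> rbiv" where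
  "rsum_s X = Abs_fps (\<lambda>a. \<Sum>j\<le>a. fps_nth (X j) (a - j))"

lemma rsum_sum:
  "rsum_t (\<lambda>j. \<Sum>x\<in>A. X x j) = (\<Sum>x\<in>A. rsum_t (X x))"
  "rsum_s (\<lambda>j. \<Sum>x\<in>A. X x j) = (\<Sum>x\<in>A. rsum_s (X x))"
  by (intro fps_ext; simp add: rsum_t_def rsum_s_def fps_sum_nth sum.swap[of _ A])+

lemma power_rt: "rt ^ j = fps_const (fps_X ^ j)"
  by (simp add: rt_def fps_const_power)

lemma mult_rt_power_nth: "fps_nth (fps_nth (F * rt ^ j) a) c = (if c < j then 0 else fps_nth (fps_nth F a) (c - j))"
  by (simp add: power_rt fps_X_power_mult_right_nth)

lemma mult_rs_power_nth: "fps_nth (F * rs ^ j) a = (if a < j then 0 else fps_nth F (a - j))"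
  by (simp add: rs_def fps_X_power_mult_right_nth)

lemma geometric_expansion:
  assumes "D * (1 - z * w) = (z :: 'a::comm_ring_1)"
  shows "D = (\<Sum>j<n. z ^ Suc j * w ^ j) + (z ^ n * D) * w ^ n"
proof (induction n)
  case (Suc n)
  have "D = z + z * D * w" using assms by (simp add: algebra_simps)
  then have "z ^ n * D * w ^ n = z ^ n * (z + z * D * w) * w ^ n" by simp
  also have "\<dots> = z ^ Suc n * w ^ n + z ^ Suc n * D * w ^ Suc n" by (simp add: algebra_simps)
  finally show ?case using Suc by (simp add: algebra_simps)
qed simp

text \<open>The remainder after \<open>c + 1\<close> terms is divisible by \<open>rt ^ Suc c\<close>
  and does not reach the coefficient of degree \<open>c\<close>.\<close>

lemma rsum_t_geometric:
  assumes "D * (1 - z * rt) = z"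
  shows "rsum_t (\<lambda>j. F * z ^ Suc j) = F * D"
proof (intro fps_ext)
  fix a c
  have "F * D = (\<Sum>j<Suc c. (F * z ^ Suc j) * rt ^ j) + (F * (z ^ Suc c * D)) * rt ^ Suc c"
    using arg_cong[OF geometric_expansion[OF assms, of "Suc c"], of "\<lambda>x. F * x"]
    by (simp only: distrib_left sum_distrib_left mult.assoc)
  then have "fps_nth (fps_nth (F * D) a) c
      = (\<Sum>j<Suc c. if c < j then 0 else fps_nth (fps_nth (F * z ^ Suc j) a) (c - j))"
    by (simp only: fps_add_nth fps_sum_nth mult_rt_power_nth) simp
  also have "\<dots> = (\<Sum>j\<le>c. fps_nth (fps_nth (F * z ^ Suc j) a) (c - j))"
    unfolding lessThan_Suc_atMost by (rule sum.cong) auto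
  finally show "fps_nth (fps_nth (rsum_t (\<lambda>j. F * z ^ Suc j)) a) c = fps_nth (fps_nth (F * D) a) c"
    by (simp add: rsum_t_def)
qed

lemma rsum_s_geometric:
  assumes "D * (1 - z * rs) = z"
  shows "rsum_s (\<lambda>j. F * z ^ Suc j) = F * D"
proof (rule fps_ext)
  fix a
  have "F * D = (\<Sum>j<Suc a. (F * z ^ Suc j) * rs ^ j) + (F * (z ^ Suc a * D)) * rs ^ Suc a"
    using arg_cong[OF geometric_expansion[OF assms, of "Suc a"], of "\<lambda>x. F * x"]
    by (simp only: distrib_left sum_distrib_left mult.assoc)
  then have "fps_nth (F * D) a = (\<Sum>j<Suc a. if a < j then 0 else fps_nth (F * z ^ Suc j) (a - j))"
    by (simp only: fps_add_nth fps_sum_nth mult_rs_power_nth) simp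
  also have "\<dots> = (\<Sum>j\<le>a. fps_nth (F * z ^ Suc j) (a - j))"
    unfolding lessThan_Suc_atMost by (rule sum.cong) auto
  finally show "fps_nth (rsum_s (\<lambda>j. F * z ^ Suc j)) a = fps_nth (F * D) a"
    by (simp add: rsum_s_def)
qed

section \<open>Bounds for the truncation error\<close>

text \<open>Coefficients in \<open>s\<close> and \<open>t\<close> are estimated by the sum of the
  absolute values of all coefficients of degree at most \<open>A\<close> in each variable. The
  properties are stated abstractly so that one lemma can lift the absolute value twice, once per
  variable.\<close>

definition submult_norm :: "('a::comm_ring_1 \<Rightarrow> real) \<Rightarrow> bool" where
  "submult_norm \<mu> \<longleftrightarrow> \<mu> 0 = 0 \<and> \<mu> 1 = 1 \<and> (\<forall>x. 0 \<le> \<mu> x) \<and> (\<forall>x. \<mu> (- x) = \<mu> x)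
     \<and> (\<forall>x y. \<mu> (x + y) \<le> \<mu> x + \<mu> y) \<and> (\<forall>x y. \<mu> (x * y) \<le> \<mu> x * \<mu> y)"

lemma submult_normD:
  assumes "submult_norm \<mu>"
  shows "\<mu> 0 = 0" "\<mu> 1 = 1" "0 \<le> \<mu> x" "\<mu> (- x) = \<mu> x" "\<mu> (x + y) \<le> \<mu> x + \<mu> y" "\<mu> (x * y) \<le> \<mu> x * \<mu> y"
  using assms by (simp_all add: submult_norm_def)

lemma submult_norm_diff: "submult_norm \<mu> \<Longrightarrow> \<mu> (x - y) \<le> \<mu> x + \<mu> y"
  using submult_normD(5)[of \<mu> x "- y"] submult_normD(4)[of \<mu> y] by simp

lemma submult_norm_sum: "submult_norm \<mu> \<Longrightarrow> \<mu> (\<Sum>x\<in>A. f x) \<le> (\<Sum>x\<in>A. \<mu> (f x))"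
proof (induction A rule: infinite_finite_induct)
  case (insert x A)
  then show ?case using submult_normD(5)[of \<mu> "f x" "sum f A"] by simp
qed (simp_all add: submult_normD(1))

lemma submult_norm_power: "submult_norm \<mu> \<Longrightarrow> \<mu> (x ^ n) \<le> \<mu> x ^ n"
proof (induction n)
  case (Suc n)
  then have "\<mu> x * \<mu> (x ^ n) \<le> \<mu> x * \<mu> x ^ n" by (intro mult_left_mono submult_normD(3)) simp_all
  then show ?case using submult_normD(6)[OF Suc.prems, of x "x ^ n"] by simp
qed (simp add: submult_normD(2))

definition lift_norm :: "nat \<Rightarrow> ('a::comm_ring_1 \<Rightarrow> real) \<Rightarrow> 'a fps \<Rightarrow> real" where
  "lift_norm A \<mu> f = (\<Sum>a\<le>A. \<mu> (fps_nth f a))"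

text \<open>Coefficients of a product up to degree \<open>A\<close> involve only coefficients of the
  factors up to \<open>A\<close>; enlarging the triangle of index pairs to a square gives the
  product of the two sums.\<close>

lemma submult_lift_norm:
  assumes \<mu>: "submult_norm \<mu>"
  shows "submult_norm (lift_norm A \<mu>)"
  unfolding submult_norm_def
proof (intro conjI allI)
  note D = submult_normD[OF \<mu>]
  show "lift_norm A \<mu> 0 = 0" by (simp add: lift_norm_def D)
  have "lift_norm A \<mu> 1 = (\<Sum>a\<le>A. if a = 0 then 1 else 0)"
    unfolding lift_norm_def by (rule sum.cong) (auto simp: D)
  then show "lift_norm A \<mu> 1 = 1" by simp
  fix f g
  show "0 \<le> lift_norm A \<mu> f" unfolding lift_norm_def by (intro sum_nonneg D)
  show "lift_norm A \<mu> (- f) = lift_norm A \<mu> f" by (simp add: lift_norm_def D)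
  show "lift_norm A \<mu> (f + g) \<le> lift_norm A \<mu> f + lift_norm A \<mu> g"
    unfolding lift_norm_def sum.distrib[symmetric] fps_add_nth by (intro sum_mono D)
  let ?h = "\<lambda>i j. \<mu> (fps_nth f i) * \<mu> (fps_nth g j)"
  have "lift_norm A \<mu> (f * g) \<le> (\<Sum>a\<le>A. \<Sum>i\<le>a. ?h i (a - i))"
    unfolding lift_norm_def fps_mult_nth atLeast0AtMost
    by (intro sum_mono order_trans[OF submult_norm_sum[OF \<mu>]] D)
  also have "\<dots> = (\<Sum>(i, j)\<in>{(i, j). i + j \<le> A}. ?h i j)"
    by (rule sum.triangle_reindex_eq[symmetric])
  also have "\<dots> \<le> (\<Sum>(i, j)\<in>{..A} \<times> {..A}. ?h i j)"
    by (rule sum_mono2) (auto intro!: mult_nonneg_nonneg D)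
  also have "\<dots> = lift_norm A \<mu> f * lift_norm A \<mu> g"
    by (simp add: lift_norm_def sum_product sum.cartesian_product)
  finally show "lift_norm A \<mu> (f * g) \<le> lift_norm A \<mu> f * lift_norm A \<mu> g" .
qed

definition rnorm :: "nat \<Rightarrow> rbiv \<Rightarrow> real" where
  "rnorm A = lift_norm A (lift_norm A abs)"

lemma submult_rnorm: "submult_norm (rnorm A)"
  unfolding rnorm_def by (intro submult_lift_norm) (simp add: submult_norm_def abs_mult abs_triangle_ineq)

lemma nth_le_rnorm:
  assumes "a \<le> A" "c \<le> A"
  shows "\<bar>fps_nth (fps_nth f a) c\<bar> \<le> rnorm A f"
proof -
  have "\<bar>fps_nth (fps_nth f a) c\<bar> \<le> (\<Sum>c\<le>A. \<bar>fps_nth (fps_nth f a) c\<bar>)"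
    by (rule member_le_sum) (use assms in auto)
  also have "\<dots> \<le> (\<Sum>a\<le>A. \<Sum>c\<le>A. \<bar>fps_nth (fps_nth f a) c\<bar>)"
    by (rule member_le_sum[of a "{..A}" "\<lambda>a. \<Sum>c\<le>A. \<bar>fps_nth (fps_nth f a) c\<bar>"])
       (use assms in \<open>auto intro: sum_nonneg\<close>)
  finally show ?thesis by (simp add: rnorm_def lift_norm_def)
qed

section \<open>Estimates for chains\<close>

lemma chain_nonneg:
  fixes y :: "nat \<Rightarrow> real"
  assumes "0 \<le> \<tau>" "\<And>p. 0 \<le> y p"
  shows "0 \<le> chain \<tau> y P ks a b"
proof (induction ks arbitrary: a rule: induct_list012)
  case (3 k l ks)
  then show ?case using assms
    by (auto intro!: mult_nonneg_nonneg sum_nonneg simp: weak_kernel_def)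
qed (use assms in auto)

lemma submult_norm_chain:
  assumes \<mu>: "submult_norm \<mu>" and T: "\<mu> \<tau> \<le> T" and Y: "\<And>p. p < P \<Longrightarrow> \<mu> (y p) \<le> B * \<eta> p"
    and nn: "0 \<le> B" "\<And>p. 0 \<le> \<eta> p" and "a < P"
  shows "\<mu> (chain \<tau> y P ks a b) \<le> B ^ sum_list ks * chain T \<eta> P ks a b"
  using \<open>a < P\<close>
proof (induction ks arbitrary: a rule: induct_list012)
  case 1
  then show ?case by (simp add: submult_normD(1)[OF \<mu>])
next
  case (2 k)
  have "\<mu> (y a ^ k) \<le> (B * \<eta> a) ^ k"
    by (rule order_trans[OF submult_norm_power[OF \<mu>] power_mono[OF Y[OF 2] submult_normD(3)[OF \<mu>]]])
  then show ?case by (cases "a = b") (simp_all add: submult_normD(1)[OF \<mu>] power_mult_distrib)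
next
  case (3 k l ks)
  note D = submult_normD[OF \<mu>]
  have T0: "0 \<le> T" using T D(3) by (rule order_trans[rotated])
  have yk: "\<mu> (y a ^ k) \<le> (B * \<eta> a) ^ k"
    by (rule order_trans[OF submult_norm_power[OF \<mu>] power_mono[OF Y[OF 3(3)] D(3)]])
  have w: "\<mu> (weak_kernel \<tau> a c) \<le> weak_kernel T a c" "0 \<le> weak_kernel T a c" for c
    using T T0 by (auto simp: weak_kernel_def D)
  have "\<mu> (\<Sum>c<P. weak_kernel \<tau> a c * chain \<tau> y P (l # ks) c b)
      \<le> (\<Sum>c<P. weak_kernel T a c * (B ^ sum_list (l # ks) * chain T \<eta> P (l # ks) c b))"
    by (intro order_trans[OF submult_norm_sum[OF \<mu>]] sum_mono order_trans[OF D(6)] mult_mono w D(3) 3(2)) simp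
  then have "\<mu> (chain \<tau> y P (k # l # ks) a b)
      \<le> (B * \<eta> a) ^ k * (\<Sum>c<P. weak_kernel T a c * (B ^ sum_list (l # ks) * chain T \<eta> P (l # ks) c b))"
    unfolding chain.simps using nn by (intro order_trans[OF D(6)] mult_mono yk D(3)) auto
  also have "\<dots> = B ^ sum_list (k # l # ks) * chain T \<eta> P (k # l # ks) a b"
    by (simp add: power_mult_distrib power_add sum_distrib_left mult_ac)
  finally show ?case .
qed

text \<open>The start \<open>a\<close> keeps its weight, and each later position is summed over
  freely at the cost of one factor \<open>\<Sum>p<M. \<eta> p\<close>. An entry of at least 2
  contributes its weight twice. Since \<open>\<eta>\<close> decreases along the block, one of the
  two factors can be moved back to \<open>a\<close>; the resulting square is what
  \<open>sum_err_weight\<close> needs.\<close>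

lemma chain_block_bound:
  fixes \<eta> :: "nat \<Rightarrow> real"
  assumes T: "1 \<le> T" and nn: "\<And>p. 0 \<le> \<eta> p" and le1: "\<And>p. \<eta> p \<le> 1"
    and mono: "\<And>p q. p \<le> q \<Longrightarrow> q < M \<Longrightarrow> \<eta> q \<le> \<eta> p" and "M \<le> P"
    and ks: "is_index ks" "ks \<noteq> []" "a < M"
  shows "(\<Sum>b<M. chain T \<eta> P ks a b) \<le> T ^ length ks * \<eta> a * (\<Sum>p<M. \<eta> p) ^ (length ks - 1)"
    and "\<exists>x\<in>set ks. 2 \<le> x \<Longrightarrow>
      (\<Sum>b<M. chain T \<eta> P ks a b) \<le> T ^ length ks * \<eta> a ^ 2 * (\<Sum>p<M. \<eta> p) ^ (length ks - 1)"
  using ks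
proof (induction ks arbitrary: a rule: induct_list012)
  case (2 k)
  have eq: "(\<Sum>b<M. chain T \<eta> P [k] a b) = \<eta> a ^ k" if "a < M" for a
    using that by simp
  {
    case 1
    have "\<eta> a ^ k \<le> \<eta> a ^ 1" by (rule power_decreasing) (use 1 nn le1 in \<open>auto simp: is_index_def\<close>)
    also have "\<dots> \<le> T * \<eta> a" using T nn[of a] mult_right_mono[of 1 T "\<eta> a"] by simp
    finally show ?case using eq[of a] 1 by simp
  next
    case 2
    have "\<eta> a ^ k \<le> \<eta> a ^ 2" by (rule power_decreasing) (use 2 nn le1 in auto)
    also have "\<dots> \<le> T * \<eta> a ^ 2" using T mult_right_mono[of 1 T "\<eta> a ^ 2"] by simp
    finally show ?case using eq[of a] 2 by simp
  }
next
  case (3 k l ks)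
  let ?H = "\<Sum>p<M. \<eta> p" and ?n = "length (l # ks)"
  let ?S = "\<lambda>ks a. \<Sum>b<M. chain T \<eta> P ks a b"
  have T0: "0 \<le> T" using T by simp
  have H: "0 \<le> ?H" by (intro sum_nonneg nn)
  have rec: "?S (k # l # ks) a = \<eta> a ^ k * (\<Sum>c<M. weak_kernel T a c * ?S (l # ks) c)" for a
  proof -
    have "?S (k # l # ks) a = \<eta> a ^ k * (\<Sum>b<M. \<Sum>c<P. weak_kernel T a c * chain T \<eta> P (l # ks) c b)"
      by (simp add: sum_distrib_left)
    also have "(\<Sum>b<M. \<Sum>c<P. weak_kernel T a c * chain T \<eta> P (l # ks) c b)
        = (\<Sum>b<M. \<Sum>c<M. weak_kernel T a c * chain T \<eta> P (l # ks) c b)"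
      using \<open>M \<le> P\<close> by (intro sum.cong refl sum.mono_neutral_right) (auto simp: chain_zero)
    also have "\<dots> = (\<Sum>c<M. \<Sum>b<M. weak_kernel T a c * chain T \<eta> P (l # ks) c b)"
      by (rule sum.swap)
    finally show ?thesis by (simp add: sum_distrib_left)
  qed
  have S0: "0 \<le> ?S ks a" for ks a by (intro sum_nonneg chain_nonneg T0 nn)
  have w: "weak_kernel T a c \<le> T" "0 \<le> weak_kernel T a c" for a c
    using T by (auto simp: weak_kernel_def)
  have lk: "is_index (l # ks)" "0 < k" if "is_index (k # l # ks)" using that by (auto simp: is_index_def)
  have one: "(\<Sum>c<M. weak_kernel T a c * ?S (l # ks) c) \<le> T ^ Suc ?n * ?H ^ ?n"
    if "is_index (k # l # ks)" for a
  proof -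
    have "(\<Sum>c<M. weak_kernel T a c * ?S (l # ks) c) \<le> (\<Sum>c<M. T * (T ^ ?n * \<eta> c * ?H ^ (?n - 1)))"
      using lk[OF that] by (intro sum_mono mult_mono w S0 3(3) T0) auto
    also have "\<dots> = T ^ Suc ?n * (?H * ?H ^ (?n - 1))"
      by (simp add: sum_distrib_left sum_distrib_right mult_ac)
    finally show ?thesis by simp
  qed
  {
    case 1
    have "\<eta> a ^ k \<le> \<eta> a ^ 1" by (rule power_decreasing) (use 1 nn le1 in \<open>auto simp: is_index_def\<close>)
    then have "?S (k # l # ks) a \<le> \<eta> a * (T ^ Suc ?n * ?H ^ ?n)"
      unfolding rec using one 1 nn by (intro mult_mono sum_nonneg mult_nonneg_nonneg w S0) auto
    then show ?case by (simp add: mult_ac)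
  next
    case 2
    show ?case
    proof (cases "2 \<le> k")
      case True
      have "\<eta> a ^ k \<le> \<eta> a ^ 2" by (rule power_decreasing) (use True nn le1 in auto)
      then have "?S (k # l # ks) a \<le> \<eta> a ^ 2 * (T ^ Suc ?n * ?H ^ ?n)"
        unfolding rec using one 2 nn by (intro mult_mono sum_nonneg mult_nonneg_nonneg w S0) auto
      then show ?thesis by (simp add: mult_ac)
    next
      case False
      then have ex: "\<exists>x\<in>set (l # ks). 2 \<le> x" using 2(1) by auto
      \<comment> \<open>The large entry occurs later, so the induction hypothesis provides
        \<open>\<eta> c ^ 2\<close>; for \<open>a \<le> c\<close> one factor is replaced by the
        larger \<open>\<eta> a\<close>.\<close>
      have "(\<Sum>c<M. weak_kernel T a c * ?S (l # ks) c)
          \<le> (\<Sum>c<M. T * (T ^ ?n * (\<eta> a * \<eta> c) * ?H ^ (?n - 1)))"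
      proof (rule sum_mono)
        fix c assume c: "c \<in> {..<M}"
        show "weak_kernel T a c * ?S (l # ks) c \<le> T * (T ^ ?n * (\<eta> a * \<eta> c) * ?H ^ (?n - 1))"
        proof (cases "a \<le> c")
          case True
          then have "\<eta> c * \<eta> c \<le> \<eta> a * \<eta> c" using mono c nn by (intro mult_right_mono) auto
          then have "T ^ ?n * \<eta> c ^ 2 * ?H ^ (?n - 1) \<le> T ^ ?n * (\<eta> a * \<eta> c) * ?H ^ (?n - 1)"
            using T0 H by (intro mult_right_mono mult_left_mono) (auto simp: power2_eq_square)
          moreover have "?S (l # ks) c \<le> T ^ ?n * \<eta> c ^ 2 * ?H ^ (?n - 1)"
            using lk[OF 2(2)] c by (intro 3(4)[OF ex]) auto
          ultimately show ?thesis by (intro mult_mono w S0 T0) auto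
        next
          case False
          then show ?thesis using T0 H nn by (auto simp: weak_kernel_def)
        qed
      qed
      also have "\<dots> = \<eta> a * (T ^ Suc ?n * (?H * ?H ^ (?n - 1)))"
        by (simp add: sum_distrib_left sum_distrib_right mult_ac)
      finally have b: "(\<Sum>c<M. weak_kernel T a c * ?S (l # ks) c) \<le> \<eta> a * (T ^ Suc ?n * ?H ^ ?n)"
        by simp
      have "\<eta> a ^ k \<le> \<eta> a ^ 1" by (rule power_decreasing) (use 2 nn le1 in \<open>auto simp: is_index_def\<close>)
      then have "?S (k # l # ks) a \<le> \<eta> a * (\<eta> a * (T ^ Suc ?n * ?H ^ ?n))"
        unfolding rec using b nn by (intro mult_mono sum_nonneg mult_nonneg_nonneg w S0) auto
      then show ?thesis by (simp add: mult_ac power2_eq_square)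
    qed
  }
qed simp_all

text \<open>Read backwards, the second block looks like the first with \<open>M\<close> and
  \<open>N\<close> exchanged. This reduces its estimate to that of the first block.\<close>

lemma chain_rev:
  assumes "a < P" "b < P"
  shows "chain \<tau> y P ks a b = chain \<tau> (\<lambda>p. y (P - Suc p)) P (rev ks) (P - Suc b) (P - Suc a)"
  using assms
proof (induction ks arbitrary: a rule: induct_list012)
  case (2 k)
  then show ?case by (auto simp: Suc_diff_Suc)
next
  case (3 k l ks)
  let ?y = "\<lambda>p. y (P - Suc p)"
  have "chain \<tau> ?y P (rev (k # l # ks)) (P - Suc b) (P - Suc a)
     = (\<Sum>e<P. chain \<tau> ?y P (rev (l # ks)) (P - Suc b) e * weak_kernel \<tau> e (P - Suc a)) * y a ^ k"
    using chain_snoc[of "rev (l # ks)" "P - Suc b" P "P - Suc a" \<tau> ?y k] 3 by (simp add: Suc_diff_Suc)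
  also have "(\<Sum>e<P. chain \<tau> ?y P (rev (l # ks)) (P - Suc b) e * weak_kernel \<tau> e (P - Suc a))
     = (\<Sum>c<P. weak_kernel \<tau> a c * chain \<tau> y P (l # ks) c b)"
    by (rule sum.reindex_bij_witness[of _ "\<lambda>c. P - Suc c" "\<lambda>c. P - Suc c"])
       (use 3 in \<open>auto simp: weak_kernel_def\<close>)
  finally show ?case by (simp add: mult_ac)
qed simp_all

definition pos_weight :: "nat \<Rightarrow> nat \<Rightarrow> nat \<Rightarrow> real" where
  "pos_weight M N p = (if p < M then 1 / real (Suc p) else 1 / real (max 1 (M + N - p)))"

text \<open>Bounds two stretches of \<open>n\<close> consecutive terms, the first with denominators
  at least \<open>M + 1 - n\<close>, the second with denominators at least
  \<open>N + 1\<close>.\<close>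

definition err_weight :: "nat \<Rightarrow> nat \<Rightarrow> nat \<Rightarrow> real" where
  "err_weight M N n = real n / real (M + 1 - n) + real n / real (N + 1)"

lemma sum_pos_weight: "(\<Sum>p<M. pos_weight M N p) = harm M"
proof -
  have "(\<Sum>p<M. pos_weight M N p) = (\<Sum>p<M. inverse (real (Suc p)))"
    by (rule sum.cong) (auto simp: pos_weight_def inverse_eq_divide)
  then show ?thesis by (simp add: harm_altdef)
qed

text \<open>With \<open>n = a + 1\<close>, one factor \<open>1 / n\<close> cancels the numerator and
  \<open>1 / (n * (M + 1 - n)) = (1 / n + 1 / (M + 1 - n)) / (M + 1)\<close>. With a single factor
  \<open>1 / n\<close> in place of the square the sum would grow like \<open>harm M\<close>.\<close>

lemma sum_err_weight:
  "(\<Sum>a<M. pos_weight M N a ^ 2 * err_weight M N (Suc a))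
     = 2 * harm M / real (M + 1) + harm M / real (N + 1)"
proof -
  have "(\<Sum>a<M. pos_weight M N a ^ 2 * err_weight M N (Suc a))
      = (\<Sum>a<M. (inverse (real (Suc a)) + inverse (real (Suc (M - Suc a)))) / real (M + 1)
           + inverse (real (Suc a)) / real (N + 1))"
  proof (rule sum.cong)
    fix a assume "a \<in> {..<M}"
    then obtain d where d: "M = a + Suc d" by (metis add_Suc_right less_imp_add_positive lessThan_iff gr0_implies_Suc)
    have x: "(1 / X) ^ 2 * (X / Y + X / Z) = (inverse X + inverse Y) / (X + Y) + inverse X / Z"
      if "X > 0" "Y > 0" "Z > 0" for X Y Z :: real
    proof -
      have "X + Y \<noteq> 0" using that by simp
      then show ?thesis using that by (simp add: divide_simps power2_eq_square) (simp add: algebra_simps)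
    qed
    have "M + 1 - Suc a = Suc d" "Suc (M - Suc a) = Suc d" "real (M + 1) = real (Suc a) + real (Suc d)"
      by (simp_all add: d)
    then show "pos_weight M N a ^ 2 * err_weight M N (Suc a)
      = (inverse (real (Suc a)) + inverse (real (Suc (M - Suc a)))) / real (M + 1)
           + inverse (real (Suc a)) / real (N + 1)"
      unfolding err_weight_def pos_weight_def
      using x[of "real (Suc a)" "real (Suc d)" "real (N + 1)"] \<open>a \<in> {..<M}\<close> by simp
  qed simp
  also have "\<dots> = ((\<Sum>a<M. inverse (real (Suc a))) + (\<Sum>a<M. inverse (real (Suc (M - Suc a))))) / real (M + 1)
      + (\<Sum>a<M. inverse (real (Suc a))) / real (N + 1)"
    by (simp only: sum.distrib sum_divide_distrib[symmetric])
  also have "(\<Sum>a<M. inverse (real (Suc (M - Suc a)))) = (\<Sum>a<M. inverse (real (Suc a)))"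
    by (rule sum.nat_diff_reindex[of "\<lambda>a. inverse (real (Suc a))"])
  finally show ?thesis by (simp add: harm_altdef)
qed

lemma block_error_bound:
  assumes T: "1 \<le> T" and ks: "is_index ks" "ks \<noteq> []" "\<exists>x\<in>set ks. 2 \<le> x"
  shows "(\<Sum>a<M. \<Sum>b<M. chain T (pos_weight M N) (M + N) ks a b * err_weight M N (Suc a))
     \<le> T ^ length ks * harm M ^ length ks * (2 / real (M + 1) + 1 / real (N + 1))"
proof -
  let ?\<eta> = "pos_weight M N"
  have e: "0 \<le> err_weight M N n" for n by (simp add: err_weight_def)
  have mono: "?\<eta> q \<le> ?\<eta> p" if "p \<le> q" "q < M" for p q
    using that by (auto simp: pos_weight_def intro!: divide_left_mono)
  have "(\<Sum>a<M. \<Sum>b<M. chain T ?\<eta> (M + N) ks a b * err_weight M N (Suc a))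
      = (\<Sum>a<M. (\<Sum>b<M. chain T ?\<eta> (M + N) ks a b) * err_weight M N (Suc a))"
    by (simp add: sum_distrib_right)
  also have "\<dots> \<le> (\<Sum>a<M. (T ^ length ks * ?\<eta> a ^ 2 * harm M ^ (length ks - 1)) * err_weight M N (Suc a))"
  proof (rule sum_mono)
    fix a assume "a \<in> {..<M}"
    then have "(\<Sum>b<M. chain T ?\<eta> (M + N) ks a b) \<le> T ^ length ks * ?\<eta> a ^ 2 * harm M ^ (length ks - 1)"
      unfolding sum_pos_weight[of M N, symmetric] using ks
      by (intro chain_block_bound(2)[OF T _ _ mono]) (auto simp: pos_weight_def)
    then show "(\<Sum>b<M. chain T ?\<eta> (M + N) ks a b) * err_weight M N (Suc a)
      \<le> (T ^ length ks * ?\<eta> a ^ 2 * harm M ^ (length ks - 1)) * err_weight M N (Suc a)"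
      using e by (rule mult_right_mono)
  qed
  also have "\<dots> = T ^ length ks * harm M ^ (length ks - 1) * (\<Sum>a<M. ?\<eta> a ^ 2 * err_weight M N (Suc a))"
    by (simp add: sum_distrib_left mult_ac)
  also have "\<dots> = T ^ length ks * (harm M * harm M ^ (length ks - 1)) * (2 / real (M + 1) + 1 / real (N + 1))"
    unfolding sum_err_weight by (simp add: algebra_simps)
  also have "harm M * harm M ^ (length ks - 1) = (harm M :: real) ^ length ks"
    using ks(2) by (cases ks) auto
  finally show ?thesis .
qed

definition coef_bound :: "nat \<Rightarrow> real" where
  "coef_bound A = (\<Sum>a\<le>A. \<Sum>c\<le>A. 2 ^ (a + c))"

lemma coef_bound_ge_1: "1 \<le> coef_bound A"
proof -
  have "(2 :: real) ^ (0 + 0) \<le> (\<Sum>c\<le>A. 2 ^ (0 + c))"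
    by (rule member_le_sum[of 0 "{..A}" "\<lambda>c. 2 ^ (0 + c)"]) auto
  also have "\<dots> \<le> (\<Sum>a\<le>A. \<Sum>c\<le>A. 2 ^ (a + c))"
    by (rule member_le_sum[of 0 "{..A}" "\<lambda>a. \<Sum>c\<le>A. 2 ^ (a + c)"]) (auto intro: sum_nonneg)
  finally show ?thesis by (simp add: coef_bound_def)
qed

lemma rnorm_lin_inv:
  assumes "1 \<le> \<bar>d\<bar>" "\<bar>e1\<bar> \<le> 1" "\<bar>e2\<bar> \<le> 1"
  shows "rnorm A (lin_inv d e1 e2) \<le> coef_bound A / \<bar>d\<bar>"
  unfolding rnorm_def lift_norm_def coef_bound_def sum_divide_distrib
  by (intro sum_mono lin_inv_nth_bound assms)

lemma rnorm_pos_inv: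
  assumes "p < M + N"
  shows "rnorm A (pos_inv M N p) \<le> coef_bound A * pos_weight M N p"
proof (cases "p < M")
  case True
  then show ?thesis using rnorm_lin_inv[of "real (Suc p)" 1 0 A] by (simp add: pos_inv_def pos_weight_def)
next
  case False
  then have "1 \<le> M + N - p" using assms by simp
  then have "1 \<le> real (M + N - p)" by simp
  then show ?thesis using rnorm_lin_inv[of "- real (M + N - p)" 0 1 A] False \<open>1 \<le> M + N - p\<close>
    by (simp add: pos_inv_def pos_weight_def max_absorb2 del: of_nat_diff)
qed

lemma rnorm_psum_diff:
  assumes f: "\<And>d. 0 < d \<Longrightarrow> rnorm A (f d) \<le> B / real d" and "0 \<le> B"
  shows "rnorm A (psum f (q + n) - psum f q) \<le> B * (real n / real (q + 1))"
proof (induction n)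
  case 0
  then show ?case by (simp add: submult_normD(1)[OF submult_rnorm])
next
  case (Suc n)
  have "rnorm A (f (Suc (q + n))) \<le> B / real (Suc (q + n))" by (rule f) simp
  also have "\<dots> \<le> B / real (q + 1)" using \<open>0 \<le> B\<close> by (intro divide_left_mono) auto
  finally have 1: "rnorm A (f (Suc (q + n))) \<le> B / real (q + 1)" .
  have "psum f (q + Suc n) - psum f q = (psum f (q + n) - psum f q) + f (Suc (q + n))"
    by (simp add: psum_Suc)
  then have "rnorm A (psum f (q + Suc n) - psum f q) \<le> rnorm A (psum f (q + n) - psum f q) + rnorm A (f (Suc (q + n)))"
    using submult_normD(5)[OF submult_rnorm] by metis
  also have "\<dots> \<le> B * (real n / real (q + 1)) + B / real (q + 1)"
    using Suc 1 by (rule add_mono)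
  also have "\<dots> = B * (real (Suc n) / real (q + 1))"
    by (simp add: add_divide_distrib distrib_left)
  finally show ?case .
qed

lemma rnorm_cyc_error:
  assumes "a \<le> b" "b < M + N"
  shows "rnorm A (cyc_error v_inv u_inv M N a b) \<le> coef_bound A *
     (if b < M then err_weight M N (Suc a) else if a < M then 0 else err_weight N M (M + N - b))"
proof -
  let ?B = "coef_bound A"
  note D = submult_normD[OF submult_rnorm[of A]]
  have B: "0 \<le> ?B" using coef_bound_ge_1[of A] by simp
  have v: "rnorm A (v_inv d) \<le> ?B / real d" if "0 < d" for d
    using rnorm_lin_inv[of "real d" 0 0 A] that by (simp add: v_inv_def)
  have u: "rnorm A (u_inv d) \<le> ?B / real d" if "0 < d" for d
    using rnorm_lin_inv[of "real d" 1 "-1" A] that by (simp add: u_inv_def)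
  have main: "rnorm A (psum v_inv M - psum v_inv (M - n)) + rnorm A (psum u_inv (N + n) - psum u_inv N)
       \<le> ?B * err_weight M N n" if "n \<le> M" for M N n
  proof -
    have "rnorm A (psum v_inv M - psum v_inv (M - n)) \<le> ?B * (real n / real (M + 1 - n))"
    proof -
      have "M - n + n = M" "M - n + 1 = M + 1 - n" using that by auto
      then show ?thesis using rnorm_psum_diff[OF v B, of "M - n" n] by (simp only:)
    qed
    moreover have "rnorm A (psum u_inv (N + n) - psum u_inv N) \<le> ?B * (real n / real (N + 1))"
      by (rule rnorm_psum_diff[OF u B])
    ultimately show ?thesis by (simp add: err_weight_def distrib_left)
  qed
  consider "b < M" | "\<not> b < M" "a < M" | "M \<le> a" by linarith
  then show ?thesis
  proof cases
    case 1
    have "rnorm A (- (psum v_inv M - psum v_inv (M - Suc a)) - (psum u_inv (N + Suc a) - psum u_inv N))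
       \<le> rnorm A (psum v_inv M - psum v_inv (M - Suc a)) + rnorm A (psum u_inv (N + Suc a) - psum u_inv N)"
      using submult_norm_diff[OF submult_rnorm] D(4) by metis
    then show ?thesis using main[of "Suc a" M N] 1 assms by (simp add: cyc_error_def)
  next
    case 2
    then show ?thesis by (simp add: cyc_error_def D(1))
  next
    case 3
    let ?m = "M + N - b"
    have "N - ?m = b - M" using 3 assms by simp
    then have le: "rnorm A ((psum v_inv N - psum v_inv (b - M)) + (psum u_inv (M + ?m) - psum u_inv M))
       \<le> rnorm A (psum v_inv N - psum v_inv (N - ?m)) + rnorm A (psum u_inv (M + ?m) - psum u_inv M)"
      using D(5) by metis
    have m: "?m \<le> N" using 3 assms by simp
    have eq: "cyc_error v_inv u_inv M N a b
        = (psum v_inv N - psum v_inv (b - M)) + (psum u_inv (M + ?m) - psum u_inv M)"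
      using 3 assms unfolding cyc_error_def by simp
    have "rnorm A (cyc_error v_inv u_inv M N a b) \<le> ?B * err_weight N M ?m"
      unfolding eq by (rule order_trans[OF le main[OF m]])
    then show ?thesis using 3 assms by simp
  qed
qed

text \<open>Chains that cross the blocks carry no error. Those in the first block are covered by
  \<open>block_error_bound\<close>; those in the second are reflected by
  \<open>p \<mapsto> M + N - 1 - p\<close>, which reverses the index and exchanges \<open>M\<close>
  and \<open>N\<close>.\<close>

lemma chain_error_bound:
  assumes ks: "is_index ks" "ks \<noteq> []" "\<exists>x\<in>set ks. 2 \<le> x"
  shows "rnorm A (\<Sum>a<M+N. \<Sum>b<M+N. chain \<tau> (pos_inv M N) (M + N) ks a b * cyc_error v_inv u_inv M N a b)
     \<le> coef_bound A ^ Suc (sum_list ks) * max 1 (rnorm A \<tau>) ^ length ks *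
        (harm M ^ length ks * (2 / real (M + 1) + 1 / real (N + 1))
        + harm N ^ length ks * (2 / real (N + 1) + 1 / real (M + 1)))"
proof -
  let ?B = "coef_bound A" and ?T = "max 1 (rnorm A \<tau>)" and ?P = "M + N"
  let ?c = "\<lambda>a b. chain ?T (pos_weight M N) ?P ks a b"
  note D = submult_normD[OF submult_rnorm[of A]]
  have B: "0 \<le> ?B" using coef_bound_ge_1[of A] by simp
  have w0: "0 \<le> pos_weight M N p" for M N p by (simp add: pos_weight_def)
  have c0: "0 \<le> ?c a b" for a b by (rule chain_nonneg) (use w0 in auto)
  have e0: "0 \<le> err_weight M N n" for M N n by (simp add: err_weight_def)
  let ?e = "\<lambda>a b. if b < M then err_weight M N (Suc a) else if a < M then 0 else err_weight N M (M + N - b)"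
  have term_le: "rnorm A (chain \<tau> (pos_inv M N) ?P ks a b * cyc_error v_inv u_inv M N a b)
     \<le> ?B ^ Suc (sum_list ks) * (?c a b * ?e a b)" if "a < ?P" "b < ?P" for a b
  proof (cases "a \<le> b")
    case True
    have "rnorm A (chain \<tau> (pos_inv M N) ?P ks a b) \<le> ?B ^ sum_list ks * ?c a b"
      using that B w0 by (intro submult_norm_chain[OF submult_rnorm] rnorm_pos_inv) auto
    then have "rnorm A (chain \<tau> (pos_inv M N) ?P ks a b) * rnorm A (cyc_error v_inv u_inv M N a b)
      \<le> (?B ^ sum_list ks * ?c a b) * (?B * ?e a b)"
      using rnorm_cyc_error[OF True that(2), of A] B c0
      by (intro mult_mono mult_nonneg_nonneg D(3)) auto
    then show ?thesis by (intro order_trans[OF D(6)]) (simp add: mult_ac)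
  next
    case False
    then show ?thesis using B c0 e0 by (simp add: chain_zero D(1))
  qed
  have "rnorm A (\<Sum>a<?P. \<Sum>b<?P. chain \<tau> (pos_inv M N) ?P ks a b * cyc_error v_inv u_inv M N a b)
    \<le> (\<Sum>a<?P. \<Sum>b<?P. ?B ^ Suc (sum_list ks) * (?c a b * ?e a b))"
    by (intro order_trans[OF submult_norm_sum[OF submult_rnorm]] sum_mono term_le) auto
  also have "\<dots> = ?B ^ Suc (sum_list ks) * (\<Sum>a<?P. \<Sum>b<?P. ?c a b * ?e a b)"
    by (simp only: sum_distrib_left)
  also have "(\<Sum>a<?P. \<Sum>b<?P. ?c a b * ?e a b)
     = (\<Sum>a<?P. \<Sum>b<?P. (if a < M \<and> b < M then ?c a b * err_weight M N (Suc a) else 0)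
        + (if M \<le> a \<and> M \<le> b then ?c a b * err_weight N M (M + N - b) else 0))"
    by (intro sum.cong refl) (auto simp: chain_zero)
  also have "\<dots> = (\<Sum>a<?P. \<Sum>b<?P. if a < M \<and> b < M then ?c a b * err_weight M N (Suc a) else 0)
        + (\<Sum>a<?P. \<Sum>b<?P. if M \<le> a \<and> M \<le> b then ?c a b * err_weight N M (M + N - b) else 0)"
    by (simp only: sum.distrib)
  also have "(\<Sum>a<?P. \<Sum>b<?P. if a < M \<and> b < M then ?c a b * err_weight M N (Suc a) else 0)
     = (\<Sum>a<M. \<Sum>b<M. ?c a b * err_weight M N (Suc a))"
    by (intro sum.mono_neutral_cong_right) (auto intro!: sum.mono_neutral_cong_right sum.neutral)
  also have "(\<Sum>a<?P. \<Sum>b<?P. if M \<le> a \<and> M \<le> b then ?c a b * err_weight N M (M + N - b) else 0)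
     = (\<Sum>b<?P. \<Sum>a<?P. if M \<le> a \<and> M \<le> b then ?c a b * err_weight N M (M + N - b) else 0)"
    by (rule sum.swap)
  also have "\<dots> = (\<Sum>b=M..<?P. \<Sum>a=M..<?P. ?c a b * err_weight N M (M + N - b))"
    by (intro sum.mono_neutral_cong_right) (auto intro!: sum.mono_neutral_cong_right sum.neutral)
  also have "\<dots> = (\<Sum>b<N. \<Sum>a<N. chain ?T (pos_weight N M) (N + M) (rev ks) b a * err_weight N M (Suc b))"
  proof (rule sum.reindex_bij_witness[of _ "\<lambda>b. ?P - Suc b" "\<lambda>b. ?P - Suc b"])
    fix b assume b: "b \<in> {M..<?P}"
    show "(\<Sum>a<N. chain ?T (pos_weight N M) (N + M) (rev ks) (?P - Suc b) a * err_weight N M (Suc (?P - Suc b)))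
      = (\<Sum>a=M..<?P. ?c a b * err_weight N M (M + N - b))"
    proof (rule sum.reindex_bij_witness[of _ "\<lambda>a. ?P - Suc a" "\<lambda>a. ?P - Suc a"])
      fix a assume a: "a \<in> {..<N}"
      have w: "pos_weight N M p = pos_weight M N (?P - Suc p)" if "p < ?P" for p
        using that by (auto simp: pos_weight_def max_def)
      have "chain ?T (pos_weight N M) (N + M) (rev ks) (?P - Suc b) a
         = chain ?T (\<lambda>p. pos_weight M N (?P - Suc p)) ?P (rev ks) (?P - Suc b) a"
      proof -
        have cong: "chain \<tau> y P ks a b = chain \<tau> y' P ks a b"
          if "\<And>p. p < P \<Longrightarrow> y p = y' p" "a < P" for \<tau> :: real and y y' P ks a b
          using that by (induction ks arbitrary: a rule: induct_list012) (auto intro!: sum.cong)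
        show ?thesis unfolding add.commute[of N M] by (rule cong) (use w b in auto)
      qed
      also have "\<dots> = ?c (?P - Suc a) b"
        using chain_rev[of "?P - Suc a" ?P b ?T "pos_weight M N" ks] a b by simp
      finally show "?c (?P - Suc a) b * err_weight N M (M + N - b)
        = chain ?T (pos_weight N M) (N + M) (rev ks) (?P - Suc b) a * err_weight N M (Suc (?P - Suc b))"
        using b by (simp add: Suc_diff_Suc)
    qed auto
  qed auto
  also have "(\<Sum>a<M. \<Sum>b<M. ?c a b * err_weight M N (Suc a))
     + (\<Sum>b<N. \<Sum>a<N. chain ?T (pos_weight N M) (N + M) (rev ks) b a * err_weight N M (Suc b))
    \<le> ?T ^ length ks * harm M ^ length ks * (2 / real (M + 1) + 1 / real (N + 1))
     + ?T ^ length (rev ks) * harm N ^ length (rev ks) * (2 / real (N + 1) + 1 / real (M + 1))"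
    using ks by (intro add_mono block_error_bound) (auto simp: is_index_def)
  finally show ?thesis using B by (simp add: distrib_left mult.assoc mult_left_mono)
qed

section \<open>The truncated cyclic sum formula\<close>

definition comps :: "nat list \<Rightarrow> nat \<Rightarrow> nat list set" where
  "comps k m = {n. length n = length k \<and> sum_list n = m}"

lemma finite_comps: "finite (comps k m)"
proof (rule finite_subset)
  show "comps k m \<subseteq> {n. set n \<subseteq> {..m} \<and> length n = length k}"
    using member_le_sum_list by (fastforce simp: comps_def)
qed (rule finite_lists_length_eq, simp)

lemma comps_Nil: "comps [] m = (if m = 0 then {[]} else {})"
  by (auto simp: comps_def)

lemma sum_comps_Cons: "(\<Sum>n\<in>comps (a # k) m. h n) = (\<Sum>i\<le>m. \<Sum>n\<in>comps k (m - i). h (i # n))"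
proof -
  have "(\<Sum>i\<le>m. \<Sum>n\<in>comps k (m - i). h (i # n)) = (\<Sum>(i, n)\<in>Sigma {..m} (\<lambda>i. comps k (m - i)). h (i # n))"
    by (rule sum.Sigma) (auto simp: finite_comps)
  also have "\<dots> = (\<Sum>n\<in>comps (a # k) m. h n)"
    by (rule sum.reindex_bij_witness[of _ "\<lambda>n. (hd n, tl n)" "\<lambda>(i, n). i # n"])
       (auto simp: comps_def length_Suc_conv)
  finally show ?thesis ..
qed

lemma bcoef_Cons: "bcoef (a # k) (i # n) = ((a + i - 1) choose i) * bcoef k n"
  unfolding bcoef_def by (simp add: prod.lessThan_Suc_shift del: prod.lessThan_Suc)

text \<open>The series of \<open>r / (1 + r * X)\<close>, which is \<open>1 / (n + X)\<close> for
  \<open>r = 1 / n\<close>.\<close>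

definition geo :: "real \<Rightarrow> real fps" where
  "geo r = Abs_fps (\<lambda>m. (-1) ^ m * r ^ Suc m)"

lemma geo_power_nth: "fps_nth (geo r ^ a) m = real ((a + m - 1) choose m) * ((-1) ^ m * r ^ (a + m))"
\<comment> \<open>The truncated subtraction is harmless for \<open>a = 0\<close>:
  \<open>m - 1 choose m\<close> is 0 unless \<open>m = 0\<close>, where it is 1.\<close>
proof (cases "a = 0")
  case True
  then show ?thesis by (cases m) auto
next
  case False
  let ?u = "1 - fps_const (- r) * fps_X"
  have u: "inverse (?u ^ n) = Abs_fps (\<lambda>k. real ((n + k - 1) choose k) * (- r) ^ k)" if "n > 0" for n
    using one_minus_const_fps_X_neg_power'[OF that, of "- r"] .
  have neg: "(- r) ^ j = (-1) ^ j * r ^ j" for j by (metis mult_minus1 power_mult_distrib)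
  have "geo r = fps_const r * inverse (?u ^ 1)"
  proof -
    have "inverse (?u ^ 1) = Abs_fps (\<lambda>k. real ((1 + k - 1) choose k) * (- r) ^ k)" by (rule u) simp
    then show ?thesis by (simp only:) (rule fps_ext, simp add: geo_def neg)
  qed
  then have "geo r ^ a = fps_const (r ^ a) * inverse (?u ^ a)"
    by (simp only: power_one_right power_mult_distrib fps_const_power fps_inverse_power)
  then show ?thesis using False u[of a] by (simp add: neg power_add mult_ac)
qed

text \<open>The negative binomial series of each factor \<open>1 / (n + X) ^ a\<close> produces the
  coefficients \<open>bcoef\<close>. A truncated shifted zeta value is thus the ordinary truncated
  sum with every denominator \<open>n\<close> replaced by \<open>n + X\<close>.\<close>

lemma mqs_geo_nth:
  "fps_nth (mqs k (map geo xs)) m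
     = (-1) ^ m * (\<Sum>n\<in>comps k m. real (bcoef k n) * mqs (map2 (+) k n) xs)"
proof (induction xs arbitrary: k m)
  case Nil
  show ?case
  proof (cases k)
    case Nil
    then show ?thesis by (simp add: comps_Nil bcoef_def)
  next
    case (Cons a l)
    then show ?thesis by (simp add: sum_comps_Cons)
  qed
next
  case (Cons r xs)
  show ?case
  proof (cases k)
    case Nil
    then show ?thesis by (simp add: comps_Nil bcoef_def)
  next
    case k: (Cons a l)
    let ?b = "\<lambda>i. real ((a + i - 1) choose i)"
    have s: "(-1) ^ i * ((-1) ^ (m - i) * x) = (-1) ^ m * (x :: real)" if "i \<le> m" for i x
      using that by (simp only: mult.assoc[symmetric] power_add[symmetric]) simp
    have "fps_nth (geo r ^ a * mqs l (map geo xs)) m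
       = (\<Sum>i\<le>m. (-1) ^ m * (\<Sum>n\<in>comps l (m - i). ?b i * real (bcoef l n) * (r ^ (a + i) * mqs (map2 (+) l n) xs)))"
      unfolding fps_mult_nth atLeast0AtMost geo_power_nth Cons.IH
    proof (rule sum.cong)
      fix i assume "i \<in> {..m}"
      then have i: "i \<le> m" by simp
      have "?b i * ((-1) ^ i * r ^ (a + i)) * ((-1) ^ (m - i) * (\<Sum>n\<in>comps l (m - i). real (bcoef l n) * mqs (map2 (+) l n) xs))
        = (-1) ^ i * ((-1) ^ (m - i) * (?b i * r ^ (a + i) * (\<Sum>n\<in>comps l (m - i). real (bcoef l n) * mqs (map2 (+) l n) xs)))"
        by (simp only: mult_ac)
      also have "\<dots> = (-1) ^ m * (?b i * r ^ (a + i) * (\<Sum>n\<in>comps l (m - i). real (bcoef l n) * mqs (map2 (+) l n) xs))"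
        by (rule s[OF i])
      also have "?b i * r ^ (a + i) * (\<Sum>n\<in>comps l (m - i). real (bcoef l n) * mqs (map2 (+) l n) xs)
        = (\<Sum>n\<in>comps l (m - i). ?b i * real (bcoef l n) * (r ^ (a + i) * mqs (map2 (+) l n) xs))"
        by (simp only: sum_distrib_left mult_ac)
      finally show "?b i * ((-1) ^ i * r ^ (a + i)) * ((-1) ^ (m - i) * (\<Sum>n\<in>comps l (m - i). real (bcoef l n) * mqs (map2 (+) l n) xs))
        = (-1) ^ m * (\<Sum>n\<in>comps l (m - i). ?b i * real (bcoef l n) * (r ^ (a + i) * mqs (map2 (+) l n) xs))" .
    qed simp
    moreover have "fps_nth (mqs k (map geo xs)) m = (\<Sum>i\<le>m. (-1) ^ m * (\<Sum>n\<in>comps l (m - i).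
        ?b i * real (bcoef l n) * mqs ((a + i) # map2 (+) l n) xs))"
      unfolding Cons.IH k sum_comps_Cons by (simp add: bcoef_Cons sum_distrib_left)
    ultimately show ?thesis
      unfolding k sum_comps_Cons
      by (simp add: bcoef_Cons sum_distrib_left distrib_left sum.distrib k)
  qed
qed

definition in_s :: "real fps \<Rightarrow> rbiv" where "in_s A = Abs_fps (\<lambda>a. fps_const (fps_nth A a))"

lemma in_s_hom: "in_s (x + y) = in_s x + in_s y" "in_s (x * y) = in_s x * in_s y" "in_s 0 = 0" "in_s 1 = 1"
proof -
  show "in_s (x + y) = in_s x + in_s y" "in_s 0 = 0"
    by (auto intro!: fps_ext simp: in_s_def)
  show "in_s 1 = 1" by (intro fps_ext) (auto simp: in_s_def)
  show "in_s (x * y) = in_s x * in_s y"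
    by (intro fps_ext) (simp add: in_s_def fps_mult_nth[of _ _ n for n] fps_sum_nth sum_distrib_left[symmetric] if_distrib cong: if_cong)
qed

lemma fps_negvar_hom:
  "fps_negvar (x + y) = fps_negvar x + fps_negvar y" "fps_negvar (x * y) = fps_negvar x * fps_negvar y"
  "fps_negvar 0 = 0" "fps_negvar 1 = 1"
proof -
  show "fps_negvar (x + y) = fps_negvar x + fps_negvar y" "fps_negvar 0 = 0" "fps_negvar 1 = 1"
    by (auto intro!: fps_ext simp: fps_negvar_def distrib_left)
  show "fps_negvar (x * y) = fps_negvar x * fps_negvar y"
  proof (rule fps_ext)
    fix n
    have "(-1) ^ n * (fps_nth x i * fps_nth y (n - i)) = ((-1) ^ i * fps_nth x i) * ((-1) ^ (n - i) * fps_nth y (n - i))"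
      if "i \<le> n" for i
    proof -
      have "(-1 :: 'a) ^ n = (-1) ^ i * (-1) ^ (n - i)" using that by (simp flip: power_add)
      then show ?thesis by (simp only: mult_ac)
    qed
    then show "fps_nth (fps_negvar (x * y)) n = fps_nth (fps_negvar x * fps_negvar y) n"
      by (simp add: fps_negvar_def fps_mult_nth sum_distrib_left)
  qed
qed

text \<open>The elements \<open>t - n\<close> of the second block are \<open>-(n - t)\<close>: the
  inner sign is \<open>fps_negvar\<close>, the outer one becomes the sign of the weight in
  \<open>zeta_S\<close>.\<close>

definition in_t :: "real fps \<Rightarrow> rbiv" where "in_t B = fps_const (fps_negvar B)"

lemma in_t_hom: "in_t (x + y) = in_t x + in_t y" "in_t (x * y) = in_t x * in_t y" "in_t 0 = 0" "in_t 1 = 1"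
  by (simp_all add: in_t_def fps_negvar_hom)

lemma in_s_in_t_nth: "fps_nth (fps_nth (in_s A * in_t B) a) c = fps_nth A a * ((-1) ^ c * fps_nth B c)"
  by (simp add: in_s_def in_t_def fps_negvar_def)

lemma lin_inv_geo:
  "lin_inv (real n) 1 0 = in_s (geo (1 / real n))"
  "lin_inv (- real n) 0 1 = - in_t (geo (1 / real n))"
proof -
  have z: "(0::real) ^ c = (if c = 0 then 1 else 0)" for c by simp
  show "lin_inv (real n) 1 0 = in_s (geo (1 / real n))"
    by (intro fps_ext) (simp add: lin_inv_def in_s_def geo_def z power_divide)
  have neg: "(- real n) ^ j = (-1) ^ j * real n ^ j" for j by (metis mult_minus1 power_mult_distrib)
  show "lin_inv (- real n) 0 1 = - in_t (geo (1 / real n))"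
    by (intro fps_ext) (simp add: lin_inv_def in_t_def fps_negvar_def geo_def z power_divide neg)
qed

text \<open>The coefficients of \<open>zeta_S\<close> with an arbitrary \<open>g k l\<close> in
  place of the product of two regularized values. One formula thereby covers truncated sums and the
  coefficients in \<open>T_1\<close> and \<open>T_2\<close>. In \<open>t\<close> the signs of
  \<open>zeta_shift\<close> and \<open>fps_negvar\<close> cancel, so only \<open>(-1) ^ a\<close>
  remains.\<close>

definition rS :: "(nat list \<Rightarrow> nat list \<Rightarrow> real) \<Rightarrow> nat list \<Rightarrow> rbiv" where
  "rS g k = Abs_fps (\<lambda>a. Abs_fps (\<lambda>c. \<Sum>i=0..length k. (-1) ^ sum_list (drop i k) *
     ((-1) ^ a * (\<Sum>n\<in>comps (take i k) a. \<Sum>n'\<in>comps (rev (drop i k)) c.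
        real (bcoef (take i k) n) * real (bcoef (rev (drop i k)) n') *
        g (map2 (+) (take i k) n) (map2 (+) (rev (drop i k)) n')))))"

definition trunc :: "nat \<Rightarrow> nat \<Rightarrow> nat list \<Rightarrow> nat list \<Rightarrow> real" where
  "trunc M N k l = tz M k * tz N l"

lemma map_pos_inv:
  "map (pos_inv M N) [0..<M+N] = map (\<lambda>n. lin_inv (real n) 1 0) [1..<Suc M]
     @ rev (map (\<lambda>n. lin_inv (- real n) 0 1) [1..<Suc N])"
proof (rule nth_equalityI)
  fix i assume "i < length (map (pos_inv M N) [0..<M+N])"
  then have i: "i < M + N" by simp
  show "map (pos_inv M N) [0..<M+N] ! i = (map (\<lambda>n. lin_inv (real n) 1 0) [1..<Suc M]
     @ rev (map (\<lambda>n. lin_inv (- real n) 0 1) [1..<Suc N])) ! i"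
  proof (cases "i < M")
    case True
    then show ?thesis by (simp add: nth_append pos_inv_def del: upt_Suc)
  next
    case False
    let ?f = "\<lambda>n. lin_inv (- real n) 0 1"
    have "[1..<Suc N] ! (N - Suc (i - M)) = M + N - i"
      using i False by (simp del: upt_Suc)
    moreover have "rev (map ?f [1..<Suc N]) ! (i - M) = ?f ([1..<Suc N] ! (N - Suc (i - M)))"
    proof -
      have "rev (map h xs) ! j = h (xs ! (length xs - Suc j))" if "j < length xs" for h :: "nat \<Rightarrow> rbiv" and xs j
        using that by (simp add: rev_nth)
      from this[of "i - M" "[1..<Suc N]" ?f] show ?thesis using i False by simp
    qed
    ultimately have "rev (map ?f [1..<Suc N]) ! (i - M) = ?f (M + N - i)" by (simp only:)
    moreover have "length (map (\<lambda>n. lin_inv (real n) 1 0) [1..<Suc M]) = M" by simp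
    moreover have "map (pos_inv M N) [0..<M+N] ! i = pos_inv M N i" using i by simp
    ultimately show ?thesis using False by (simp only: nth_append pos_inv_def if_False)
  qed
qed simp

text \<open>Cutting a chain between the two blocks gives the sum over \<open>i\<close>. The second
  block consists of negatives in reversed order, which accounts for the sign of the weight and for
  \<open>rev\<close>.\<close>

lemma rS_trunc: "rS (trunc M N) k = mqs k (map (pos_inv M N) [0..<M+N])"
proof (intro fps_ext)
  fix a c
  let ?r = "\<lambda>N. map (\<lambda>n. 1 / real n) [1..<Suc N]"
  have 1: "mqs l (map (\<lambda>n. lin_inv (real n) 1 0) [1..<Suc M]) = in_s (mqs l (map geo (?r M)))" for l
    unfolding mqs_hom[of in_s, OF in_s_hom] by (simp only: lin_inv_geo map_map o_def)
  have 2: "mqs l (rev (map (\<lambda>n. lin_inv (- real n) 0 1) [1..<Suc N]))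
      = (-1) ^ sum_list l * in_t (mqs (rev l) (map geo (?r N)))" for l
  proof -
    have "mqs l (rev (map (\<lambda>n. lin_inv (- real n) 0 1) [1..<Suc N]))
       = mqs (rev l) (map uminus (map in_t (map geo (?r N))))"
      using mqs_rev[of "rev l" "map (\<lambda>n. lin_inv (- real n) 0 1) [1..<Suc N]"]
      by (simp only: lin_inv_geo map_map o_def rev_rev_ident)
    then show ?thesis unfolding mqs_uminus mqs_hom[of in_t, OF in_t_hom] by (simp add: sum_list_rev)
  qed
  have sgn: "fps_nth (fps_nth ((-1) ^ j * F) a) c = (-1) ^ j * fps_nth (fps_nth F a) c" for F :: rbiv and j a c
    by (cases "even j") simp_all
  have tz: "tz N l = mqs l (?r N)" for N l by (simp only: tz_def)
  have sq: "(-1) ^ c * ((-1) ^ c * x) = (x :: real)" for x c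
    by (simp flip: mult.assoc power_mult_distrib)
  have "fps_nth (fps_nth (mqs k (map (pos_inv M N) [0..<M+N])) a) c
     = (\<Sum>i\<le>length k. (-1) ^ sum_list (drop i k) *
         (fps_nth (mqs (take i k) (map geo (?r M))) a * ((-1) ^ c * fps_nth (mqs (rev (drop i k)) (map geo (?r N))) c)))"
    unfolding map_pos_inv mqs_append 1 2 fps_sum_nth mult.left_commute[of "in_s x" for x] sgn in_s_in_t_nth ..
  also have "\<dots> = fps_nth (fps_nth (rS (trunc M N) k) a) c"
    unfolding rS_def trunc_def fps_nth_Abs_fps atLeast0AtMost mqs_geo_nth sq tz[symmetric]
    by (intro sum.cong refl) (simp add: sum_product mult_ac sum_distrib_left)
  finally show "fps_nth (fps_nth (rS (trunc M N) k) a) c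
     = fps_nth (fps_nth (mqs k (map (pos_inv M N) [0..<M+N])) a) c" ..
qed

definition rS_tau :: "real \<Rightarrow> (nat list \<Rightarrow> nat list \<Rightarrow> real) \<Rightarrow> nat list \<Rightarrow> rbiv" where
  "rS_tau \<tau> g k = (\<Sum>l\<leftarrow>coarsenings k. rS g l * rc \<tau> ^ (length k - length l))"

lemma rS_tau_trunc:
  "k \<noteq> [] \<Longrightarrow> rS_tau \<tau> (trunc M N) k = (\<Sum>a<M+N. \<Sum>b<M+N. chain (rc \<tau>) (pos_inv M N) (M + N) k a b)"
  unfolding rS_tau_def rS_trunc by (simp add: mqs_tau_chain[symmetric] mqs_tau_def)

definition cyc_lhs :: "real \<Rightarrow> (nat list \<Rightarrow> nat list \<Rightarrow> real) \<Rightarrow> nat list \<Rightarrow> rbiv" where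
  "cyc_lhs \<tau> g k = (\<Sum>i=1..length k. \<Sum>j=0..<k ! (i - 1).
            rS_tau \<tau> g ((j + 1) # drop i k @ take (i - 1) k @ [k ! (i - 1) - j]))
         - rc (real (sum_list k)) * rc \<tau> ^ length k * rS_tau 1 g [sum_list k + 1]"

definition cyc_rhs :: "real \<Rightarrow> (nat list \<Rightarrow> nat list \<Rightarrow> real) \<Rightarrow> nat list \<Rightarrow> rbiv" where
  "cyc_rhs \<tau> g k = (\<Sum>i=1..length k. rsum_t (\<lambda>j.
            rS_tau \<tau> g ((j + 1) # drop i k @ take i k)
            + rc (1 - \<tau>) * rS_tau \<tau> g (uplus [j + 1] (drop i k @ take i k))))
       + (\<Sum>i=1..length k. rsum_s (\<lambda>j.
            rS_tau \<tau> g (drop i k @ take i k @ [j + 1])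
            + rc (1 - \<tau>) * rS_tau \<tau> g (uplus (drop i k @ take i k) [j + 1])))"

text \<open>A prepended entry adds a position \<open>e\<close> weakly before \<open>a\<close>, with
  weight \<open>\<tau>\<close> at \<open>e = a\<close>; the \<open>uplus\<close> term puts the same
  power at \<open>a\<close> with weight \<open>1 - \<tau>\<close>. Together every
  \<open>e \<le> a\<close> has weight 1, and the series over \<open>j\<close> sums to
  \<open>end_low\<close>.\<close>

lemma low_part_trunc:
  assumes "K \<noteq> []"
  shows "rsum_t (\<lambda>j. rS_tau \<tau> (trunc M N) ((j + 1) # K)
            + rc (1 - \<tau>) * rS_tau \<tau> (trunc M N) (uplus [j + 1] K))
     = (\<Sum>a<M+N. \<Sum>b<M+N. chain (rc \<tau>) (pos_inv M N) (M + N) K a b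
          * (\<Sum>e=0..<Suc a. end_low v_inv u_inv M N e))"
proof -
  let ?P = "M + N" and ?y = "pos_inv M N"
  let ?c = "\<lambda>a b. chain (rc \<tau>) ?y ?P K a b"
  have "rS_tau \<tau> (trunc M N) ((j + 1) # K) + rc (1 - \<tau>) * rS_tau \<tau> (trunc M N) (uplus [j + 1] K)
     = (\<Sum>a<?P. \<Sum>b<?P. \<Sum>e\<in>{0..<Suc a}. ?c a b * ?y e ^ Suc j)" for j
  proof -
    obtain h t where K: "K = h # t" using assms by (cases K) auto
    have up: "uplus [j + 1] K = (j + 1 + h) # t" by (simp add: uplus_def K)
    have "(\<Sum>e<?P. \<Sum>b<?P. chain (rc \<tau>) ?y ?P ((j + 1) # K) e b)
      = (\<Sum>e<?P. \<Sum>b<?P. \<Sum>a<?P. ?c a b * (weak_kernel (rc \<tau>) e a * ?y e ^ Suc j))"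
      using assms by (simp add: chain_Cons sum_distrib_left mult_ac)
    also have "\<dots> = (\<Sum>e<?P. \<Sum>a<?P. \<Sum>b<?P. ?c a b * (weak_kernel (rc \<tau>) e a * ?y e ^ Suc j))"
      by (intro sum.cong refl sum.swap)
    also have "\<dots> = (\<Sum>a<?P. \<Sum>e<?P. \<Sum>b<?P. ?c a b * (weak_kernel (rc \<tau>) e a * ?y e ^ Suc j))"
      by (rule sum.swap)
    also have "\<dots> = (\<Sum>a<?P. \<Sum>b<?P. \<Sum>e<?P. ?c a b * (weak_kernel (rc \<tau>) e a * ?y e ^ Suc j))"
      by (intro sum.cong refl sum.swap)
    finally have 1: "rS_tau \<tau> (trunc M N) ((j + 1) # K)
      = (\<Sum>a<?P. \<Sum>b<?P. ?c a b * (\<Sum>e<?P. weak_kernel (rc \<tau>) e a * ?y e ^ Suc j))"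
      by (simp add: rS_tau_trunc sum_distrib_left)
    have 2: "rc (1 - \<tau>) * rS_tau \<tau> (trunc M N) (uplus [j + 1] K)
      = (\<Sum>a<?P. \<Sum>b<?P. ?c a b * (rc (1 - \<tau>) * ?y a ^ Suc j))"
    proof -
      have "rS_tau \<tau> (trunc M N) (uplus [j + 1] K) = (\<Sum>a<?P. \<Sum>b<?P. ?y a ^ (j + 1) * ?c a b)"
        unfolding up unfolding K chain_Cons_add[symmetric] by (rule rS_tau_trunc) simp
      then show ?thesis by (simp add: sum_distrib_left mult_ac)
    qed
    have 3: "(\<Sum>e<?P. weak_kernel (rc \<tau>) e a * ?y e ^ Suc j) + rc (1 - \<tau>) * ?y a ^ Suc j
       = (\<Sum>e\<in>{0..<Suc a}. ?y e ^ Suc j)" if "a < ?P" for a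
    proof -
      have "(\<Sum>e<?P. weak_kernel (rc \<tau>) e a * ?y e ^ Suc j)
         = (\<Sum>e<Suc a. weak_kernel (rc \<tau>) e a * ?y e ^ Suc j)"
        using that by (intro sum.mono_neutral_right) (auto simp: weak_kernel_def)
      also have "\<dots> = (\<Sum>e<a. ?y e ^ Suc j) + rc \<tau> * ?y a ^ Suc j"
        by (simp add: weak_kernel_def)
      finally show ?thesis
        by (simp add: atLeast0LessThan rc_simps left_diff_distrib del: power_Suc)
    qed
    show ?thesis
      unfolding 1 2 sum.distrib[symmetric] distrib_left[symmetric]
      using 3 by (simp only: sum_distrib_left[symmetric]) simp
  qed
  then have "rsum_t (\<lambda>j. rS_tau \<tau> (trunc M N) ((j + 1) # K)
            + rc (1 - \<tau>) * rS_tau \<tau> (trunc M N) (uplus [j + 1] K))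
     = (\<Sum>a<?P. \<Sum>b<?P. \<Sum>e\<in>{0..<Suc a}. rsum_t (\<lambda>j. ?c a b * ?y e ^ Suc j))"
    by (simp only: rsum_sum)
  also have "\<dots> = (\<Sum>a<?P. \<Sum>b<?P. \<Sum>e\<in>{0..<Suc a}. ?c a b * end_low v_inv u_inv M N e)"
    by (intro sum.cong refl rsum_t_geometric end_low_inv) auto
  finally show ?thesis by (simp only: sum_distrib_left)
qed

lemma high_part_trunc:
  assumes "K \<noteq> []"
  shows "rsum_s (\<lambda>j. rS_tau \<tau> (trunc M N) (K @ [j + 1])
            + rc (1 - \<tau>) * rS_tau \<tau> (trunc M N) (uplus K [j + 1]))
     = (\<Sum>a<M+N. \<Sum>b<M+N. chain (rc \<tau>) (pos_inv M N) (M + N) K a b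
          * (\<Sum>e=b..<M+N. end_high v_inv u_inv M N e))"
proof -
  let ?P = "M + N" and ?y = "pos_inv M N"
  let ?c = "\<lambda>a b. chain (rc \<tau>) ?y ?P K a b"
  have "rS_tau \<tau> (trunc M N) (K @ [j + 1]) + rc (1 - \<tau>) * rS_tau \<tau> (trunc M N) (uplus K [j + 1])
     = (\<Sum>a<?P. \<Sum>b<?P. \<Sum>e\<in>{b..<?P}. ?c a b * ?y e ^ Suc j)" for j
  proof -
    obtain h t where K: "K = t @ [h]" using assms by (metis rev_exhaust)
    have up: "uplus K [j + 1] = t @ [h + (j + 1)]" by (simp add: uplus_def K)
    have "(\<Sum>a<?P. \<Sum>e<?P. chain (rc \<tau>) ?y ?P (K @ [j + 1]) a e)
      = (\<Sum>a<?P. \<Sum>e<?P. \<Sum>b<?P. ?c a b * (weak_kernel (rc \<tau>) b e * ?y e ^ Suc j))"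
      using assms by (intro sum.cong refl) (simp add: chain_snoc sum_distrib_left sum_distrib_right mult_ac)
    also have "\<dots> = (\<Sum>a<?P. \<Sum>b<?P. \<Sum>e<?P. ?c a b * (weak_kernel (rc \<tau>) b e * ?y e ^ Suc j))"
      by (intro sum.cong refl sum.swap)
    finally have 1: "rS_tau \<tau> (trunc M N) (K @ [j + 1])
      = (\<Sum>a<?P. \<Sum>b<?P. ?c a b * (\<Sum>e<?P. weak_kernel (rc \<tau>) b e * ?y e ^ Suc j))"
      by (simp add: rS_tau_trunc sum_distrib_left)
    have 2: "rc (1 - \<tau>) * rS_tau \<tau> (trunc M N) (uplus K [j + 1])
      = (\<Sum>a<?P. \<Sum>b<?P. ?c a b * (rc (1 - \<tau>) * ?y b ^ Suc j))"
    proof -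
      have "rS_tau \<tau> (trunc M N) (uplus K [j + 1]) = (\<Sum>a<?P. \<Sum>b<?P. ?c a b * ?y b ^ (j + 1))"
        unfolding up unfolding K chain_snoc_add[symmetric] by (rule rS_tau_trunc) simp
      then show ?thesis by (simp add: sum_distrib_left mult_ac)
    qed
    have 3: "(\<Sum>e<?P. weak_kernel (rc \<tau>) b e * ?y e ^ Suc j) + rc (1 - \<tau>) * ?y b ^ Suc j
       = (\<Sum>e\<in>{b..<?P}. ?y e ^ Suc j)" if "b < ?P" for b
      unfolding weak_kernel_sum[OF that] sum.atLeast_Suc_lessThan[OF that]
      by (simp add: rc_simps left_diff_distrib del: power_Suc)
    show ?thesis
      unfolding 1 2 sum.distrib[symmetric] distrib_left[symmetric]
      using 3 by (simp only: sum_distrib_left[symmetric]) simp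
  qed
  then have "rsum_s (\<lambda>j. rS_tau \<tau> (trunc M N) (K @ [j + 1])
            + rc (1 - \<tau>) * rS_tau \<tau> (trunc M N) (uplus K [j + 1]))
     = (\<Sum>a<?P. \<Sum>b<?P. \<Sum>e\<in>{b..<?P}. rsum_s (\<lambda>j. ?c a b * ?y e ^ Suc j))"
    by (simp only: rsum_sum)
  also have "\<dots> = (\<Sum>a<?P. \<Sum>b<?P. \<Sum>e\<in>{b..<?P}. ?c a b * end_high v_inv u_inv M N e)"
    by (intro sum.cong refl rsum_s_geometric end_high_inv) auto
  finally show ?thesis by (simp only: sum_distrib_left)
qed

lemma cyclic_sum_trunc:
  assumes k: "length k \<ge> 1"
  shows "cyc_lhs \<tau> (trunc M N) k - cyc_rhs \<tau> (trunc M N) k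
     = (\<Sum>i=1..length k. \<Sum>a<M+N. \<Sum>b<M+N.
          chain (rc \<tau>) (pos_inv M N) (M + N) (drop i k @ take i k) a b * cyc_error v_inv u_inv M N a b)"
proof -
  let ?P = "M + N" and ?y = "pos_inv M N"
  let ?c = "\<lambda>i a b. chain (rc \<tau>) ?y ?P (drop i k @ take i k) a b"
  have ne: "drop i k @ take i k \<noteq> []" if "i \<in> {1..length k}" for i using that k by auto
  have star: "rS_tau 1 (trunc M N) [sum_list k + 1] = (\<Sum>a<?P. ?y a ^ (sum_list k + 1))"
    by (subst rS_tau_trunc) simp_all
  have "cyc_lhs \<tau> (trunc M N) k = (\<Sum>i=1..length k. \<Sum>a<?P. \<Sum>b<?P. ?c i a b
      * cyc_kernel (rc \<tau>) (diff_inv v_inv u_inv M N) ?P a b)"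
    unfolding cyc_lhs_def star
    using cyclic_telescoping[of ?P "diff_inv v_inv u_inv M N" ?y k "rc \<tau>", OF diff_inv_mult k]
    by (simp add: rS_tau_trunc rc_simps)
  also have "\<dots> = (\<Sum>i=1..length k. \<Sum>a<?P. \<Sum>b<?P. ?c i a b * (\<Sum>e=0..<Suc a. end_low v_inv u_inv M N e)
      + ?c i a b * (\<Sum>e=b..<?P. end_high v_inv u_inv M N e) + ?c i a b * cyc_error v_inv u_inv M N a b)"
  proof (intro sum.cong refl)
    fix i a b assume "b \<in> {..<?P}"
    then show "?c i a b * cyc_kernel (rc \<tau>) (diff_inv v_inv u_inv M N) ?P a b
      = ?c i a b * (\<Sum>e=0..<Suc a. end_low v_inv u_inv M N e)
      + ?c i a b * (\<Sum>e=b..<?P. end_high v_inv u_inv M N e) + ?c i a b * cyc_error v_inv u_inv M N a b"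
      \<comment> \<open>The kernel identity is available for \<open>a \<le> b\<close>; otherwise the
        chain vanishes.\<close>
      by (cases "a \<le> b") (simp_all only: cyc_kernel_eq_error lessThan_iff distrib_left chain_zero not_le
          mult_zero_left add_0_left)
  qed
  also have "\<dots> = cyc_rhs \<tau> (trunc M N) k + (\<Sum>i=1..length k. \<Sum>a<?P. \<Sum>b<?P. ?c i a b * cyc_error v_inv u_inv M N a b)"
  proof -
    have "cyc_rhs \<tau> (trunc M N) k
      = (\<Sum>i=1..length k. \<Sum>a<?P. \<Sum>b<?P. ?c i a b * (\<Sum>e=0..<Suc a. end_low v_inv u_inv M N e))
      + (\<Sum>i=1..length k. \<Sum>a<?P. \<Sum>b<?P. ?c i a b * (\<Sum>e=b..<?P. end_high v_inv u_inv M N e))"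
      unfolding cyc_rhs_def
      using low_part_trunc[OF ne, of _ \<tau> M N] high_part_trunc[OF ne, of _ \<tau> M N]
      by (intro arg_cong2[where f = "(+)"] sum.cong refl) (simp_all only: append_assoc)
    then show ?thesis by (simp only: sum.distrib)
  qed
  finally show ?thesis by simp
qed

section \<open>Passage to the limit\<close>

lemma trunc_error_tendsto:
  assumes k: "is_index k" "length k \<ge> 1" "sum_list k > length k" and c: "1 \<le> c"
  shows "(\<lambda>n. fps_nth (fps_nth (cyc_lhs \<tau> (trunc (Suc n) (Suc n ^ c)) k
            - cyc_rhs \<tau> (trunc (Suc n) (Suc n ^ c)) k) a) d) \<longlonglongrightarrow> 0"
proof -
  define A where "A = max a d"
  define r where "r = length k"
  define K where "K = coef_bound A ^ Suc (sum_list k) * max 1 (rnorm A (rc \<tau>)) ^ r"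
  have K: "0 \<le> K" unfolding K_def using coef_bound_ge_1[of A] by (intro mult_nonneg_nonneg zero_le_power) auto
  \<comment> \<open>Here the hypothesis that the weight exceeds the depth enters.\<close>
  have big: "\<exists>x\<in>set k. 2 \<le> x"
  proof (rule ccontr)
    assume "\<not> (\<exists>x\<in>set k. 2 \<le> x)"
    then have "\<And>x. x \<in> set k \<Longrightarrow> x \<le> 1" by force
    then have "sum_list k \<le> length k" by (induction k) force+
    then show False using k by simp
  qed
  have bound: "\<bar>fps_nth (fps_nth (cyc_lhs \<tau> (trunc (Suc n) (Suc n ^ c)) k
            - cyc_rhs \<tau> (trunc (Suc n) (Suc n ^ c)) k) a) d\<bar>
     \<le> (6 * real r * K * real c ^ r) * ((ln (real (Suc n)) + 1) ^ r / sqrt (real (Suc n)))" for n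
  proof -
    let ?M = "Suc n" and ?N = "Suc n ^ c"
    have MN: "?M \<le> ?N" using power_increasing[of 1 c "Suc n"] c by simp
    let ?E = "\<lambda>i. \<Sum>a<?M+?N. \<Sum>b<?M+?N. chain (rc \<tau>) (pos_inv ?M ?N) (?M + ?N) (drop i k @ take i k) a b
         * cyc_error v_inv u_inv ?M ?N a b"
    have HN: "harm ?N \<le> real c * (ln (real ?M) + 1)"
    proof -
      have "harm ?N \<le> ln (real ?N) + 1"
        using harm_le_ln[of "?N - 1"] by simp
      also have "\<dots> = real c * ln (real ?M) + 1" by (simp add: ln_realpow del: of_nat_Suc)
      also have "\<dots> \<le> real c * (ln (real ?M) + 1)" using c by (simp add: distrib_left)
      finally show ?thesis .
    qed
    have E: "rnorm A (?E i) \<le> K * (6 * ((real c * (ln (real ?M) + 1)) ^ r / real ?M))" if "i \<in> {1..length k}" for i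
    proof -
      have len: "length (drop i k @ take i k) = r" using that by (simp add: r_def)
      have sum: "sum_list (drop i k @ take i k) = sum_list k"
        by (metis add.commute append_take_drop_id sum_list.append)
      have set: "set (drop i k @ take i k) = set k"
        by (metis Un_commute append_take_drop_id set_append)
      have "rnorm A (?E i) \<le> K * (harm ?M ^ r * (2 / real (?M + 1) + 1 / real (?N + 1))
        + harm ?N ^ r * (2 / real (?N + 1) + 1 / real (?M + 1)))"
      proof -
        have "is_index (drop i k @ take i k)" "drop i k @ take i k \<noteq> []" "\<exists>x\<in>set (drop i k @ take i k). 2 \<le> x"
          using k big set len r_def by (auto simp: is_index_def)
        from chain_error_bound[OF this, where A = A and M = ?M and N = ?N and \<tau> = "rc \<tau>"]
        show ?thesis unfolding len sum K_def .
      qed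
      also have "\<dots> \<le> K * (harm ?N ^ r * (3 / real ?M) + harm ?N ^ r * (3 / real ?M))"
      proof -
        \<comment> \<open>As \<open>M \<le> N\<close>, each of the two brackets is at most
          \<open>3 / M\<close>; together they give the constant 6.\<close>
        have le: "1 / real (?M + 1) \<le> 1 / real ?M" "1 / real (?N + 1) \<le> 1 / real ?M"
          using MN by (auto intro!: divide_left_mono simp del: of_nat_Suc of_nat_power)
        then have le3: "2 / real (?M + 1) + 1 / real (?N + 1) \<le> 3 / real ?M"
          "2 / real (?N + 1) + 1 / real (?M + 1) \<le> 3 / real ?M" by linarith+
        have h: "harm ?M ^ r \<le> (harm ?N :: real) ^ r" "0 \<le> (harm ?N :: real) ^ r"
          by (intro power_mono harm_mono MN harm_nonneg) (intro zero_le_power harm_nonneg)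
        show ?thesis
          by (rule mult_left_mono[OF add_mono[OF mult_mono[OF h(1) le3(1) h(2)] mult_left_mono[OF le3(2) h(2)]] K])
            (intro add_nonneg_nonneg, simp_all)
      qed
      also have "\<dots> = K * (6 * (harm ?N ^ r / real ?M))"
      proof -
        have "K * (h * (3 / x) + h * (3 / x)) = K * (6 * (h / x))" for h x :: real
          by (cases "x = 0") (simp_all add: field_simps)
        then show ?thesis .
      qed
      also have "\<dots> \<le> K * (6 * ((real c * (ln (real ?M) + 1)) ^ r / real ?M))"
        by (intro mult_left_mono divide_right_mono power_mono HN harm_nonneg K) auto
      finally show ?thesis .
    qed
    have "\<bar>fps_nth (fps_nth (cyc_lhs \<tau> (trunc ?M ?N) k - cyc_rhs \<tau> (trunc ?M ?N) k) a) d\<bar>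
       \<le> rnorm A (cyc_lhs \<tau> (trunc ?M ?N) k - cyc_rhs \<tau> (trunc ?M ?N) k)"
      by (rule nth_le_rnorm) (auto simp: A_def)
    also have "\<dots> \<le> (\<Sum>i=1..length k. rnorm A (?E i))"
      unfolding cyclic_sum_trunc[OF k(2)] by (rule submult_norm_sum[OF submult_rnorm])
    also have "\<dots> \<le> (\<Sum>i=1..length k. K * (6 * ((real c * (ln (real ?M) + 1)) ^ r / real ?M)))"
      by (intro sum_mono E)
    also have "\<dots> = (6 * real r * K * real c ^ r) * ((ln (real ?M) + 1) ^ r / real ?M)"
      by (simp add: r_def power_mult_distrib)
    also have "\<dots> \<le> (6 * real r * K * real c ^ r) * ((ln (real ?M) + 1) ^ r / sqrt (real ?M))"
      using K sqrt_le_power(2)[of 1 n]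
      by (intro mult_left_mono divide_left_mono) (auto intro!: add_nonneg_nonneg)
    finally show ?thesis .
  qed
  show ?thesis
    by (rule Lim_null_comparison[OF _ tendsto_mult_right_zero[OF ln_power_over_sqrt]])
       (intro always_eventually allI, use bound in simp)
qed

section \<open>Transfer of bilinear relations from truncations to regularized values\<close>

text \<open>Finite linear combinations of values of \<open>g\<close> at pairs of indices. Every
  coefficient of the cyclic sum identity has this form, although the theorem contains infinite sums,
  because each coefficient receives finitely many terms.\<close>

definition linb :: "((nat list \<Rightarrow> nat list \<Rightarrow> real) \<Rightarrow> real) \<Rightarrow> bool" where
  "linb F \<longleftrightarrow> (\<exists>ps. (\<forall>(x, k, l)\<in>set ps. is_index k \<and> is_index l) \<and>
      (\<forall>g. F g = (\<Sum>(x, k, l)\<leftarrow>ps. x * g k l)))"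

lemma linb_0: "linb (\<lambda>g. 0)"
  unfolding linb_def by (rule exI[of _ "[]"]) simp

lemma linb_atom: "is_index k \<Longrightarrow> is_index l \<Longrightarrow> linb (\<lambda>g. g k l)"
  unfolding linb_def by (rule exI[of _ "[(1, k, l)]"]) simp

lemma linb_add:
  assumes "linb F" "linb G"
  shows "linb (\<lambda>g. F g + G g)"
proof -
  obtain ps qs where "\<forall>(x, k, l)\<in>set ps. is_index k \<and> is_index l" "\<forall>g. F g = (\<Sum>(x, k, l)\<leftarrow>ps. x * g k l)"
    "\<forall>(x, k, l)\<in>set qs. is_index k \<and> is_index l" "\<forall>g. G g = (\<Sum>(x, k, l)\<leftarrow>qs. x * g k l)"
    using assms unfolding linb_def by blast
  then show ?thesis unfolding linb_def by (intro exI[of _ "ps @ qs"]) auto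
qed

lemma linb_cmult:
  assumes "linb F"
  shows "linb (\<lambda>g. c * F g)"
proof -
  obtain ps where ps: "\<forall>(x, k, l)\<in>set ps. is_index k \<and> is_index l" "\<And>g. F g = (\<Sum>(x, k, l)\<leftarrow>ps. x * g k l)"
    using assms unfolding linb_def by blast
  have "c * F g = (\<Sum>(x, k, l)\<leftarrow>map (\<lambda>(x, k, l). (c * x, k, l)) ps. x * g k l)" for g
    unfolding ps(2) by (induction ps) (auto simp: distrib_left mult.assoc)
  then show ?thesis unfolding linb_def using ps(1)
    by (intro exI[of _ "map (\<lambda>(x, k, l). (c * x, k, l)) ps"]) auto
qed

lemma linb_multc: "linb F \<Longrightarrow> linb (\<lambda>g. F g * c)"
  using linb_cmult[of F c] by (simp add: mult.commute)

lemma linb_diff: "linb F \<Longrightarrow> linb G \<Longrightarrow> linb (\<lambda>g. F g - G g)"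
  using linb_add[OF _ linb_cmult[of G "-1"]] by simp

lemma linb_sum: "(\<And>x. x \<in> A \<Longrightarrow> linb (F x)) \<Longrightarrow> linb (\<lambda>g. \<Sum>x\<in>A. F x g)"
  by (induction A rule: infinite_finite_induct) (auto intro: linb_0 linb_add)

lemma is_index_comps: "is_index k \<Longrightarrow> n \<in> comps k m \<Longrightarrow> is_index (map2 (+) k n)"
  by (auto simp: is_index_def comps_def in_set_zip add_pos_nonneg)

lemma is_index_parts: "is_index k \<Longrightarrow> is_index (take i k)" "is_index k \<Longrightarrow> is_index (drop i k)"
    "is_index (rev k) = is_index k" "is_index (k @ l) = (is_index k \<and> is_index l)"
    "is_index (a # k) = (0 < a \<and> is_index k)" "is_index []"
  by (auto simp: is_index_def dest: in_set_takeD in_set_dropD)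

definition rlin :: "((nat list \<Rightarrow> nat list \<Rightarrow> real) \<Rightarrow> rbiv) \<Rightarrow> bool" where
  "rlin F \<longleftrightarrow> (\<forall>a c. linb (\<lambda>g. fps_nth (fps_nth (F g) a) c))"

lemma rlin_rS: "is_index k \<Longrightarrow> rlin (\<lambda>g. rS g k)"
  unfolding rlin_def rS_def fps_nth_Abs_fps
  by (intro allI linb_sum linb_cmult linb_atom is_index_comps) (auto simp: is_index_parts)

lemma rlinD: "rlin F \<Longrightarrow> linb (\<lambda>g. fps_nth (fps_nth (F g) a) c)"
  by (simp add: rlin_def)

lemma rlin_add: "rlin F \<Longrightarrow> rlin G \<Longrightarrow> rlin (\<lambda>g. F g + G g)"
  unfolding rlin_def[of "\<lambda>g. F g + G g"] fps_add_nth by (intro allI linb_add rlinD)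

lemma rlin_diff: "rlin F \<Longrightarrow> rlin G \<Longrightarrow> rlin (\<lambda>g. F g - G g)"
  unfolding rlin_def[of "\<lambda>g. F g - G g"] fps_sub_nth by (intro allI linb_diff rlinD)

lemma rlin_sum: "(\<And>x. x \<in> A \<Longrightarrow> rlin (F x)) \<Longrightarrow> rlin (\<lambda>g. \<Sum>x\<in>A. F x g)"
  unfolding rlin_def[of "\<lambda>g. \<Sum>x\<in>A. F x g"] fps_sum_nth by (intro allI linb_sum rlinD)

lemma rlin_sum_list: "(\<And>x. x \<in> set xs \<Longrightarrow> rlin (F x)) \<Longrightarrow> rlin (\<lambda>g. \<Sum>x\<leftarrow>xs. F x g)"
proof (induction xs)
  case Nil
  then show ?case by (simp add: rlin_def linb_0)
next
  case (Cons x xs)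
  have "rlin (\<lambda>g. F x g + (\<Sum>x\<leftarrow>xs. F x g))"
    by (rule rlin_add[OF Cons.prems Cons.IH[OF Cons.prems]]) simp_all
  then show ?case by simp
qed

lemma rlin_rc_mult: "rlin F \<Longrightarrow> rlin (\<lambda>g. rc x * F g)"
  unfolding rlin_def[of "\<lambda>g. rc x * F g"] rc_mult_nth by (intro allI linb_cmult rlinD)

lemma rlin_mult_rc: "rlin F \<Longrightarrow> rlin (\<lambda>g. F g * rc x ^ n)"
  unfolding rc_simps(7) rlin_def[of "\<lambda>g. F g * rc (x ^ n)"] mult_rc_nth by (intro allI linb_multc rlinD)

lemma rlin_rS_tau: "is_index k \<Longrightarrow> rlin (\<lambda>g. rS_tau \<tau> g k)"
  unfolding rS_tau_def
  by (rule rlin_sum_list, rule rlin_mult_rc, rule rlin_rS, rule is_index_coarsenings)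

lemma rsum_nth:
  "fps_nth (fps_nth (rsum_t X) a) c = (\<Sum>j\<le>c. fps_nth (fps_nth (X j) a) (c - j))"
  "fps_nth (fps_nth (rsum_s X) a) c = (\<Sum>j\<le>a. fps_nth (fps_nth (X j) (a - j)) c)"
  by (simp_all add: rsum_t_def rsum_s_def fps_sum_nth)

lemma rlin_rsum_t: "(\<And>j. rlin (F j)) \<Longrightarrow> rlin (\<lambda>g. rsum_t (\<lambda>j. F j g))"
  unfolding rlin_def[of "\<lambda>g. rsum_t (\<lambda>j. F j g)"] rsum_nth by (intro allI linb_sum rlinD)

lemma rlin_rsum_s: "(\<And>j. rlin (F j)) \<Longrightarrow> rlin (\<lambda>g. rsum_s (\<lambda>j. F j g))"
  unfolding rlin_def[of "\<lambda>g. rsum_s (\<lambda>j. F j g)"] rsum_nth by (intro allI linb_sum rlinD)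

lemma rlin_cyc:
  assumes k: "is_index k"
  shows "rlin (\<lambda>g. cyc_lhs \<tau> g k - cyc_rhs \<tau> g k)"
proof -
  have K: "is_index (drop i k @ take j k)" for i j using k by (simp add: is_index_parts)
  have up1: "is_index (uplus [j + 1] K)" if "is_index K" for j K
    using that by (cases K) (auto simp: uplus_def is_index_def)
  have up2: "is_index (uplus K [j + 1])" if "is_index K" for j K
    using that by (cases K rule: rev_cases) (auto simp: uplus_def is_index_def)
  have idx: "is_index ((j + 1) # drop i k @ take (i - 1) k @ [k ! (i - 1) - j])"
    if "j \<in> {0..<k ! (i - 1)}" for i j
    using that k by (simp add: is_index_parts)
  have star: "rlin (\<lambda>g. rc (real (sum_list k)) * rc \<tau> ^ length k * rS_tau 1 g [sum_list k + 1])"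
    unfolding rc_simps(7) rc_simps(5)[symmetric]
    by (rule rlin_rc_mult, rule rlin_rS_tau) (simp add: is_index_def)
  have lhs: "rlin (\<lambda>g. cyc_lhs \<tau> g k)"
    unfolding cyc_lhs_def
    by (rule rlin_diff[OF _ star], rule rlin_sum, rule rlin_sum, rule rlin_rS_tau, rule idx)
  have low: "rlin (\<lambda>g. rS_tau \<tau> g ((j + 1) # drop i k @ take i k)
            + rc (1 - \<tau>) * rS_tau \<tau> g (uplus [j + 1] (drop i k @ take i k)))" for i j
    by (rule rlin_add[OF rlin_rS_tau rlin_rc_mult[OF rlin_rS_tau[OF up1[OF K]]]])
       (simp add: is_index_parts(5) K)
  have high: "rlin (\<lambda>g. rS_tau \<tau> g (drop i k @ take i k @ [j + 1])
            + rc (1 - \<tau>) * rS_tau \<tau> g (uplus (drop i k @ take i k) [j + 1]))" for i j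
    by (rule rlin_add[OF rlin_rS_tau rlin_rc_mult[OF rlin_rS_tau[OF up2[OF K]]]])
       (use k in \<open>simp add: is_index_parts\<close>)
  have rhs: "rlin (\<lambda>g. cyc_rhs \<tau> g k)"
    unfolding cyc_rhs_def
    by (rule rlin_add[OF rlin_sum[OF rlin_rsum_t[OF low]] rlin_sum[OF rlin_rsum_s[OF high]]])
  show ?thesis by (rule rlin_diff[OF lhs rhs])
qed

lemma linb_nth_form:
  assumes "linb F"
  shows "\<exists>(m :: nat) x \<kappa> \<mu>. (\<forall>p<m. is_index (\<kappa> p) \<and> is_index (\<mu> p))
    \<and> (\<forall>g. F g = (\<Sum>p<m. x p * g (\<kappa> p) (\<mu> p)))"
proof -
  obtain ps where ps: "\<forall>(x, k, l)\<in>set ps. is_index k \<and> is_index l" "\<And>g. F g = (\<Sum>(x, k, l)\<leftarrow>ps. x * g k l)"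
    using assms unfolding linb_def by blast
  show ?thesis
  proof (intro exI conjI allI impI)
    show "F g = (\<Sum>p<length ps. fst (ps ! p) * g (fst (snd (ps ! p))) (snd (snd (ps ! p))))" for g
      unfolding ps(2) sum_list_sum_nth
      by (simp add: atLeast0LessThan case_prod_unfold)
    fix p assume "p < length ps"
    then have "ps ! p \<in> set ps" by (rule nth_mem)
    with ps(1) show "is_index (fst (snd (ps ! p)))" "is_index (snd (snd (ps ! p)))"
      by (auto simp: case_prod_unfold)
  qed
qed

lemma poly_infinite_zero:
  assumes "infinite S" "\<And>x. x \<in> S \<Longrightarrow> poly p x = 0"
  shows "p = (0 :: real poly)"
  using assms poly_roots_finite[of p] finite_subset[of S "{x. poly p x = 0}"] by blast

lemma zeta_reg_harmonic_asymp:
  assumes "is_index k" "1 \<le> c"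
  shows "negl (\<lambda>n. ln (real (Suc n)))
     (\<lambda>n. tz (Suc n ^ c) k - poly (zeta_reg Harmonic k) (real c * ln (real (Suc n)) + euler_mascheroni))"
proof -
  interpret asymptotic_reg Harmonic "\<lambda>n. tz (Suc n ^ c)" "\<lambda>n. ln (real (Suc n))" "real c" euler_mascheroni
    by (rule asymptotic_reg_tz[OF assms(2)])
  show ?thesis using zeta_reg_asymp(2)[OF assms(1)] unfolding asymp_def .
qed

text \<open>For each exponent \<open>c\<close> the combination is, up to negligible terms, a
  polynomial in \<open>ln M\<close>, which must vanish identically. At a fixed value of the
  logarithm the exponent is still free, so the polynomial in the second variable has infinitely many
  zeros and vanishes coefficientwise; then the first variable is freed.\<close>

lemma harmonic_double_relation:
  assumes \<kappa>: "\<And>p. p < m \<Longrightarrow> is_index (\<kappa> p)" and \<mu>: "\<And>p. p < m \<Longrightarrow> is_index (\<mu> p)"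
    and lim: "\<And>c. 1 \<le> c \<Longrightarrow> (\<lambda>n. \<Sum>p<m. x p * trunc (Suc n) (Suc n ^ c) (\<kappa> p) (\<mu> p)) \<longlonglongrightarrow> 0"
  shows "(\<Sum>p<m. smult (x p * coeff (zeta_reg Harmonic (\<mu> p)) j) (zeta_reg Harmonic (\<kappa> p))) = 0"
proof -
  let ?Z = "zeta_reg Harmonic" and ?L = "\<lambda>n. ln (real (Suc n))" and ?\<gamma> = "euler_mascheroni :: real"
  have L: "filterlim ?L at_top sequentially" by real_asymp
  have eq: "(\<Sum>p<m. x p * (poly (?Z (\<kappa> p)) (X + ?\<gamma>) * poly (?Z (\<mu> p)) (real c * X + ?\<gamma>))) = 0"
    if c: "1 \<le> c" for c X
  proof -
    define r where "r = (\<Sum>p<m. smult (x p) (pcompose (?Z (\<kappa> p)) [:?\<gamma>, 1:] * pcompose (?Z (\<mu> p)) [:?\<gamma>, real c:]))"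
    have r: "poly r X = (\<Sum>p<m. x p * (poly (?Z (\<kappa> p)) (X + ?\<gamma>) * poly (?Z (\<mu> p)) (real c * X + ?\<gamma>)))" for X
      by (simp add: r_def poly_sum poly_pcompose add.commute mult.commute[of "real c"])
    have "(\<lambda>n. \<Sum>p<m. x p * (trunc (Suc n) (Suc n ^ c) (\<kappa> p) (\<mu> p)
        - poly (?Z (\<kappa> p)) (?L n + ?\<gamma>) * poly (?Z (\<mu> p)) (real c * ?L n + ?\<gamma>))) \<longlonglongrightarrow> (\<Sum>p<m. 0)"
    proof (rule tendsto_sum)
      fix p assume "p \<in> {..<m}"
      then have "negl ?L (\<lambda>n. tz (Suc n ^ 1) (\<kappa> p) * tz (Suc n ^ c) (\<mu> p)
        - poly (?Z (\<kappa> p)) (real 1 * ?L n + ?\<gamma>) * poly (?Z (\<mu> p)) (real c * ?L n + ?\<gamma>))"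
        using \<kappa> \<mu> c by (intro negl_prod zeta_reg_harmonic_asymp) auto
      from negl_tendsto[OF this]
      show "(\<lambda>n. x p * (trunc (Suc n) (Suc n ^ c) (\<kappa> p) (\<mu> p)
        - poly (?Z (\<kappa> p)) (?L n + ?\<gamma>) * poly (?Z (\<mu> p)) (real c * ?L n + ?\<gamma>))) \<longlonglongrightarrow> 0"
        by (intro tendsto_mult_right_zero) (simp add: trunc_def)
    qed
    then have "(\<lambda>n. (\<Sum>p<m. x p * trunc (Suc n) (Suc n ^ c) (\<kappa> p) (\<mu> p)) - poly r (?L n)) \<longlonglongrightarrow> 0"
      by (simp add: r right_diff_distrib sum_subtractf)
    from tendsto_diff[OF lim[OF c] this] have "(\<lambda>n. poly r (?L n)) \<longlonglongrightarrow> 0" by simp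
    then have "r = 0" by (intro poly_tendsto_zero_imp_0[OF L]) simp_all
    then show ?thesis using r[of X] by simp
  qed
  \<comment> \<open>The points \<open>real c * X + ?\<gamma>\<close> are pairwise distinct for
    \<open>X \<noteq> 0\<close>; hence \<open>y \<noteq> ?\<gamma>\<close> below, which still leaves
    infinitely many \<open>y\<close>.\<close>
  have coeff: "(\<Sum>p<m. x p * poly (?Z (\<kappa> p)) (X + ?\<gamma>) * coeff (?Z (\<mu> p)) j) = 0" if X: "X \<noteq> 0" for X
  proof -
    define q where "q = (\<Sum>p<m. smult (x p * poly (?Z (\<kappa> p)) (X + ?\<gamma>)) (?Z (\<mu> p)))"
    have "q = 0"
    proof (rule poly_infinite_zero)
      have "inj_on (\<lambda>c. real c * X + ?\<gamma>) {1..}" using X by (auto simp: inj_on_def)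
      then show "infinite ((\<lambda>c. real c * X + ?\<gamma>) ` {1..})"
        by (simp add: finite_image_iff infinite_Ici)
      fix y assume "y \<in> (\<lambda>c. real c * X + ?\<gamma>) ` {1..}"
      then show "poly q y = 0" using eq by (auto simp: q_def poly_sum mult.assoc)
    qed
    then have "coeff q j = 0" by simp
    then show ?thesis by (simp add: q_def coeff_sum)
  qed
  show ?thesis
  proof (rule poly_infinite_zero)
    have "infinite (UNIV - {?\<gamma>})" by (simp add: infinite_UNIV_char_0)
    then show "infinite {y. y \<noteq> ?\<gamma>}" by (simp add: Collect_neg_eq Compl_eq_Diff_UNIV)
    fix y assume "y \<in> {y. y \<noteq> ?\<gamma>}"
    then show "poly (\<Sum>p<m. smult (x p * coeff (?Z (\<mu> p)) j) (?Z (\<kappa> p))) y = 0"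
      using coeff[of "y - ?\<gamma>"] by (simp add: poly_sum mult_ac)
  qed
qed

text \<open>In the shuffle case the linear transfer is applied to one argument at a time, the
  coefficient in the other argument serving as a scalar.\<close>

lemma zeta_reg_double_relation:
  assumes F: "linb F"
    and lim: "\<And>c. 1 \<le> c \<Longrightarrow> (\<lambda>n. F (trunc (Suc n) (Suc n ^ c))) \<longlonglongrightarrow> 0"
  shows "F (\<lambda>k l. coeff (zeta_reg b k) i * coeff (zeta_reg b l) j) = 0"
proof -
  obtain m :: nat and x \<kappa> \<mu>
    where ix: "\<forall>p<m. is_index (\<kappa> p) \<and> is_index (\<mu> p)"
      and eq: "\<forall>g. F g = (\<Sum>p<m. x p * g (\<kappa> p) (\<mu> p))"
    using linb_nth_form[OF F] by (elim exE conjE)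
  have F: "\<And>p. p < m \<Longrightarrow> is_index (\<kappa> p)" "\<And>p. p < m \<Longrightarrow> is_index (\<mu> p)"
    "\<And>g. F g = (\<Sum>p<m. x p * g (\<kappa> p) (\<mu> p))"
    using ix eq by simp_all
  have H: "(\<Sum>p<m. smult (x p * coeff (zeta_reg Harmonic (\<mu> p)) j) (zeta_reg Harmonic (\<kappa> p))) = 0" for j
    by (rule harmonic_double_relation[OF F(1,2) lim[unfolded F(3)]])
  show ?thesis
  proof (cases b)
    case Harmonic
    have "coeff (\<Sum>p<m. smult (x p * coeff (zeta_reg Harmonic (\<mu> p)) j) (zeta_reg Harmonic (\<kappa> p))) i = 0"
      unfolding H by simp
    then show ?thesis unfolding F(3) Harmonic by (simp add: coeff_sum mult_ac)
  next
    case Shuffle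
    have HS: "(\<Sum>p<m. smult (x p * coeff (zeta_reg Harmonic (\<mu> p)) j) (zeta_reg Shuffle (\<kappa> p))) = 0" for j
      by (rule harmonic_relation_imp_shuffle[OF _ _ H]) (use F(1,2) in simp_all)
    \<comment> \<open>Comparing coefficients exchanges the roles: the first argument becomes the
      scalar, already in its shuffle version, and the second argument is transferred next.\<close>
    have "(\<Sum>p<m. smult (x p * coeff (zeta_reg Shuffle (\<kappa> p)) i) (zeta_reg Harmonic (\<mu> p))) = 0"
    proof (rule poly_eqI)
      fix j
      have "coeff (\<Sum>p<m. smult (x p * coeff (zeta_reg Harmonic (\<mu> p)) j) (zeta_reg Shuffle (\<kappa> p))) i = 0"
        unfolding HS by simp
      then show "coeff (\<Sum>p<m. smult (x p * coeff (zeta_reg Shuffle (\<kappa> p)) i) (zeta_reg Harmonic (\<mu> p))) j = coeff 0 j"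
        by (simp add: coeff_sum mult_ac)
    qed
    then have "(\<Sum>p<m. smult (x p * coeff (zeta_reg Shuffle (\<kappa> p)) i) (zeta_reg Shuffle (\<mu> p))) = 0"
      by (intro harmonic_relation_imp_shuffle[of "{..<m}" \<mu>]) (use F(1,2) in simp_all)
    then have "coeff (\<Sum>p<m. smult (x p * coeff (zeta_reg Shuffle (\<kappa> p)) i) (zeta_reg Shuffle (\<mu> p))) j = 0"
      by simp
    then show ?thesis unfolding F(3) Shuffle by (simp add: coeff_sum mult_ac)
  qed
qed

section \<open>Coefficients in T_1 and T_2\<close>

definition bicoeff :: "nat \<Rightarrow> nat \<Rightarrow> biv \<Rightarrow> rbiv" where
  "bicoeff i j F = Abs_fps (\<lambda>a. Abs_fps (\<lambda>c. coeff (coeff (fps_nth (fps_nth F a) c) i) j))"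

lemma bicoeff_nth: "fps_nth (fps_nth (bicoeff i j F) a) c = coeff (coeff (fps_nth (fps_nth F a) c) i) j"
  by (simp add: bicoeff_def)

lemma biv_eqI: "(\<And>i j. bicoeff i j F = bicoeff i j G) \<Longrightarrow> F = G"
proof (intro fps_ext poly_eqI)
  fix a c i j assume "\<And>i j. bicoeff i j F = bicoeff i j G"
  then have "fps_nth (fps_nth (bicoeff i j F) a) c = fps_nth (fps_nth (bicoeff i j G) a) c" by simp
  then show "coeff (coeff (fps_nth (fps_nth F a) c) i) j = coeff (coeff (fps_nth (fps_nth G a) c) i) j"
    by (simp only: bicoeff_nth)
qed

lemma bicoeff_add: "bicoeff i j (F + G) = bicoeff i j F + bicoeff i j G"
  by (intro fps_ext) (simp add: bicoeff_nth)

lemma bicoeff_diff: "bicoeff i j (F - G) = bicoeff i j F - bicoeff i j G"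
  by (intro fps_ext) (simp add: bicoeff_nth)

lemma bicoeff_0: "bicoeff i j 0 = 0"
  by (intro fps_ext) (simp add: bicoeff_nth)

lemma bicoeff_sum: "bicoeff i j (\<Sum>x\<in>A. F x) = (\<Sum>x\<in>A. bicoeff i j (F x))"
  by (induction A rule: infinite_finite_induct) (simp_all add: bicoeff_0 bicoeff_add)

lemma bicoeff_sum_list: "bicoeff i j (\<Sum>x\<leftarrow>xs. F x) = (\<Sum>x\<leftarrow>xs. bicoeff i j (F x))"
  by (induction xs) (simp_all add: bicoeff_0 bicoeff_add)

lemma bicoeff_sc: "bicoeff i j (sc x * F) = rc x * bicoeff i j F"
  by (intro fps_ext) (simp add: bicoeff_nth rc_mult_nth sc_def)

lemma bicoeff_sc_power: "bicoeff i j (sc x ^ n * F) = rc x ^ n * bicoeff i j F"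
  by (induction n) (simp_all add: bicoeff_sc mult.assoc)

lemma bicoeff_sgn: "bicoeff i j ((-1) ^ n * F) = (-1) ^ n * bicoeff i j F"
  using bicoeff_diff[of i j 0 F] by (cases "even n") (simp_all add: bicoeff_0)

lemma bicoeff_lift: "fps_nth (fps_nth (bicoeff i j (lift_s A * lift_t B)) a) c
    = coeff (fps_nth A a) i * coeff (fps_nth B c) j"
proof -
  have "fps_nth (fps_nth (lift_s A * lift_t B) a) c = emb1 (fps_nth A a) * emb2 (fps_nth B c)"
    by (simp add: lift_s_def lift_t_def)
  also have "\<dots> = smult (fps_nth B c) (emb1 (fps_nth A a))" by (simp add: emb2_def)
  finally show ?thesis by (simp add: bicoeff_nth emb1_def coeff_map_poly mult.commute)
qed

lemma bicoeff_zeta_S: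
  "bicoeff i j (zeta_S b k) = rS (\<lambda>k l. coeff (zeta_reg b k) i * coeff (zeta_reg b l) j) k"
proof (intro fps_ext)
  fix a c
  have sgn: "fps_nth (fps_nth ((-1) ^ n * F) a) c = (-1) ^ n * fps_nth (fps_nth F a) c" for F :: rbiv and n a c
    by (cases "even n") simp_all
  have sgnp: "coeff ((-1) ^ n * p) i = (-1) ^ n * coeff p i" for p :: "real poly" and n i
    by (cases "even n") simp_all
  have ofn: "coeff (of_nat n * p) i = real n * coeff p i" for p :: "real poly" and n i
    by (simp add: of_nat_poly)
  have sq: "(-1) ^ c * ((-1) ^ c * x) = (x :: real)" for x c
    by (simp flip: mult.assoc power_mult_distrib)
  have shift: "coeff (fps_nth (zeta_shift b k) m) i
     = (-1) ^ m * (\<Sum>n\<in>comps k m. real (bcoef k n) * coeff (zeta_reg b (map2 (+) k n)) i)" for k m i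
    by (simp add: zeta_shift_def comps_def sgnp coeff_sum ofn)
  have neg: "coeff (fps_nth (fps_negvar (zeta_shift b k)) m) i
     = (\<Sum>n\<in>comps k m. real (bcoef k n) * coeff (zeta_reg b (map2 (+) k n)) i)" for k m i
    by (simp add: fps_negvar_def sgnp shift sq)
  show "fps_nth (fps_nth (bicoeff i j (zeta_S b k)) a) c
     = fps_nth (fps_nth (rS (\<lambda>k l. coeff (zeta_reg b k) i * coeff (zeta_reg b l) j) k) a) c"
    unfolding zeta_S_def bicoeff_sum bicoeff_sgn fps_sum_nth sgn bicoeff_lift shift neg rS_def fps_nth_Abs_fps
    by (intro sum.cong refl) (simp add: sum_product mult_ac sum_distrib_left)
qed

lemma bicoeff_zeta_S_tau:
  "bicoeff i j (zeta_S_tau \<tau> b k)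
     = rS_tau (of_rat \<tau>) (\<lambda>k l. coeff (zeta_reg b k) i * coeff (zeta_reg b l) j) k"
proof -
  have "bicoeff i j (zeta_S b l * sc x ^ n)
      = rS (\<lambda>k l. coeff (zeta_reg b k) i * coeff (zeta_reg b l) j) l * rc x ^ n" for l x n
    using bicoeff_sc_power[of i j x n "zeta_S b l"]
    unfolding bicoeff_zeta_S mult.commute[of "sc x ^ n"] mult.commute[of "rc x ^ n"] .
  then show ?thesis unfolding zeta_S_tau_def rS_tau_def bicoeff_sum_list by (simp only:)
qed

lemma bicoeff_fsum_t: "bicoeff i j (fsum_t X) = rsum_t (\<lambda>n. bicoeff i j (X n))"
proof (intro fps_ext)
  fix a c
  have "tvar ^ n = fps_const (fps_X ^ n)" for n by (simp add: tvar_def fps_const_power)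
  then have "fps_nth (fps_nth (X n * tvar ^ n) a) c = fps_nth (fps_nth (X n) a) (c - n)" if "n \<le> c" for n
    using that by (simp add: fps_X_power_mult_right_nth)
  then show "fps_nth (fps_nth (bicoeff i j (fsum_t X)) a) c
      = fps_nth (fps_nth (rsum_t (\<lambda>n. bicoeff i j (X n))) a) c"
    by (simp add: bicoeff_nth fsum_t_def rsum_t_def coeff_sum)
qed

lemma bicoeff_fsum_s: "bicoeff i j (fsum_s X) = rsum_s (\<lambda>n. bicoeff i j (X n))"
proof (intro fps_ext)
  fix a c
  have "fps_nth (X n * svar ^ n) a = fps_nth (X n) (a - n)" if "n \<le> a" for n
    using that by (simp add: svar_def fps_X_power_mult_right_nth)
  then show "fps_nth (fps_nth (bicoeff i j (fsum_s X)) a) c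
      = fps_nth (fps_nth (rsum_s (\<lambda>n. bicoeff i j (X n))) a) c"
    by (simp add: bicoeff_nth fsum_s_def rsum_s_def coeff_sum fps_sum_nth)
qed

theorem theorem6p10:
  fixes \<tau> :: rat and b :: regtype and k :: "nat list"
  assumes "is_index k" and "length k \<ge> 1" and "sum_list k > length k"
  shows "(\<Sum>i=1..length k. \<Sum>j=0..<k ! (i - 1).
            zeta_S_tau \<tau> b ((j + 1) # drop i k @ take (i - 1) k @ [k ! (i - 1) - j]))
         - sc (real (sum_list k)) * sc (of_rat \<tau>) ^ length k * zeta_S_star b [sum_list k + 1]
       = (\<Sum>i=1..length k. fsum_t (\<lambda>j.
            zeta_S_tau \<tau> b ((j + 1) # drop i k @ take i k)
            + sc (1 - of_rat \<tau>) * zeta_S_tau \<tau> b (uplus [j + 1] (drop i k @ take i k))))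
       + (\<Sum>i=1..length k. fsum_s (\<lambda>j.
            zeta_S_tau \<tau> b (drop i k @ take i k @ [j + 1])
            + sc (1 - of_rat \<tau>) * zeta_S_tau \<tau> b (uplus (drop i k @ take i k) [j + 1])))"
    (is "?L = ?R")
proof (rule biv_eqI)
  fix i j
  let ?g = "\<lambda>k l. coeff (zeta_reg b k) i * coeff (zeta_reg b l) j"
  have L: "bicoeff i j ?L = cyc_lhs (of_rat \<tau>) ?g k"
    unfolding cyc_lhs_def zeta_S_star_def bicoeff_diff bicoeff_sum mult.assoc bicoeff_sc bicoeff_sc_power
      bicoeff_zeta_S_tau of_rat_1 ..
  have R: "bicoeff i j ?R = cyc_rhs (of_rat \<tau>) ?g k"
    unfolding cyc_rhs_def bicoeff_add bicoeff_sum bicoeff_fsum_t bicoeff_fsum_s bicoeff_sc bicoeff_zeta_S_tau ..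
  \<comment> \<open>Every coefficient of the difference is a \<open>linb\<close> functional of
    \<open>g\<close> that tends to 0 along all truncations \<open>N = M ^ c\<close>, so it vanishes
    at \<open>?g\<close>.\<close>
  have "cyc_lhs (of_rat \<tau>) ?g k - cyc_rhs (of_rat \<tau>) ?g k = 0"
  proof (intro fps_ext)
    fix a c
    have "linb (\<lambda>g. fps_nth (fps_nth (cyc_lhs (of_rat \<tau>) g k - cyc_rhs (of_rat \<tau>) g k) a) c)"
      by (rule rlinD[OF rlin_cyc[OF assms(1)]])
    from zeta_reg_double_relation[OF this trunc_error_tendsto[OF assms], of b i j]
    show "fps_nth (fps_nth (cyc_lhs (of_rat \<tau>) ?g k - cyc_rhs (of_rat \<tau>) ?g k) a) c = fps_nth (fps_nth 0 a) c"
      by simp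
  qed
  then show "bicoeff i j ?L = bicoeff i j ?R" unfolding L R by (rule iffD1[OF right_minus_eq])
qed

end
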